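(* Let $r\ge 5$, let $\alpha:M\to\mathbb R^4$ be an immersion of class $C^r$ of a smooth oriented surface, and consider an axiumbilic point of $\alpha$. Consider a Monge chart with that point at the origin and a homothety of $\mathbb R^4$ such that the differential equation of axial lines is written as $$a_0(x,y)(dx^4-6dx^2dy^2+dy^4)+a_1(x,y)\,dx\,dy\,(dx^2-dy^2)+O(3)=0,$$ where $O(3)$ denotes terms of order $\ge3$ in $(x,y)$ and $$a_0(x,y)=y+\tfrac12a_{20}x^2+a_{11}xy+\tfrac12a_{02}y^2+\text{h.o.t.},\qquad a_1(x,y)=b_{01}y+\tfrac12b_{20}x^2+b_{11}xy+\tfrac12b_{02}y^2+\text{h.o.t.}$$ Then the following conditions are equivalent: (i) the curves $a_0=0$ and $a_1=0$ are regular and have quadratic contact at $0$; (ii) the axiumbilic point $0$ is of type $E^1_{4,5}$; (iii) the Lie-Cartan vector field defined in $\mathbb L_\alpha$ has a quadratic saddle-node in the projective axis (the projective line over $0$) with the center manifold transversal to the projective line.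
   Context: Let $I_\alpha=E\,dx^2+2F\,dx\,dy+G\,dy^2$ be the first fundamental form in a positive chart and $II_\alpha=\sum_{i=1,2}(e_i\,dx^2+2f_i\,dx\,dy+g_i\,dy^2)N_i$ the second fundamental form, $\{N_1,N_2\}$ being an orthonormal normal frame such that $\{\alpha_x,\alpha_y,N_1,N_2\}$ is positive. The ellipse of curvature at a point is the image of the unit circle of the tangent plane under $k_n(v)=II_\alpha(v)/I_\alpha(v)$. A point is axiumbilic if this ellipse has equal axes (is a circle). Outside axiumbilic points, the axial directions are the tangent directions mapped to the vertices of the ellipse; they are the solutions of the quartic differential equation of axial lines $$[A_0 G(EG-4F^2)+A_1F(2F^2-EG)]dy^4+[-8A_0EFG+A_1E(4F^2-EG)]dy^3dx+[-6A_0GE^2+3A_1FE^2]dy^2dx^2+A_1E^3dy\,dx^3+A_0E^3dx^4=0,$$ where $A_1=4G(EG-4F^2)(e_1^2+e_2^2)+32EFG(e_1f_1+e_2f_2)+4E^3(g_1^2+g_2^2)-8E^2G(e_1g_1+e_2g_2)-16E^2G(f_1^2+f_2^2)$ and $A_0=4F(EG-2F^2)(e_1^2+e_2^2)-4E(EG-4F^2)(e_1f_1+e_2f_2)+4E^3(f_1g_1+f_2g_2)-4E^2F(e_1g_1+e_2g_2)-8E^2F(f_1^2+f_2^2)$; the equation is considered up to a nonzero constant factor. Monge chart: after a rigid motion, $\alpha$ is locally $(x,y)\mapsto(x,y,R(x,y),S(x,y))$ with $R,S$ having zero value and zero first derivatives at the origin. With $p=dy/dx$, let $\mathcal G(x,y,p)$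 be the left-hand side of the equation of axial lines divided by $dx^4$. The Lie-Cartan surface is $\mathbb L_\alpha=\{\mathcal G=0\}$ in the projective bundle $PM$ of $M$, and the Lie-Cartan vector field, tangent to it, is $X=\mathcal G_p\,\partial_x+p\,\mathcal G_p\,\partial_y-(\mathcal G_x+p\,\mathcal G_y)\,\partial_p$. Quadratic contact of $a_0=0$ and $a_1=0$ at $0$: the Jacobian matrix $\partial(a_0,a_1)/\partial(x,y)$ at $(0,0)$ has rank $1$ and, writing $y(x)$ for the local solution of $a_0(x,y(x))=0$ (here $\partial a_0/\partial y(0,0)=1\neq0$) and $s(x)=a_1(x,y(x))$, one has $s'(0)=0$ and $s''(0)\ne0$. Definition. An axiumbilic point is of type $E^1_{4,5}$ if $\mathbb L_\alpha$ has, along the projective line over the point, exactly four singular points (critical points of $\mathcal G$), and these are of Morse type (nondegenerate). A quadratic saddle-node is a singular point of a vector field on a surface with one zero and one nonzero eigenvalue such that the restriction of the field to a center manifold has nonzero quadratic term.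
   Formalization: When b_01=0 the curve a_1=0 is not regular, so (i) fails although (ii) and (iii) can hold; regularity in (i) is therefore claimed only for b_01≠0, and for all b_01 the equivalence is proved with (i) read as quadratic contact (rank 1, s'(0)=0, s''(0)≠0). *)

theory Defs
  imports "HOL-Analysis.Analysis" "HOL-Library.Landau_Symbols"
begin

section \<open>Functions of class C^k on an open set\<close>

fun Ck_on :: "nat \<Rightarrow> ('a::real_normed_vector \<Rightarrow> 'b::real_normed_vector) \<Rightarrow> 'a set \<Rightarrow> bool" where
  "Ck_on 0 f U \<longleftrightarrow> continuous_on U f"
| "Ck_on (Suc k) f U \<longleftrightarrow>
     (\<forall>z\<in>U. f differentiable (at z)) \<and>
     (\<forall>v. Ck_on k (\<lambda>z. frechet_derivative f (at z) v) U)"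

abbreviation Dx :: "(real \<times> real \<Rightarrow> 'b::real_normed_vector) \<Rightarrow> real \<times> real \<Rightarrow> 'b" where
  "Dx f z \<equiv> frechet_derivative f (at z) (1, 0)"

abbreviation Dy :: "(real \<times> real \<Rightarrow> 'b::real_normed_vector) \<Rightarrow> real \<times> real \<Rightarrow> 'b" where
  "Dy f z \<equiv> frechet_derivative f (at z) (0, 1)"

section \<open>Surfaces in four-space\<close>

definition immersion_on :: "(real \<times> real \<Rightarrow> real^4) \<Rightarrow> (real \<times> real) set \<Rightarrow> bool" where
  "immersion_on \<alpha> U \<longleftrightarrow>
     (\<forall>z\<in>U. \<alpha> differentiable (at z) \<and> inj (frechet_derivative \<alpha> (at z)))"

definition ff_E :: "(real \<times> real \<Rightarrow> real^4) \<Rightarrow> real \<times> real \<Rightarrow> real" where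
  "ff_E \<alpha> z = Dx \<alpha> z \<bullet> Dx \<alpha> z"

definition ff_F :: "(real \<times> real \<Rightarrow> real^4) \<Rightarrow> real \<times> real \<Rightarrow> real" where
  "ff_F \<alpha> z = Dx \<alpha> z \<bullet> Dy \<alpha> z"

definition ff_G :: "(real \<times> real \<Rightarrow> real^4) \<Rightarrow> real \<times> real \<Rightarrow> real" where
  "ff_G \<alpha> z = Dy \<alpha> z \<bullet> Dy \<alpha> z"

text \<open>Coefficients of the second fundamental form in the direction of a unit normal vector \<open>n\<close>.\<close>

definition sf_e :: "(real \<times> real \<Rightarrow> real^4) \<Rightarrow> real^4 \<Rightarrow> real \<times> real \<Rightarrow> real" where
  "sf_e \<alpha> n z = Dx (Dx \<alpha>) z \<bullet> n"

definition sf_f :: "(real \<times> real \<Rightarrow> real^4) \<Rightarrow> real^4 \<Rightarrow> real \<times> real \<Rightarrow> real" where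
  "sf_f \<alpha> n z = Dy (Dx \<alpha>) z \<bullet> n"

definition sf_g :: "(real \<times> real \<Rightarrow> real^4) \<Rightarrow> real^4 \<Rightarrow> real \<times> real \<Rightarrow> real" where
  "sf_g \<alpha> n z = Dy (Dy \<alpha>) z \<bullet> n"

definition normal_frame :: "(real \<times> real \<Rightarrow> real^4) \<Rightarrow> real \<times> real \<Rightarrow> real^4 \<Rightarrow> real^4 \<Rightarrow> bool" where
  "normal_frame \<alpha> z n1 n2 \<longleftrightarrow>
     norm n1 = 1 \<and> norm n2 = 1 \<and> n1 \<bullet> n2 = 0 \<and>
     Dx \<alpha> z \<bullet> n1 = 0 \<and> Dy \<alpha> z \<bullet> n1 = 0 \<and> Dx \<alpha> z \<bullet> n2 = 0 \<and> Dy \<alpha> z \<bullet> n2 = 0 \<and>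
     det (vector [Dx \<alpha> z, Dy \<alpha> z, n1, n2] :: real^4^4) > 0"

text \<open>The forms I and II evaluated on the tangent vector with coordinates \<open>(u, v)\<close>.\<close>

definition form_I :: "(real \<times> real \<Rightarrow> real^4) \<Rightarrow> real \<times> real \<Rightarrow> real \<Rightarrow> real \<Rightarrow> real" where
  "form_I \<alpha> z u v = ff_E \<alpha> z * u^2 + 2 * ff_F \<alpha> z * u * v + ff_G \<alpha> z * v^2"

definition form_II ::
    "(real \<times> real \<Rightarrow> real^4) \<Rightarrow> real^4 \<Rightarrow> real^4 \<Rightarrow> real \<times> real \<Rightarrow> real \<Rightarrow> real \<Rightarrow> real^4" where
  "form_II \<alpha> n1 n2 z u v =
     (sf_e \<alpha> n1 z * u^2 + 2 * sf_f \<alpha> n1 z * u * v + sf_g \<alpha> n1 z * v^2) *\<^sub>R n1 +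
     (sf_e \<alpha> n2 z * u^2 + 2 * sf_f \<alpha> n2 z * u * v + sf_g \<alpha> n2 z * v^2) *\<^sub>R n2"

definition curvature_ellipse ::
    "(real \<times> real \<Rightarrow> real^4) \<Rightarrow> real^4 \<Rightarrow> real^4 \<Rightarrow> real \<times> real \<Rightarrow> (real^4) set" where
  "curvature_ellipse \<alpha> n1 n2 z =
     {form_II \<alpha> n1 n2 z u v /\<^sub>R form_I \<alpha> z u v | u v. form_I \<alpha> z u v = 1}"

text \<open>The radius 0 is allowed: the two (equal) axes of the ellipse may vanish.\<close>

definition axiumbilic :: "(real \<times> real \<Rightarrow> real^4) \<Rightarrow> real \<times> real \<Rightarrow> bool" where
  "axiumbilic \<alpha> z \<longleftrightarrow>
     (\<exists>n1 n2. normal_frame \<alpha> z n1 n2 \<and>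
       (\<exists>c\<in>span {n1, n2}. \<exists>\<rho>\<ge>0.
         curvature_ellipse \<alpha> n1 n2 z = {q \<in> span {n1, n2}. dist c q = \<rho>}))"

section \<open>The differential equation of axial lines\<close>

text \<open>\<open>N1\<close>, \<open>N2\<close> is a normal frame field; only the inner products of the vectors
  \<open>(e_1, e_2)\<close>, \<open>(f_1, f_2)\<close>, \<open>(g_1, g_2)\<close> enter, so the choice of frame is irrelevant.\<close>

definition axial_A1 ::
    "(real \<times> real \<Rightarrow> real^4) \<Rightarrow> (real \<times> real \<Rightarrow> real^4) \<Rightarrow> (real \<times> real \<Rightarrow> real^4)
      \<Rightarrow> real \<times> real \<Rightarrow> real" where
  "axial_A1 \<alpha> N1 N2 z =
     (let E = ff_E \<alpha> z; F = ff_F \<alpha> z; G = ff_G \<alpha> z;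
          e1 = sf_e \<alpha> (N1 z) z; f1 = sf_f \<alpha> (N1 z) z; g1 = sf_g \<alpha> (N1 z) z;
          e2 = sf_e \<alpha> (N2 z) z; f2 = sf_f \<alpha> (N2 z) z; g2 = sf_g \<alpha> (N2 z) z
      in 4 * G * (E * G - 4 * F^2) * (e1^2 + e2^2) + 32 * E * F * G * (e1 * f1 + e2 * f2)
         + 4 * E^3 * (g1^2 + g2^2) - 8 * E^2 * G * (e1 * g1 + e2 * g2)
         - 16 * E^2 * G * (f1^2 + f2^2))"

definition axial_A0 ::
    "(real \<times> real \<Rightarrow> real^4) \<Rightarrow> (real \<times> real \<Rightarrow> real^4) \<Rightarrow> (real \<times> real \<Rightarrow> real^4)
      \<Rightarrow> real \<times> real \<Rightarrow> real" where
  "axial_A0 \<alpha> N1 N2 z =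
     (let E = ff_E \<alpha> z; F = ff_F \<alpha> z; G = ff_G \<alpha> z;
          e1 = sf_e \<alpha> (N1 z) z; f1 = sf_f \<alpha> (N1 z) z; g1 = sf_g \<alpha> (N1 z) z;
          e2 = sf_e \<alpha> (N2 z) z; f2 = sf_f \<alpha> (N2 z) z; g2 = sf_g \<alpha> (N2 z) z
      in 4 * F * (E * G - 2 * F^2) * (e1^2 + e2^2) - 4 * E * (E * G - 4 * F^2) * (e1 * f1 + e2 * f2)
         + 4 * E^3 * (f1 * g1 + f2 * g2) - 4 * E^2 * F * (e1 * g1 + e2 * g2)
         - 8 * E^2 * F * (f1^2 + f2^2))"

text \<open>Left-hand side of the equation of axial lines, with \<open>u = dx\<close> and \<open>v = dy\<close>.\<close>

definition axial_form ::
    "(real \<times> real \<Rightarrow> real^4) \<Rightarrow> (real \<times> real \<Rightarrow> real^4) \<Rightarrow> (real \<times> real \<Rightarrow> real^4)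
      \<Rightarrow> real \<times> real \<Rightarrow> real \<Rightarrow> real \<Rightarrow> real" where
  "axial_form \<alpha> N1 N2 z u v =
     (let E = ff_E \<alpha> z; F = ff_F \<alpha> z; G = ff_G \<alpha> z;
          A0 = axial_A0 \<alpha> N1 N2 z; A1 = axial_A1 \<alpha> N1 N2 z
      in (A0 * G * (E * G - 4 * F^2) + A1 * F * (2 * F^2 - E * G)) * v^4
         + (- 8 * A0 * E * F * G + A1 * E * (4 * F^2 - E * G)) * v^3 * u
         + (- 6 * A0 * G * E^2 + 3 * A1 * F * E^2) * v^2 * u^2
         + A1 * E^3 * v * u^3 + A0 * E^3 * u^4)"

section \<open>Monge charts\<close>

definition monge :: "(real \<times> real \<Rightarrow> real) \<Rightarrow> (real \<times> real \<Rightarrow> real) \<Rightarrow> real \<times> real \<Rightarrow> real^4" where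
  "monge R S z = vector [fst z, snd z, R z, S z]"

text \<open>In the positive chart \<open>\<phi>\<close> of the surface, the immersion \<open>\<alpha>\<close> followed by a rigid motion
  \<open>q \<mapsto> T q + b\<close> and a homothety of ratio \<open>\<mu>\<close> is the graph of \<open>(R, S)\<close> over \<open>V\<close>.\<close>

definition monge_chart_at ::
    "nat \<Rightarrow> (real \<times> real \<Rightarrow> real^4) \<Rightarrow> (real \<times> real) set \<Rightarrow> real \<times> real
      \<Rightarrow> (real \<times> real) set \<Rightarrow> (real \<times> real \<Rightarrow> real) \<Rightarrow> (real \<times> real \<Rightarrow> real) \<Rightarrow> bool" where
  "monge_chart_at r \<alpha> U m V R S \<longleftrightarrow>
     open V \<and> 0 \<in> V \<and> Ck_on r R V \<and> Ck_on r S V \<and>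
     R 0 = 0 \<and> S 0 = 0 \<and>
     (R has_derivative (\<lambda>_. 0)) (at 0) \<and> (S has_derivative (\<lambda>_. 0)) (at 0) \<and>
     (\<exists>\<phi> T b \<mu>.
        Ck_on r \<phi> V \<and> inj_on \<phi> V \<and> \<phi> ` V \<subseteq> U \<and> \<phi> 0 = m \<and>
        (\<forall>z\<in>V. fst (Dx \<phi> z) * snd (Dy \<phi> z) - snd (Dx \<phi> z) * fst (Dy \<phi> z) > 0) \<and>
        orthogonal_transformation T \<and> det (matrix T) = 1 \<and> \<mu> > 0 \<and>
        (\<forall>z\<in>V. monge R S z = \<mu> *\<^sub>R (T (\<alpha> (\<phi> z)) + b)))"

section \<open>The Lie-Cartan surface and vector field\<close>

text \<open>A point of the projective line over a point of the surface is \<open>Some p\<close>, the direction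
  with slope \<open>dy/dx = p\<close>, or \<open>None\<close>, the direction \<open>dx = 0\<close>.  Near \<open>None\<close> the chart
  \<open>(x, y, q)\<close> of the projective bundle with \<open>q = dx/dy\<close> is used; there \<open>None\<close> is \<open>q = 0\<close>.\<close>

type_synonym pdir = "real option"

fun fiber_coord :: "pdir \<Rightarrow> real" where
  "fiber_coord (Some p) = p"
| "fiber_coord None = 0"

definition over_origin :: "pdir \<Rightarrow> real \<times> real \<times> real" where
  "over_origin l = (0, 0, fiber_coord l)"

fun lie_cartan_fun ::
    "(real \<times> real \<Rightarrow> real^4) \<Rightarrow> (real \<times> real \<Rightarrow> real^4) \<Rightarrow> (real \<times> real \<Rightarrow> real^4)
      \<Rightarrow> pdir \<Rightarrow> real \<times> real \<times> real \<Rightarrow> real" where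
  "lie_cartan_fun \<alpha> N1 N2 (Some _) (x, y, p) = axial_form \<alpha> N1 N2 (x, y) 1 p"
| "lie_cartan_fun \<alpha> N1 N2 None (x, y, q) = axial_form \<alpha> N1 N2 (x, y) q 1"

text \<open>The field in the second chart is obtained by exchanging the roles of \<open>x\<close> and \<open>y\<close>; on
  the surface, where both charts are defined, the two fields agree up to the nonvanishing
  factor \<open>- q^3\<close>.\<close>

fun lie_cartan_field ::
    "pdir \<Rightarrow> (real \<times> real \<times> real \<Rightarrow> real) \<Rightarrow> real \<times> real \<times> real \<Rightarrow> real \<times> real \<times> real" where
  "lie_cartan_field (Some _) f (x, y, p) =
     (let fx = frechet_derivative f (at (x, y, p)) (1, 0, 0);
          fy = frechet_derivative f (at (x, y, p)) (0, 1, 0);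
          fp = frechet_derivative f (at (x, y, p)) (0, 0, 1)
      in (fp, p * fp, - (fx + p * fy)))"
| "lie_cartan_field None f (x, y, q) =
     (let fx = frechet_derivative f (at (x, y, q)) (1, 0, 0);
          fy = frechet_derivative f (at (x, y, q)) (0, 1, 0);
          fq = frechet_derivative f (at (x, y, q)) (0, 0, 1)
      in (q * fq, fq, - (fy + q * fx)))"

section \<open>Singular points of Morse type\<close>

definition critical_zero :: "('a::real_normed_vector \<Rightarrow> real) \<Rightarrow> 'a \<Rightarrow> bool" where
  "critical_zero f z \<longleftrightarrow> f z = 0 \<and> (f has_derivative (\<lambda>_. 0)) (at z)"

definition hessian :: "('a::real_normed_vector \<Rightarrow> real) \<Rightarrow> 'a \<Rightarrow> 'a \<Rightarrow> 'a \<Rightarrow> real" where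
  "hessian f z u v = frechet_derivative (\<lambda>w. frechet_derivative f (at w) u) (at z) v"

definition nondegenerate_hessian :: "('a::real_normed_vector \<Rightarrow> real) \<Rightarrow> 'a \<Rightarrow> bool" where
  "nondegenerate_hessian f z \<longleftrightarrow> (\<forall>u. u \<noteq> 0 \<longrightarrow> (\<exists>v. hessian f z u v \<noteq> 0))"

definition lie_cartan_singular ::
    "(real \<times> real \<Rightarrow> real^4) \<Rightarrow> (real \<times> real \<Rightarrow> real^4) \<Rightarrow> (real \<times> real \<Rightarrow> real^4) \<Rightarrow> pdir set" where
  "lie_cartan_singular \<alpha> N1 N2 =
     {l. critical_zero (lie_cartan_fun \<alpha> N1 N2 l) (over_origin l)}"

definition type_E145 ::
    "(real \<times> real \<Rightarrow> real^4) \<Rightarrow> (real \<times> real \<Rightarrow> real^4) \<Rightarrow> (real \<times> real \<Rightarrow> real^4) \<Rightarrow> bool" where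
  "type_E145 \<alpha> N1 N2 \<longleftrightarrow>
     axiumbilic \<alpha> 0 \<and>
     finite (lie_cartan_singular \<alpha> N1 N2) \<and> card (lie_cartan_singular \<alpha> N1 N2) = 4 \<and>
     (\<forall>l\<in>lie_cartan_singular \<alpha> N1 N2.
        nondegenerate_hessian (lie_cartan_fun \<alpha> N1 N2 l) (over_origin l))"

section \<open>Quadratic saddle-nodes on a surface\<close>

text \<open>The surface is \<open>f = 0\<close>, regular at \<open>z\<close>, and \<open>X\<close> is a vector field on the ambient
  3-space that is tangent to it.\<close>

definition surface_tangent :: "('a::real_normed_vector \<Rightarrow> real) \<Rightarrow> 'a \<Rightarrow> 'a set" where
  "surface_tangent f z = {v. frechet_derivative f (at z) v = 0}"

definition has_saddle_node_eigenvalues ::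
    "('a::real_normed_vector \<Rightarrow> real) \<Rightarrow> ('a \<Rightarrow> 'a) \<Rightarrow> 'a \<Rightarrow> bool" where
  "has_saddle_node_eigenvalues f X z \<longleftrightarrow>
     f z = 0 \<and> f differentiable (at z) \<and> frechet_derivative f (at z) \<noteq> (\<lambda>_. 0) \<and>
     X z = 0 \<and> X differentiable (at z) \<and>
     (\<exists>v\<in>surface_tangent f z. v \<noteq> 0 \<and> frechet_derivative X (at z) v = 0) \<and>
     (\<exists>w\<in>surface_tangent f z. w \<noteq> 0 \<and>
        (\<exists>\<nu>. \<nu> \<noteq> 0 \<and> frechet_derivative X (at z) w = \<nu> *\<^sub>R w))"

text \<open>\<open>\<gamma>\<close> is a regular parametrization, near \<open>\<gamma> 0 = z\<close>, of an invariant curve of class C^1 in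
  the surface that is tangent at \<open>z\<close> to the kernel of the linear part; the restriction of \<open>X\<close>
  to the curve is the field \<open>h t d/dt\<close> in the parameter \<open>t\<close>.\<close>

definition center_manifold ::
    "('a::real_normed_vector \<Rightarrow> real) \<Rightarrow> ('a \<Rightarrow> 'a) \<Rightarrow> 'a \<Rightarrow> (real \<Rightarrow> 'a) \<Rightarrow> (real \<Rightarrow> real) \<Rightarrow> bool" where
  "center_manifold f X z \<gamma> h \<longleftrightarrow>
     \<gamma> 0 = z \<and>
     frechet_derivative X (at z) (vector_derivative \<gamma> (at 0)) = 0 \<and>
     (\<exists>\<delta>>0. \<gamma> C1_differentiable_on {-\<delta><..<\<delta>} \<and>
        (\<forall>t\<in>{-\<delta><..<\<delta>}. vector_derivative \<gamma> (at t) \<noteq> 0 \<and> f (\<gamma> t) = 0 \<and>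
            X (\<gamma> t) = h t *\<^sub>R vector_derivative \<gamma> (at t)))"

text \<open>Vanishing of the constant and linear terms of \<open>h\<close> is part of the limit condition.\<close>

definition quadratic_saddle_node_along ::
    "('a::real_normed_vector \<Rightarrow> real) \<Rightarrow> ('a \<Rightarrow> 'a) \<Rightarrow> 'a \<Rightarrow> (real \<Rightarrow> 'a) \<Rightarrow> bool" where
  "quadratic_saddle_node_along f X z \<gamma> \<longleftrightarrow>
     has_saddle_node_eigenvalues f X z \<and>
     (\<exists>h c. center_manifold f X z \<gamma> h \<and> c \<noteq> 0 \<and> ((\<lambda>t. h t / t^2) \<longlongrightarrow> c) (at 0))"

definition transversal_to_fiber :: "(real \<Rightarrow> real \<times> real \<times> real) \<Rightarrow> bool" where
  "transversal_to_fiber \<gamma> \<longleftrightarrow> vector_derivative \<gamma> (at 0) \<notin> span {(0, 0, 1)}"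

definition lie_cartan_saddle_node ::
    "(real \<times> real \<Rightarrow> real^4) \<Rightarrow> (real \<times> real \<Rightarrow> real^4) \<Rightarrow> (real \<times> real \<Rightarrow> real^4) \<Rightarrow> bool" where
  "lie_cartan_saddle_node \<alpha> N1 N2 \<longleftrightarrow>
     (\<exists>l \<gamma>. quadratic_saddle_node_along (lie_cartan_fun \<alpha> N1 N2 l)
              (lie_cartan_field l (lie_cartan_fun \<alpha> N1 N2 l)) (over_origin l) \<gamma> \<and>
            transversal_to_fiber \<gamma>)"

section \<open>Contact of plane curves\<close>

definition regular_curve_at_0 :: "(real \<times> real \<Rightarrow> real) \<Rightarrow> bool" where
  "regular_curve_at_0 a \<longleftrightarrow>
     a 0 = 0 \<and> a differentiable (at 0) \<and> frechet_derivative a (at 0) \<noteq> (\<lambda>_. 0)"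

definition quadratic_contact_at_0 ::
    "(real \<times> real \<Rightarrow> real) \<Rightarrow> (real \<times> real \<Rightarrow> real) \<Rightarrow> bool" where
  "quadratic_contact_at_0 a0 a1 \<longleftrightarrow>
     rank (vector [vector [Dx a0 0, Dy a0 0], vector [Dx a1 0, Dy a1 0]] :: real^2^2) = 1 \<and>
     (\<exists>y \<delta> s' s2. \<delta> > 0 \<and> y 0 = 0 \<and> continuous_on {-\<delta><..<\<delta>} y \<and>
        (\<forall>x\<in>{-\<delta><..<\<delta>}. a0 (x, y x) = 0 \<and>
           ((\<lambda>t. a1 (t, y t)) has_real_derivative s' x) (at x)) \<and>
        s' 0 = 0 \<and> (s' has_real_derivative s2) (at 0) \<and> s2 \<noteq> 0)"

end

theory Submission
  imports Defs "HOL-Real_Asymp.Real_Asymp"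
begin

text \<open>
  Put \<open>\<chi> = b20 - b01 * a20\<close>; each of the three conditions amounts to \<open>\<chi> \<noteq> 0\<close>.  On the curve
  \<open>a0 = 0\<close> one has \<open>y = - a20 x^2 / 2 + \<dots>\<close>, so that \<open>a1\<close> restricted to it is \<open>\<chi> x^2 / 2 + \<dots>\<close>.
  Write \<open>f\<close> for the left-hand side of the equation of axial lines divided by \<open>dx^4\<close>.  Over the
  origin the only nonvanishing derivative of \<open>f\<close> is \<open>f_y = \<phi> p / c\<close>, where
  \<open>\<phi> p = 1 - 6 p^2 + p^4 + b01 (p - p^3)\<close> has exactly four roots, all simple; at a root the
  determinant of the Hessian is \<open>- f_xx f_yp^2\<close>, and \<open>f_xx\<close> is \<open>\<chi> (p - p^3) / c\<close>.  Off the roots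
  the surface \<open>f = 0\<close> is a graph \<open>y = Y(x, p)\<close>, the field vanishes only at \<open>p = 0\<close>, and there it
  has the eigenvalues \<open>0\<close>, with eigenvector \<open>(1, 0, - a20)\<close>, and \<open>- 1 / c\<close>, along the fiber.  The
  first component \<open>f_p\<close> of the field is \<open>\<chi> x^2 / (2 c) + \<dots>\<close> along any center manifold.
  Conversely, for \<open>\<chi> \<noteq> 0\<close> the orbits are the solutions of a singular equation
  \<open>x^2 p' = - (2 / \<chi>) (p + a20 x + \<dots>)\<close>; with \<open>p = - a20 x + x^2 w\<close> and \<open>\<tau> = 1 / x\<close> it becomes
  \<open>dw/d\<tau> = (2 / \<chi>) w - F\<close>, where \<open>F\<close> has a limit and \<open>F_w\<close> tends to \<open>0\<close> as \<open>\<tau>\<close> tends to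
  infinity.  A bounded solution is a fixed point of a contraction, it converges as \<open>\<tau>\<close> tends to
  plus or minus infinity, and its two halves fit together to a center manifold of class \<open>C^1\<close>.
\<close>

section \<open>Bounded solutions of scalar differential equations\<close>

text \<open>Give \<open>x\<close> and \<open>p\<close> weight 1 and \<open>y\<close> weight 2. On
  the surface near the horizontal direction \<open>y\<close> is of order \<open>x^2\<close>, so to
  leading order only the terms in \<open>y\<close> and \<open>x^2\<close> of \<open>a0\<close> and
  \<open>a1\<close> count; this is why \<open>a11\<close>, \<open>a02\<close>, \<open>b11\<close>,
  \<open>b02\<close> leave no trace in \<open>\<chi>\<close>. The obstacle is smoothness of the
  center manifold at the origin, where its slope is a quotient of two vanishing components of the
  field. The slope \<open>- a20\<close> is the kernel direction, and passing to \<open>w\<close>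
  removes the first-order part of the numerator: divided by \<open>x^2\<close>, both components stay
  bounded. This costs a third derivative of the coefficients, hence five derivatives of the
  immersion. Continuity of \<open>p'\<close> at \<open>0\<close> then means convergence of
  \<open>w\<close>, and both sides of \<open>0\<close> lead to the same limit, the rest point of the
  limiting linear equation. For one sign of \<open>x\<close> the bounded solution is repelling, for
  the other its neighbours are bounded too, so center manifolds need not be unique. Extending the
  equation to all \<open>\<tau>\<close> selects one bounded solution in either case; the converse
  implication is proved for every center manifold.\<close>

lemma integrable_exp_times_bounded:
  fixes \<phi> :: "real \<Rightarrow> real"
  assumes "k > 0" "continuous_on UNIV \<phi>" "\<And>t. \<bar>\<phi> t\<bar> \<le> M"
  shows "(\<lambda>s. exp (- (k * s)) * \<phi> s) integrable_on {t..}"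
proof (rule integrable_on_all_intervals_integrable_bound)
  show "(\<lambda>s. M * exp (- (k * s))) integrable_on {t..}"
    using integrable_on_exp_minus_to_infinity[OF assms(1), of t] integrable_on_mult_right by fastforce
  show "norm (exp (- (k * s)) * \<phi> s) \<le> M * exp (- (k * s))" for s
    using assms(3)[of s] by (simp add: abs_mult mult.commute)
  fix a b :: real
  have "(\<lambda>s. exp (- (k * s)) * \<phi> s) integrable_on ({t..} \<inter> cbox a b)"
  proof -
    have "{t..} \<inter> cbox a b = {max t a..b}" by auto
    then show ?thesis
      by (auto intro!: integrable_continuous_interval continuous_intros
          continuous_on_subset[OF assms(2)])
  qed
  then show "(\<lambda>x. if x \<in> {t..} then exp (- (k * x)) * \<phi> x else 0) integrable_on cbox a b"
    using integrable_restrict_Int[of "{t..}" "\<lambda>s. exp (- (k * s)) * \<phi> s" "cbox a b"] by (simp add: Int_commute)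
qed

text \<open>The bounded solution of \<open>w' = k w - \<phi>\<close> for \<open>k > 0\<close>.\<close>

definition exp_resolvent :: "real \<Rightarrow> (real \<Rightarrow> real) \<Rightarrow> real \<Rightarrow> real" where
  "exp_resolvent k \<phi> t = exp (k * t) * integral {t..} (\<lambda>s. exp (- (k * s)) * \<phi> s)"

lemma exp_resolvent_diff:
  assumes "k > 0" "continuous_on UNIV \<phi>" "continuous_on UNIV \<psi>"
    and "\<And>t. \<bar>\<phi> t\<bar> \<le> M" "\<And>t. \<bar>\<psi> t\<bar> \<le> M"
  shows "exp_resolvent k \<phi> t - exp_resolvent k \<psi> t = exp_resolvent k (\<lambda>s. \<phi> s - \<psi> s) t"
proof -
  have "integral {t..} (\<lambda>s. exp (- (k * s)) * (\<phi> s - \<psi> s)) =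
     integral {t..} (\<lambda>s. exp (- (k * s)) * \<phi> s) - integral {t..} (\<lambda>s. exp (- (k * s)) * \<psi> s)"
    unfolding right_diff_distrib
    by (rule integral_diff) (use assms integrable_exp_times_bounded in blast)+
  then show ?thesis by (simp add: exp_resolvent_def right_diff_distrib)
qed

lemma exp_resolvent_bound:
  assumes "k > 0" "continuous_on UNIV \<phi>" "\<And>t. \<bar>\<phi> t\<bar> \<le> M"
  shows "\<bar>exp_resolvent k \<phi> t\<bar> \<le> M / k"
proof -
  have "((\<lambda>s. M * exp (- (k * s))) has_integral M * (exp (- (k * t))/k)) {t..}"
    using has_integral_mult_right[OF has_integral_exp_minus_to_infinity[OF assms(1), of t], of M] by simp
  moreover have "norm (integral {t..} (\<lambda>s. exp (- (k * s)) * \<phi> s)) \<le> integral {t..} (\<lambda>s. M * exp (- (k * s)))"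
  proof (rule integral_norm_bound_integral)
    show "norm (exp (- (k * s)) * \<phi> s) \<le> M * exp (- (k * s))" for s
      using assms(3)[of s] by (simp add: abs_mult mult.commute)
  qed (use assms calculation integrable_exp_times_bounded in blast)+
  ultimately have "\<bar>integral {t..} (\<lambda>s. exp (- (k * s)) * \<phi> s)\<bar> \<le> M * (exp (- (k * t))/k)"
    by (auto dest!: integral_unique)
  then have "exp (k * t) * \<bar>integral {t..} (\<lambda>s. exp (- (k * s)) * \<phi> s)\<bar> \<le> exp (k * t) * (M * (exp (- (k * t))/k))"
    by (intro mult_left_mono) auto
  also have "\<dots> = M / k" by (simp add: exp_minus field_simps)
  finally show ?thesis by (simp add: exp_resolvent_def abs_mult)
qed

lemma exp_resolvent_deriv:
  assumes "k > 0" "continuous_on UNIV \<phi>" "\<And>t. \<bar>\<phi> t\<bar> \<le> M"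
  shows "(exp_resolvent k \<phi> has_real_derivative k * exp_resolvent k \<phi> t - \<phi> t) (at t)"
proof -
  define e where "e = (\<lambda>s. exp (- (k * s)) * \<phi> s)"
  have ce: "continuous_on A e" for A
    unfolding e_def by (intro continuous_intros continuous_on_subset[OF assms(2)]) auto
  have int: "e integrable_on {s..}" for s
    unfolding e_def by (rule integrable_exp_times_bounded[OF assms])
  \<comment> \<open>Near \<open>t\<close> the tail integral is a constant minus an integral over a
    compact interval starting at \<open>t - 1\<close>; the fundamental theorem applies to the
    latter.\<close>
  have split: "integral {s..} e = integral {t-1..} e - integral {t-1..s} e" if "s \<in> {t-1..t+1}" for s
  proof -
    have "integral ({t-1..s} \<union> {s..}) e = integral {t-1..s} e + integral {s..} e"
    proof (rule integral_Un)
      show "negligible ({t - 1..s} \<inter> {s..})"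
        by (rule negligible_subset[of "{s}"]) auto
    qed (use ce int in \<open>auto intro: integrable_continuous_interval\<close>)
    moreover have "{t-1..s} \<union> {s..} = {t-1..}" using that by auto
    ultimately show ?thesis by simp
  qed
  have "((\<lambda>s. integral {t-1..s} e) has_real_derivative e t) (at t within {t-1..t+1})"
    by (rule integral_has_real_derivative) (use ce in auto)
  then have "((\<lambda>s. integral {t-1..s} e) has_real_derivative e t) (at t)"
    by (subst (asm) at_within_Icc_at) auto
  then have "((\<lambda>s. integral {t-1..} e - integral {t-1..s} e) has_real_derivative - e t) (at t)"
    by (auto intro!: derivative_eq_intros)
  then have d: "((\<lambda>s. integral {s..} e) has_real_derivative - e t) (at t)"
  proof (rule has_field_derivative_transform_within_open[where S="{t-1<..<t+1}"])
    show "integral {t-1..} e - integral {t-1..s} e = integral {s..} e" if "s \<in> {t-1<..<t+1}" for s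
      using split[of s] that by (metis atLeastAtMost_iff greaterThanLessThan_iff less_imp_le)
  qed auto
  have "((\<lambda>s. exp (k * s) * integral {s..} e) has_real_derivative
      k * (exp (k * t) * integral {t..} e) - exp (k * t) * e t) (at t)"
  proof (rule DERIV_cong[OF DERIV_mult[OF _ d]])
    show "((\<lambda>s. exp (k * s)) has_real_derivative k * exp (k * t)) (at t)"
      by (auto intro!: derivative_eq_intros)
  qed (simp add: algebra_simps)
  moreover have "exp (k * t) * exp (- (k * t)) = 1" by (simp flip: exp_add)
  then have "exp (k * t) * e t = \<phi> t" unfolding e_def by (metis mult.assoc mult_1)
  ultimately show ?thesis
    unfolding exp_resolvent_def[abs_def] e_def by simp
qed

text \<open>The resolvent has norm at most \<open>1 / k\<close> on bounded continuous functions, so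
  its composition with \<open>u \<mapsto> F t (u t)\<close> contracts by the factor
  \<open>L / k\<close>.\<close>

lemma bounded_solution_pos:
  fixes F :: "real \<Rightarrow> real \<Rightarrow> real"
  assumes k: "k > 0" and F: "continuous_on UNIV (\<lambda>(t, w). F t w)"
    and M: "\<And>t w. \<bar>F t w\<bar> \<le> M" and L: "\<And>t u v. \<bar>F t u - F t v\<bar> \<le> L * \<bar>u - v\<bar>"
    and Lk: "0 \<le> L" "L < k"
  obtains w where "\<And>t. (w has_real_derivative k * w t - F t (w t)) (at t)" "\<And>t. \<bar>w t\<bar> \<le> M / k"
proof -
  have cF: "continuous_on UNIV (\<lambda>t. F t (u t))" if "continuous_on UNIV u" for u
    using continuous_on_compose2[OF F continuous_on_Pair[OF continuous_on_id that]] by simp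
  define \<Phi> where "\<Phi> u = exp_resolvent k (\<lambda>t. F t (apply_bcontfun u t))" for u :: "real \<Rightarrow>\<^sub>C real"
  have d: "(\<Phi> u has_real_derivative k * \<Phi> u t - F t (apply_bcontfun u t)) (at t)" for u t
    unfolding \<Phi>_def by (rule exp_resolvent_deriv[OF k cF M]) auto
  have b: "\<bar>\<Phi> u t\<bar> \<le> M / k" for u t
    unfolding \<Phi>_def by (rule exp_resolvent_bound[OF k cF M]) auto
  have "\<Phi> u \<in> bcontfun" for u
    unfolding bcontfun_def
    using boundedI[of "range (\<Phi> u)" "M / k"] b[of u]
      DERIV_continuous_on[OF has_field_derivative_at_within[OF d[of u]]] by auto
  then have ap: "apply_bcontfun (Bcontfun (\<Phi> u)) = \<Phi> u" for u
    by (simp add: Bcontfun_inverse)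
  have "\<exists>!u. Bcontfun (\<Phi> u) = u"
  proof (rule banach_fix_type[of "L / k"])
    show "\<forall>u v. dist (Bcontfun (\<Phi> u)) (Bcontfun (\<Phi> v)) \<le> L / k * dist u v"
    proof (intro allI dist_bound)
      fix u v :: "real \<Rightarrow>\<^sub>C real" and t
      have "\<bar>exp_resolvent k (\<lambda>s. F s (apply_bcontfun u s) - F s (apply_bcontfun v s)) t\<bar>
          \<le> (L * dist u v) / k"
      proof (rule exp_resolvent_bound[OF k])
        show "continuous_on UNIV (\<lambda>s. F s (apply_bcontfun u s) - F s (apply_bcontfun v s))"
          by (intro continuous_intros cF) auto
        show "\<bar>F s (apply_bcontfun u s) - F s (apply_bcontfun v s)\<bar> \<le> L * dist u v" for s
        proof -
          have "\<bar>apply_bcontfun u s - apply_bcontfun v s\<bar> \<le> dist u v"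
            using dist_bounded[of u s v] by (simp add: dist_real_def)
          then show ?thesis using L[of s] Lk(1) by (meson mult_left_mono order_trans)
        qed
      qed
      also have "exp_resolvent k (\<lambda>s. F s (apply_bcontfun u s) - F s (apply_bcontfun v s)) t
          = \<Phi> u t - \<Phi> v t"
        unfolding \<Phi>_def by (rule exp_resolvent_diff[symmetric, OF k cF cF M M]) auto
      finally show "dist (apply_bcontfun (Bcontfun (\<Phi> u)) t) (apply_bcontfun (Bcontfun (\<Phi> v)) t)
          \<le> L / k * dist u v"
        by (simp add: ap dist_real_def)
    qed
  qed (use k Lk in auto)
  then obtain u where u: "Bcontfun (\<Phi> u) = u" by auto
  have "apply_bcontfun u = \<Phi> u" using ap[of u] u by simp
  then show ?thesis using that[of "apply_bcontfun u"] d[of u] b[of u] by simp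
qed

lemma bounded_solution:
  fixes F :: "real \<Rightarrow> real \<Rightarrow> real"
  assumes k: "k \<noteq> 0" and F: "continuous_on UNIV (\<lambda>(t, w). F t w)"
    and M: "\<And>t w. \<bar>F t w\<bar> \<le> M" and L: "\<And>t u v. \<bar>F t u - F t v\<bar> \<le> L * \<bar>u - v\<bar>"
    and Lk: "0 \<le> L" "L < \<bar>k\<bar>"
  obtains w where "\<And>t. (w has_real_derivative k * w t - F t (w t)) (at t)" "\<And>t. \<bar>w t\<bar> \<le> M / \<bar>k\<bar>"
proof (cases "k > 0")
  case True
  then show ?thesis using bounded_solution_pos[OF True F M L Lk(1)] Lk(2) that by auto
next
  case False
  \<comment> \<open>Reversing time turns the rate \<open>k\<close> into \<open>- k\<close> and
    \<open>F t w\<close> into \<open>- F (- t) w\<close>.\<close>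
  with k have k': "-k > 0" by simp
  have "continuous_on UNIV (\<lambda>z. - (\<lambda>(t, w). F t w) (- fst z, snd z))"
    by (intro continuous_intros continuous_on_compose2[OF F, of UNIV "\<lambda>z. (- fst z, snd z)"]) auto
  then have F': "continuous_on UNIV (\<lambda>(t, w). - F (-t) w)" by (simp add: case_prod_unfold)
  obtain w where w: "\<And>t. (w has_real_derivative (-k) * w t - (- F (-t) (w t))) (at t)"
      "\<And>t. \<bar>w t\<bar> \<le> M / (-k)"
    by (rule bounded_solution_pos[OF k' F', of M L])
       (use M L Lk False in \<open>auto simp: abs_minus_commute\<close>)
  show ?thesis
  proof (rule that[of "\<lambda>t. w (-t)"])
    show "((\<lambda>t. w (-t)) has_real_derivative k * w (-t) - F t (w (-t))) (at t)" for t
      by (rule DERIV_cong[OF DERIV_chain2[where g=uminus and x=t, OF w(1)[of "-t"]]]) (auto intro!: derivative_eq_intros)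
    show "\<bar>w (-t)\<bar> \<le> M / \<bar>k\<bar>" for t using w(2)[of "-t"] False by simp
  qed
qed

text \<open>In the variable \<open>1 / x\<close> the equation is \<open>w' = k w - F\<close> on a half-line; \<open>F\<close> is extended to the
  plane by clamping both arguments.\<close>

lemma one_sided_solution:
  fixes F :: "real \<Rightarrow> real \<Rightarrow> real"
  assumes k: "k \<noteq> 0" and \<delta>: "\<delta> > 0" and B: "B \<ge> 0"
    and F: "continuous_on ({0<..\<delta>} \<times> {-B..B}) (\<lambda>(x, w). F x w)"
    and M: "\<And>x w. x \<in> {0<..\<delta>} \<Longrightarrow> w \<in> {-B..B} \<Longrightarrow> \<bar>F x w\<bar> \<le> \<bar>k\<bar> * B"
    and L: "\<And>x u v. x \<in> {0<..\<delta>} \<Longrightarrow> u \<in> {-B..B} \<Longrightarrow> v \<in> {-B..B} \<Longrightarrow>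
              \<bar>F x u - F x v\<bar> \<le> L * \<bar>u - v\<bar>"
    and Lk: "0 \<le> L" "L < \<bar>k\<bar>"
    and lim: "((\<lambda>(x, w). F x w) \<longlongrightarrow> F0) (at_right 0 \<times>\<^sub>F principal {-B..B})"
  obtains w where "\<And>x. x \<in> {0<..<\<delta>} \<Longrightarrow>
        (w has_real_derivative - (k * w x - F x (w x)) / x^2) (at x)"
    "\<And>x. x \<in> {0<..<\<delta>} \<Longrightarrow> \<bar>w x\<bar> \<le> B" "(w \<longlongrightarrow> F0 / k) (at_right 0)"
proof -
  define cl where "cl u = max (-B) (min B u)" for u
  have cl: "cl u \<in> {-B..B}" "\<bar>cl u - cl v\<bar> \<le> \<bar>u - v\<bar>" "\<bar>u\<bar> \<le> B \<Longrightarrow> cl u = u" for u v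
    using B by (auto simp: cl_def)
  define X where "X t = 1 / max (1/\<delta>) t" for t
  have X: "X t \<in> {0<..\<delta>}" for t
  proof -
    define m where "m = max (1/\<delta>) t"
    have "1 / \<delta> \<le> m" by (simp add: m_def)
    moreover have "0 < 1 / \<delta>" using \<delta> by simp
    ultimately have "m > 0" by linarith
    with \<open>1 / \<delta> \<le> m\<close> \<delta> have "1 / m \<le> \<delta>" by (simp add: field_simps)
    with \<open>m > 0\<close> show ?thesis by (simp add: X_def m_def)
  qed
  define G where "G t u = F (X t) (cl u)" for t u
  have "continuous_on UNIV (\<lambda>z. (X (fst z), cl (snd z)))"
    unfolding X_def cl_def using \<delta> by (intro continuous_intros) (auto simp: max_def)
  from continuous_on_compose2[OF F this] have G: "continuous_on UNIV (\<lambda>(t, u). G t u)"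
    using X cl(1) by (simp add: case_prod_unfold G_def mem_Times_iff image_subset_iff)
  have GM: "\<bar>G t u\<bar> \<le> \<bar>k\<bar> * B" for t u
    unfolding G_def by (intro M X cl)
  have GL: "\<bar>G t u - G t v\<bar> \<le> L * \<bar>u - v\<bar>" for t u v
  proof -
    have "\<bar>G t u - G t v\<bar> \<le> L * \<bar>cl u - cl v\<bar>"
      unfolding G_def by (intro L X cl)
    also have "\<dots> \<le> L * \<bar>u - v\<bar>"
      by (intro mult_left_mono cl Lk)
    finally show ?thesis .
  qed
  obtain v where v: "\<And>t. (v has_real_derivative k * v t - G t (v t)) (at t)"
      "\<And>t. \<bar>v t\<bar> \<le> (\<bar>k\<bar> * B) / \<bar>k\<bar>"
    by (rule bounded_solution[OF k G GM GL Lk]) blast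
  \<comment> \<open>The bound \<open>\<bar>k\<bar> * B\<close> on \<open>F\<close> is made for this:
    the solution stays within \<open>{-B..B}\<close> and never feels the clamping in
    \<open>w\<close>.\<close>
  have vB: "\<bar>v t\<bar> \<le> B" for t using v(2)[of t] k by simp
  define w where "w x = v (1 / x)" for x
  have wB: "\<bar>w x\<bar> \<le> B" for x by (simp add: w_def vB)
  have GF: "G (1 / x) (w x) = F x (w x)" if "x \<in> {0<..<\<delta>}" for x
  proof -
    have "max (1/\<delta>) (1/x) = 1/x" using that by (auto simp: max_def field_simps)
    then show ?thesis using wB cl by (simp add: G_def X_def)
  qed
  have w: "(w has_real_derivative - (k * w x - F x (w x)) / x^2) (at x)" if x: "x \<in> {0<..<\<delta>}" for x
  proof -
    have "((\<lambda>x. 1 / x) has_real_derivative - 1 / x^2) (at x)"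
      using x by (auto intro!: derivative_eq_intros simp: power2_eq_square)
    from DERIV_chain2[where f = v, OF v(1) this]
    have "(w has_real_derivative (k * w x - G (1/x) (w x)) * (- 1 / x^2)) (at x)"
      by (simp add: w_def[abs_def])
    moreover have "(k * w x - G (1/x) (w x)) * (- 1 / x^2) = - (k * w x - F x (w x)) / x^2"
      unfolding GF[OF x] using x by (simp add: field_simps)
    ultimately show ?thesis by simp
  qed
  have ev: "\<forall>\<^sub>F x in at_right 0. x \<in> {0<..<\<delta>}"
    using \<delta> by (auto simp: eventually_at_right intro: exI[of _ \<delta>])
  have "LIM x at_right 0. (x, w x) :> at_right 0 \<times>\<^sub>F principal {-B..B}"
    by (intro filterlim_Pair filterlim_ident)
       (use wB in \<open>auto simp: filterlim_principal abs_le_iff minus_le_iff\<close>)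
  from filterlim_compose[OF lim this] have Fw: "((\<lambda>x. F x (w x)) \<longlongrightarrow> F0) (at_right 0)" by simp
  \<comment> \<open>Integrating factor: \<open>(w - F0 / k) * e\<close> has derivative
    \<open>e * (F - F0) / x^2\<close>, while \<open>e\<close> has derivative
    \<open>e * k / x^2\<close>. The ratio of derivatives \<open>(F - F0) / k\<close> tends to
    \<open>0\<close>.\<close>
  define e where "e x = exp (- k / x)" for x :: real
  have e0: "e x \<noteq> 0" for x by (simp add: e_def)
  have De: "\<forall>\<^sub>F x in at_right 0. (e has_real_derivative e x * (k / x^2)) (at x)"
    using ev by eventually_elim
      (auto intro!: derivative_eq_intros simp: e_def[abs_def] field_simps power2_eq_square)
  have Dn: "\<forall>\<^sub>F x in at_right 0. ((\<lambda>x. (w x - F0 / k) * e x) has_real_derivative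
      e x * ((F x (w x) - F0) / x^2)) (at x)"
    using De ev
  proof eventually_elim
    case (elim x)
    have "((\<lambda>x. w x - F0 / k) has_real_derivative - (k * w x - F x (w x)) / x^2) (at x)"
      using w[OF elim(2)] by (auto intro!: derivative_eq_intros)
    then show ?case
      by (rule DERIV_cong[OF DERIV_mult[OF _ elim(1)]])
         (use k elim(2) in \<open>simp add: field_simps\<close>)
  qed
  have ne: "\<forall>\<^sub>F x in at_right 0. e x * (k / x^2) \<noteq> 0"
    using ev by eventually_elim (use k e0 in auto)
  have quot: "((\<lambda>x. e x * ((F x (w x) - F0) / x^2) / (e x * (k / x^2))) \<longlongrightarrow> 0) (at_right 0)"
  proof (rule Lim_transform_eventually)
    show "((\<lambda>x. (F x (w x) - F0) / k) \<longlongrightarrow> 0) (at_right 0)"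
      using tendsto_divide[OF tendsto_diff[OF Fw tendsto_const] tendsto_const, of k F0] k by simp
    show "\<forall>\<^sub>F x in at_right 0. (F x (w x) - F0) / k = e x * ((F x (w x) - F0) / x^2) / (e x * (k / x^2))"
      using ev by eventually_elim (use e0 in simp)
  qed
  \<comment> \<open>The sign of \<open>k\<close> decides the form of l'Hopital's rule. For
    \<open>k > 0\<close> the factor \<open>e\<close> tends to \<open>0\<close>, and boundedness of
    \<open>w\<close> makes the numerator tend to \<open>0\<close> as well; for \<open>k < 0\<close>
    the denominator \<open>e\<close> tends to infinity, which is enough.\<close>
  have "((\<lambda>x. (w x - F0 / k) * e x / e x) \<longlongrightarrow> 0) (at_right 0)"
  proof (cases "k > 0")
    case True
    have e_lim: "(e \<longlongrightarrow> 0) (at_right 0)"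
      unfolding e_def using True by real_asymp
    have "((\<lambda>x. (w x - F0 / k) * e x) \<longlongrightarrow> 0) (at_right 0)"
    proof (rule Lim_null_comparison)
      show "\<forall>\<^sub>F x in at_right 0. norm ((w x - F0 / k) * e x) \<le> (B + \<bar>F0 / k\<bar>) * e x"
      proof (rule always_eventually, rule allI)
        fix x
        have "\<bar>w x - F0 / k\<bar> \<le> B + \<bar>F0 / k\<bar>" using wB[of x] by linarith
        then have "\<bar>w x - F0 / k\<bar> * e x \<le> (B + \<bar>F0 / k\<bar>) * e x"
          by (rule mult_right_mono) (simp add: e_def)
        then show "norm ((w x - F0 / k) * e x) \<le> (B + \<bar>F0 / k\<bar>) * e x"
          by (simp add: abs_mult) (simp add: e_def)
      qed
      show "((\<lambda>x. (B + \<bar>F0 / k\<bar>) * e x) \<longlongrightarrow> 0) (at_right 0)"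
        using tendsto_mult_left[OF e_lim] by simp
    qed
    then show ?thesis
      by (rule lhopital_right_0[OF _ e_lim _ ne Dn De quot]) (use e0 in simp)
  next
    case False
    with k have "k < 0" by simp
    then have "LIM x at_right 0. e x :> at_top"
      unfolding e_def by real_asymp
    then show ?thesis
      by (rule lhopital_right_0_at_top[OF _ ne Dn De quot])
  qed
  then have "((\<lambda>x. w x - F0 / k) \<longlongrightarrow> 0) (at_right 0)" using e0 by simp
  then have "(w \<longlongrightarrow> F0 / k) (at_right 0)" by (simp add: LIM_zero_iff)
  with w wB show ?thesis using that by blast
qed

text \<open>The reflection \<open>x \<mapsto> - x\<close> replaces \<open>k\<close> and
  \<open>F x w\<close> by \<open>- k\<close> and \<open>- F (- x) w\<close>. The limit of the left
  half is therefore \<open>- F0 / - k\<close>, equal to that of the right half, so the halves join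
  continuously.\<close>

lemma two_sided_solution:
  fixes F :: "real \<Rightarrow> real \<Rightarrow> real"
  assumes k: "k \<noteq> 0" and \<delta>: "\<delta> > 0" and B: "B \<ge> 0"
    and F: "continuous_on (({-\<delta>..\<delta>} - {0}) \<times> {-B..B}) (\<lambda>(x, w). F x w)"
    and M: "\<And>x w. x \<in> {-\<delta>..\<delta>} - {0} \<Longrightarrow> w \<in> {-B..B} \<Longrightarrow> \<bar>F x w\<bar> \<le> \<bar>k\<bar> * B"
    and L: "\<And>x u v. x \<in> {-\<delta>..\<delta>} - {0} \<Longrightarrow> u \<in> {-B..B} \<Longrightarrow> v \<in> {-B..B} \<Longrightarrow>
              \<bar>F x u - F x v\<bar> \<le> L * \<bar>u - v\<bar>"
    and Lk: "0 \<le> L" "L < \<bar>k\<bar>"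
    and lim: "((\<lambda>(x, w). F x w) \<longlongrightarrow> F0) (at 0 \<times>\<^sub>F principal {-B..B})"
  obtains w where "\<And>x. x \<in> {-\<delta><..<\<delta>} - {0} \<Longrightarrow>
        (w has_real_derivative - (k * w x - F x (w x)) / x^2) (at x)"
    "\<And>x. x \<in> {-\<delta><..<\<delta>} - {0} \<Longrightarrow> \<bar>w x\<bar> \<le> B" "(w \<longlongrightarrow> F0 / k) (at 0)"
proof -
  have 1: "continuous_on ({0<..\<delta>} \<times> {-B..B}) (\<lambda>(x, w). F x w)"
    by (rule continuous_on_subset[OF F]) auto
  have 2: "((\<lambda>(x, w). F x w) \<longlongrightarrow> F0) (at_right 0 \<times>\<^sub>F principal {-B..B})"
    by (rule tendsto_mono[OF prod_filter_mono lim]) (auto intro: at_le)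
  obtain u where u: "\<And>x. x \<in> {0<..<\<delta>} \<Longrightarrow>
        (u has_real_derivative - (k * u x - F x (u x)) / x^2) (at x)"
    "\<And>x. x \<in> {0<..<\<delta>} \<Longrightarrow> \<bar>u x\<bar> \<le> B" "(u \<longlongrightarrow> F0 / k) (at_right 0)"
    by (rule one_sided_solution[OF k \<delta> B 1 M L Lk 2]) auto
  have "continuous_on ({0<..\<delta>} \<times> {-B..B}) (\<lambda>z. - (\<lambda>(x, w). F x w) (- fst z, snd z))"
    by (intro continuous_on_minus continuous_on_compose2[OF F, of _ "\<lambda>z. (- fst z, snd z)"]
        continuous_intros) auto
  then have 3: "continuous_on ({0<..\<delta>} \<times> {-B..B}) (\<lambda>(x, w). - F (-x) w)"
    by (simp add: case_prod_unfold)
  have "LIM z at_right (0::real) \<times>\<^sub>F principal {-B..B}. (- fst z, snd z) :> at 0 \<times>\<^sub>F principal {-B..B}"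
  proof (rule filterlim_Pair)
    have "LIM x at_right (0::real). - x :> at_left 0"
      by (simp add: filterlim_def at_left_minus[of 0])
    then have "LIM x at_right (0::real). - x :> at 0"
      by (rule filterlim_mono) (auto intro: at_le)
    show "LIM z at_right (0::real) \<times>\<^sub>F principal {-B..B}. - fst z :> at 0"
      by (rule filterlim_compose[OF \<open>LIM x at_right (0::real). - x :> at 0\<close> filterlim_fst])
  qed (rule filterlim_snd)
  from tendsto_minus[OF filterlim_compose[OF lim this]]
  have 4: "((\<lambda>(x, w). - F (-x) w) \<longlongrightarrow> - F0) (at_right 0 \<times>\<^sub>F principal {-B..B})"
    by (simp add: case_prod_unfold)
  have 5: "\<bar>- F (-x) a - - F (-x) b\<bar> \<le> L * \<bar>a - b\<bar>"
    if "x \<in> {0<..\<delta>}" "a \<in> {-B..B}" "b \<in> {-B..B}" for x a b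
    using L[of "-x" a b] that by simp
  have k': "- k \<noteq> 0" using k by simp
  obtain v where v: "\<And>x. x \<in> {0<..<\<delta>} \<Longrightarrow>
        (v has_real_derivative - (- k * v x - - F (-x) (v x)) / x^2) (at x)"
    "\<And>x. x \<in> {0<..<\<delta>} \<Longrightarrow> \<bar>v x\<bar> \<le> B" "(v \<longlongrightarrow> - F0 / - k) (at_right 0)"
    by (rule one_sided_solution[OF k' \<delta> B 3 _ 5 Lk(1) _ 4]) (use M Lk in auto)
  \<comment> \<open>The value \<open>v 0\<close> taken at \<open>x = 0\<close> is a dummy; all
    claims concern a punctured neighbourhood.\<close>
  define w where "w x = (if x > 0 then u x else v (-x))" for x
  have "(w has_real_derivative - (k * w x - F x (w x)) / x^2) (at x)"
    if x: "x \<in> {-\<delta><..<\<delta>} - {0}" for x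
  proof (cases "x > 0")
    case True
    have "(u has_real_derivative - (k * w x - F x (w x)) / x^2) (at x)"
      using u(1)[of x] x True by (simp add: w_def)
    then show ?thesis
      by (rule has_field_derivative_transform_within_open[of _ _ _ "{0<..}"]) (use True in \<open>auto simp: w_def\<close>)
  next
    case False
    then have x': "-x \<in> {0<..<\<delta>}" using x by auto
    have "(uminus has_real_derivative -1) (at x)" by (auto intro!: derivative_eq_intros)
    from DERIV_chain2[OF v(1)[OF x'] this]
    have "((\<lambda>x. v (-x)) has_real_derivative - (- k * v (-x) - - F x (v (-x))) / x^2 * - 1) (at x)"
      by simp
    then have "((\<lambda>x. v (-x)) has_real_derivative - (k * w x - F x (w x)) / x^2) (at x)"
      using False by (simp add: w_def field_simps)
    then show ?thesis
      by (rule has_field_derivative_transform_within_open[of _ _ _ "{..<0}"]) (use False x in \<open>auto simp: w_def\<close>)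
  qed
  moreover have "\<bar>w x\<bar> \<le> B" if "x \<in> {-\<delta><..<\<delta>} - {0}" for x
    using u(2)[of x] v(2)[of "-x"] that by (auto simp: w_def)
  moreover have "(w \<longlongrightarrow> F0 / k) (at 0)"
  proof (rule filterlim_split_at)
    have "\<forall>\<^sub>F x in at_right 0. u x = w x"
      by (simp add: w_def eventually_at_filter)
    then show "(w \<longlongrightarrow> F0 / k) (at_right 0)" using u(3) by (rule Lim_transform_eventually[rotated])
    have "((\<lambda>x. v (-x)) \<longlongrightarrow> F0 / k) (at_left 0)"
      using v(3) filterlim_at_left_to_right[of "\<lambda>x. v (-x)" _ 0] by simp
    moreover have "\<forall>\<^sub>F x in at_left 0. v (-x) = w x"
      by (simp add: w_def eventually_at_filter)
    ultimately show "(w \<longlongrightarrow> F0 / k) (at_left 0)" by (rule Lim_transform_eventually)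
  qed
  ultimately show ?thesis using that by blast
qed

section \<open>Functions of class C^k and their jets\<close>

lemma Ck_on_cong:
  assumes "open U" "\<And>z. z \<in> U \<Longrightarrow> f z = g z"
  shows "Ck_on k f U \<longleftrightarrow> Ck_on k g U"
  using assms(2)
proof (induction k arbitrary: f g)
  case 0
  then show ?case by (simp cong: continuous_on_cong)
next
  case (Suc k)
  have *: "(f has_derivative f') (at z) \<longleftrightarrow> (g has_derivative f') (at z)" if "z \<in> U" for z f'
    using has_derivative_transform_within_open[of f f' z UNIV U g]
      has_derivative_transform_within_open[of g f' z UNIV U f] Suc.prems assms(1) that by auto
  then have "f differentiable (at z) \<longleftrightarrow> g differentiable (at z)" if "z \<in> U" for z
    using that by (simp add: differentiable_def)
  moreover have "frechet_derivative f (at z) = frechet_derivative g (at z)" if "z \<in> U" for z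
    using * that by (simp add: frechet_derivative_def)
  moreover from this have "Ck_on k (\<lambda>z. frechet_derivative f (at z) v) U \<longleftrightarrow>
      Ck_on k (\<lambda>z. frechet_derivative g (at z) v) U" for v
    by (intro Suc.IH) simp
  ultimately show ?case by simp
qed

lemma Ck_on_imp_continuous_on: "Ck_on k f U \<Longrightarrow> continuous_on U f"
  by (cases k) (auto intro!: continuous_at_imp_continuous_on differentiable_imp_continuous_within)

lemma Ck_on_Suc_imp: "Ck_on (Suc k) f U \<Longrightarrow> Ck_on k f U"
  by (induction k arbitrary: f) (auto dest: Ck_on_imp_continuous_on[of "Suc 0", simplified]
      intro!: continuous_at_imp_continuous_on differentiable_imp_continuous_within)

lemma Ck_on_mono: "Ck_on k f U \<Longrightarrow> j \<le> k \<Longrightarrow> Ck_on j f U"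
  by (induction k) (auto simp: le_Suc_eq simp del: Ck_on.simps dest: Ck_on_Suc_imp)

lemma Ck_on_SucI:
  assumes "open U" "\<And>z. z \<in> U \<Longrightarrow> (f has_derivative f' z) (at z)" "\<And>v. Ck_on k (\<lambda>z. f' z v) U"
  shows "Ck_on (Suc k) f U"
proof -
  have "frechet_derivative f (at z) = f' z" if "z \<in> U" for z
    using frechet_derivative_at[OF assms(2)[OF that]] by simp
  then have "Ck_on k (\<lambda>z. frechet_derivative f (at z) v) U" for v
    using Ck_on_cong[OF assms(1), of "\<lambda>z. frechet_derivative f (at z) v" "\<lambda>z. f' z v"] assms(3) by simp
  with assms(2) show ?thesis by (auto simp: differentiable_def)
qed

lemma Ck_on_SucD:
  assumes "Ck_on (Suc k) f U"
  shows "z \<in> U \<Longrightarrow> (f has_derivative frechet_derivative f (at z)) (at z)"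
    and "Ck_on k (\<lambda>z. frechet_derivative f (at z) v) U"
  using assms by (auto simp: frechet_derivative_works)

lemma Ck_on_const: "open U \<Longrightarrow> Ck_on k (\<lambda>_. c) U"
proof (induction k arbitrary: c)
  case (Suc k)
  then show ?case by (intro Ck_on_SucI[where f' = "\<lambda>_ _. 0"]) auto
qed simp

lemma Ck_on_add: "open U \<Longrightarrow> Ck_on k f U \<Longrightarrow> Ck_on k g U \<Longrightarrow> Ck_on k (\<lambda>z. f z + g z) U"
proof (induction k arbitrary: f g)
  case (Suc k)
  note f = Ck_on_SucD[OF Suc.prems(2)] and g = Ck_on_SucD[OF Suc.prems(3)]
  show ?case
    by (rule Ck_on_SucI[OF Suc.prems(1) has_derivative_add[OF f(1) g(1)]])
       (use Suc.IH[OF Suc.prems(1) f(2) g(2)] in auto)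
qed (auto intro: continuous_intros)

lemma Ck_on_mult:
  fixes f g :: "'a::real_normed_vector \<Rightarrow> real"
  shows "open U \<Longrightarrow> Ck_on k f U \<Longrightarrow> Ck_on k g U \<Longrightarrow> Ck_on k (\<lambda>z. f z * g z) U"
proof (induction k arbitrary: f g)
  case (Suc k)
  note f = Ck_on_SucD[OF Suc.prems(2)] and g = Ck_on_SucD[OF Suc.prems(3)]
  note f' = Ck_on_Suc_imp[OF Suc.prems(2)] and g' = Ck_on_Suc_imp[OF Suc.prems(3)]
  note U = Suc.prems(1)
  show ?case
    by (rule Ck_on_SucI[OF U has_derivative_mult[OF f(1) g(1)]])
       (use Ck_on_add[OF U Suc.IH[OF U f' g(2)] Suc.IH[OF U f(2) g']] in auto)
qed (auto intro: continuous_intros)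

lemma Ck_on_minus:
  fixes f :: "'a::real_normed_vector \<Rightarrow> real"
  shows "open U \<Longrightarrow> Ck_on k f U \<Longrightarrow> Ck_on k (\<lambda>z. - f z) U"
  using Ck_on_mult[of U k "\<lambda>_. -1" f] Ck_on_const[of U k "-1::real"] by simp

lemma Ck_on_diff:
  fixes f g :: "'a::real_normed_vector \<Rightarrow> real"
  shows "open U \<Longrightarrow> Ck_on k f U \<Longrightarrow> Ck_on k g U \<Longrightarrow> Ck_on k (\<lambda>z. f z - g z) U"
  using Ck_on_add[of U k f "\<lambda>z. - g z"] Ck_on_minus[of U k g] by simp

lemma Ck_on_power:
  fixes f :: "'a::real_normed_vector \<Rightarrow> real"
  shows "open U \<Longrightarrow> Ck_on k f U \<Longrightarrow> Ck_on k (\<lambda>z. f z ^ n) U"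
  by (induction n) (auto intro: Ck_on_const Ck_on_mult)

lemma Ck_on_inverse:
  fixes f :: "'a::real_normed_vector \<Rightarrow> real"
  shows "open U \<Longrightarrow> (\<And>z. z \<in> U \<Longrightarrow> f z \<noteq> 0) \<Longrightarrow> Ck_on k f U \<Longrightarrow> Ck_on k (\<lambda>z. inverse (f z)) U"
proof (induction k arbitrary: f)
  case (Suc k)
  note f = Ck_on_SucD[OF Suc.prems(3)] and f' = Ck_on_Suc_imp[OF Suc.prems(3)]
  note U = Suc.prems(1)
  note i = Suc.IH[OF U Suc.prems(2) f']
  show ?case
    by (rule Ck_on_SucI[OF U Deriv.has_derivative_inverse[OF Suc.prems(2) f(1)]])
       (use Ck_on_minus[OF U Ck_on_mult[OF U Ck_on_mult[OF U i f(2)] i]] in auto)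
qed (auto intro!: continuous_intros)

lemma Ck_on_divide:
  fixes f g :: "'a::real_normed_vector \<Rightarrow> real"
  shows "open U \<Longrightarrow> (\<And>z. z \<in> U \<Longrightarrow> g z \<noteq> 0) \<Longrightarrow> Ck_on k f U \<Longrightarrow> Ck_on k g U \<Longrightarrow>
    Ck_on k (\<lambda>z. f z / g z) U"
  unfolding divide_inverse by (intro Ck_on_mult Ck_on_inverse)

lemmas Ck_on_intros = Ck_on_const Ck_on_add Ck_on_mult Ck_on_minus Ck_on_diff Ck_on_power Ck_on_divide

section \<open>Partial derivatives and jets along families tending to the origin\<close>

lemma frechet_derivative_partials:
  fixes f :: "real \<times> real \<Rightarrow> real"
  assumes "f differentiable (at z)"
  shows "(f has_derivative (\<lambda>(h, k). Dx f z * h + Dy f z * k)) (at z)"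
proof -
  let ?D = "frechet_derivative f (at z)"
  have D: "(f has_derivative ?D) (at z)" using assms by (simp add: frechet_derivative_works)
  then interpret bounded_linear ?D by (rule has_derivative_bounded_linear)
  have "?D v = (case v of (h, k) \<Rightarrow> Dx f z * h + Dy f z * k)" for v
  proof -
    have "v = fst v *\<^sub>R (1, 0) + snd v *\<^sub>R (0, 1)" by (cases v) simp
    then have "?D v = ?D (fst v *\<^sub>R (1, 0) + snd v *\<^sub>R (0, 1))" by simp
    also have "\<dots> = fst v *\<^sub>R ?D (1, 0) + snd v *\<^sub>R ?D (0, 1)" by (simp only: add scaleR)
    finally show ?thesis by (simp add: split_beta mult.commute)
  qed
  then show ?thesis by (intro has_derivative_eq_rhs[OF D] ext)
qed

text \<open>After one use of l'Hopital's rule the quotient \<open>s' t / t\<close> is a difference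
  quotient, so its limit is the derivative of \<open>s'\<close> at the single point
  \<open>0\<close>.\<close>

lemma DERIV_second_order_quotient:
  fixes s :: "real \<Rightarrow> real"
  assumes "\<forall>\<^sub>F t in at 0. (s has_real_derivative s' t) (at t)" "isCont s 0" "s 0 = 0"
    and "s' 0 = 0" "(s' has_real_derivative s2) (at 0)"
  shows "((\<lambda>t. s t / t^2) \<longlongrightarrow> s2 / 2) (at 0)"
proof (rule lhopital[where f' = s' and g' = "\<lambda>t. 2 * t"])
  show "(s \<longlongrightarrow> 0) (at 0)" using assms(2,3) by (simp add: isCont_def)
  show "((\<lambda>t. t^2) \<longlongrightarrow> 0) (at (0::real))" by real_asymp
  show "\<forall>\<^sub>F x::real in at 0. x\<^sup>2 \<noteq> 0" "\<forall>\<^sub>F x::real in at 0. 2 * x \<noteq> 0"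
    by (auto simp: eventually_at_filter)
  show "\<forall>\<^sub>F x::real in at 0. ((\<lambda>t. t\<^sup>2) has_real_derivative 2 * x) (at x)"
    by (auto intro!: always_eventually derivative_eq_intros)
  have "((\<lambda>t. s' t / t) \<longlongrightarrow> s2) (at 0)"
    using assms(4,5) by (simp add: has_field_derivative_iff)
  from tendsto_divide[OF this tendsto_const[of 2]]
  show "((\<lambda>t. s' t / (2 * t)) \<longlongrightarrow> s2 / 2) (at 0)" by (simp add: mult.commute)
qed (rule assms(1))

lemma has_real_derivative_along_x:
  assumes "(f has_derivative (\<lambda>(h, k). a * h + b * k)) (at (x, y))"
  shows "((\<lambda>t. f (t, y)) has_real_derivative a) (at x)"
proof -
  have "((\<lambda>t. (t, y)) has_derivative (\<lambda>h. (h, 0))) (at x)"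
    by (auto intro!: derivative_eq_intros)
  from has_derivative_compose[OF this assms]
  show ?thesis by (simp add: has_field_derivative_def)
qed

lemma has_real_derivative_along_y:
  assumes "(f has_derivative (\<lambda>(h, k). a * h + b * k)) (at (x, y))"
  shows "((\<lambda>t. f (x, t)) has_real_derivative b) (at y)"
proof -
  have "((\<lambda>t. (x, t)) has_derivative (\<lambda>h. (0, h))) (at y)"
    by (auto intro!: derivative_eq_intros)
  from has_derivative_compose[OF this assms]
  show ?thesis by (simp add: has_field_derivative_def)
qed

lemma eventually_pair_in_open:
  fixes x y :: "'i \<Rightarrow> real"
  assumes "open V" "0 \<in> V" "(x \<longlongrightarrow> 0) \<F>" "(y \<longlongrightarrow> 0) \<F>"
  shows "\<forall>\<^sub>F i in \<F>. (x i, y i) \<in> V"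
  using topological_tendstoD[OF tendsto_Pair[OF assms(3,4)] assms(1)] assms(2)
  by (simp add: zero_prod_def)

text \<open>Mean value theorem in the second variable: \<open>q\<close> is \<open>Dy D\<close> at an
  intermediate point. It extracts the factor \<open>y i\<close> before anything is known about the
  size of \<open>y i\<close> relative to \<open>x i\<close>.\<close>

lemma partial_quotient:
  fixes D :: "real \<times> real \<Rightarrow> real" and x y :: "'i \<Rightarrow> real"
  assumes V: "open V" "0 \<in> V" and D: "\<And>z. z \<in> V \<Longrightarrow> D differentiable (at z)"
    and c: "continuous_on V (Dy D)"
    and x: "(x \<longlongrightarrow> 0) \<F>" and y: "(y \<longlongrightarrow> 0) \<F>"
  obtains q where "(q \<longlongrightarrow> Dy D 0) \<F>" "\<forall>\<^sub>F i in \<F>. D (x i, y i) = D (x i, 0) + q i * y i"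
proof -
  obtain A B where AB: "open A" "open B" "(0::real) \<in> A" "(0::real) \<in> B" "A \<times> B \<subseteq> V"
    using open_prod_elim[OF V] by (metis mem_Sigma_iff zero_prod_def)
  obtain e where e: "e > 0" "ball 0 e \<subseteq> B" using AB open_contains_ball by blast
  define \<theta> where "\<theta> i = (SOME t. t \<in> {0..1} \<and> D (x i, y i) = D (x i, 0) + Dy D (x i, t * y i) * y i)" for i
  \<comment> \<open>Resetting useless choices to \<open>0\<close> gives
    \<open>\<bar>t i * y i\<bar> \<le> \<bar>y i\<bar>\<close> for every \<open>i\<close>, also
    where the mean value theorem does not apply.\<close>
  define t where "t i = (if \<theta> i \<in> {0..1} then \<theta> i else 0)" for i
  have ex: "\<exists>t. t \<in> {0..1} \<and> D (x i, y i) = D (x i, 0) + Dy D (x i, t * y i) * y i"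
    if i: "x i \<in> A" "\<bar>y i\<bar> < e" for i
  proof -
    have "((\<lambda>t. D (x i, t * y i)) has_real_derivative Dy D (x i, t * y i) * y i) (at t)"
      if "0 \<le> t" "t \<le> 1" for t
    proof -
      have "\<bar>t * y i\<bar> \<le> 1 * \<bar>y i\<bar>" unfolding abs_mult using that by (intro mult_right_mono) auto
      then have "t * y i \<in> B" using e i by (auto simp: subset_iff dist_real_def)
      then have "(x i, t * y i) \<in> V" using AB i by auto
      from has_real_derivative_along_y[OF frechet_derivative_partials[OF D[OF this]]]
      show ?thesis by (rule DERIV_chain2) (auto intro!: derivative_eq_intros)
    qed
    from MVT2[OF zero_less_one this] obtain t where "0 < t" "t < 1"
      "D (x i, 1 * y i) - D (x i, 0 * y i) = (1 - 0) * (Dy D (x i, t * y i) * y i)" by blast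
    then show ?thesis by (intro exI[of _ t]) auto
  qed
  have "\<forall>\<^sub>F i in \<F>. x i \<in> A \<and> \<bar>y i\<bar> < e"
    using topological_tendstoD[OF x AB(1,3)] tendstoD[OF y e(1)]
    by eventually_elim simp
  then have ev: "\<forall>\<^sub>F i in \<F>. D (x i, y i) = D (x i, 0) + Dy D (x i, t i * y i) * y i"
  proof eventually_elim
    case (elim i)
    with someI_ex[OF ex[of i]] show ?case unfolding t_def \<theta>_def by auto
  qed
  have "((\<lambda>i. t i * y i) \<longlongrightarrow> 0) \<F>"
  proof (rule Lim_null_comparison)
    show "((\<lambda>i. \<bar>y i\<bar>) \<longlongrightarrow> 0) \<F>" using y by (simp add: tendsto_rabs_zero)
    have "\<bar>t i\<bar> \<le> 1" for i by (auto simp: t_def)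
    then show "\<forall>\<^sub>F i in \<F>. norm (t i * y i) \<le> \<bar>y i\<bar>"
      by (auto simp: abs_mult intro!: mult_left_le_one_le always_eventually)
  qed
  from tendsto_Pair[OF x this] have "((\<lambda>i. (x i, t i * y i)) \<longlongrightarrow> 0) \<F>" by (simp add: zero_prod_def)
  moreover have "isCont (Dy D) 0"
    using c V by (simp add: continuous_on_eq_continuous_at)
  ultimately have "((\<lambda>i. Dy D (x i, t i * y i)) \<longlongrightarrow> Dy D 0) \<F>" by (rule isCont_tendsto_compose[rotated])
  then show ?thesis using ev that by blast
qed

lemma second_order_x:
  fixes D :: "real \<times> real \<Rightarrow> real"
  assumes V: "open V" "0 \<in> V" and D: "Ck_on 2 D V"
  shows "((\<lambda>t. (D (t, 0) - D 0 - Dx D 0 * t) / t^2) \<longlongrightarrow> Dx (Dx D) 0 / 2) (at 0)"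
proof (rule DERIV_second_order_quotient[where s' = "\<lambda>t. Dx D (t, 0) - Dx D 0"])
  have D': "Ck_on (Suc (Suc 0)) D V" using D by (simp add: numeral_2_eq_2)
  have d: "D differentiable (at z)" "(Dx D) differentiable (at z)" if "z \<in> V" for z
    using D' that by auto
  have D1: "((\<lambda>t. D (t, 0) - D 0 - Dx D 0 * t) has_real_derivative Dx D (t, 0) - Dx D 0) (at t)"
    if "(t, 0) \<in> V" for t
    using has_real_derivative_along_x[OF frechet_derivative_partials[OF d(1)[OF that]]]
    by (auto intro!: derivative_eq_intros)
  show "\<forall>\<^sub>F t in at 0. ((\<lambda>t. D (t, 0) - D 0 - Dx D 0 * t) has_real_derivative Dx D (t, 0) - Dx D 0) (at t)"
    using eventually_pair_in_open[OF V tendsto_ident_at[of 0 UNIV] tendsto_const]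
    by eventually_elim (rule D1)
  show "isCont (\<lambda>t. D (t, 0) - D 0 - Dx D 0 * t) 0"
    using D1[of 0] V by (auto simp: zero_prod_def intro: DERIV_isCont)
  show "((\<lambda>t. Dx D (t, 0) - Dx D 0) has_real_derivative Dx (Dx D) 0) (at 0)"
    using has_real_derivative_along_x[OF frechet_derivative_partials[OF d(2), of 0, unfolded zero_prod_def]] V
    by (auto intro!: derivative_eq_intros simp: zero_prod_def)
qed (auto simp: zero_prod_def)

text \<open>Along \<open>y\<close> comparable to \<open>x^2\<close>, the terms \<open>x * y\<close>
  and \<open>y^2\<close> of the Taylor polynomial are negligible against \<open>x^2\<close>; only
  the pure second \<open>x\<close>-derivative and the first \<open>y\<close>-derivative
  survive.\<close>

lemma second_jet_limit:
  fixes D :: "real \<times> real \<Rightarrow> real" and x y :: "'i \<Rightarrow> real"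
  assumes V: "open V" "0 \<in> V" and D: "Ck_on 2 D V"
    and x: "(x \<longlongrightarrow> 0) \<F>" "\<forall>\<^sub>F i in \<F>. x i \<noteq> 0" and y: "((\<lambda>i. y i / (x i)^2) \<longlongrightarrow> \<eta>) \<F>"
  shows "((\<lambda>i. (D (x i, y i) - D 0 - Dx D 0 * x i) / (x i)^2) \<longlongrightarrow> Dx (Dx D) 0 / 2 + Dy D 0 * \<eta>) \<F>"
proof -
  have "((\<lambda>i. y i / (x i)^2 * (x i)^2) \<longlongrightarrow> \<eta> * 0^2) \<F>"
    by (intro tendsto_intros x y)
  then have "(y \<longlongrightarrow> \<eta> * 0^2) \<F>"
    by (rule Lim_transform_eventually) (use x(2) in \<open>auto elim: eventually_mono\<close>)
  then have y0: "(y \<longlongrightarrow> 0) \<F>" by simp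
  have D': "Ck_on (Suc (Suc 0)) D V" using D by (simp add: numeral_2_eq_2)
  have "D differentiable (at z)" if "z \<in> V" for z using D' that by auto
  moreover have "continuous_on V (Dy D)"
    using Ck_on_imp_continuous_on[OF Ck_on_SucD(2)[OF D']] .
  ultimately obtain q where q: "(q \<longlongrightarrow> Dy D 0) \<F>"
    "\<forall>\<^sub>F i in \<F>. D (x i, y i) = D (x i, 0) + q i * y i"
    using partial_quotient[OF V _ _ x(1) y0, of D] by blast
  have "filterlim x (at 0) \<F>" using x by (simp add: filterlim_at)
  from tendsto_add[OF filterlim_compose[OF second_order_x[OF V D] this] tendsto_mult[OF q(1) y]]
  show ?thesis
    by (rule Lim_transform_eventually) (use q(2) in eventually_elim, simp add: add_divide_distrib diff_divide_distrib)
qed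

lemma first_jet_limit:
  fixes D :: "real \<times> real \<Rightarrow> real" and x y :: "'i \<Rightarrow> real"
  assumes V: "open V" "0 \<in> V" and D: "Ck_on 1 D V"
    and x: "(x \<longlongrightarrow> 0) \<F>" "\<forall>\<^sub>F i in \<F>. x i \<noteq> 0" and y: "((\<lambda>i. y i / x i) \<longlongrightarrow> \<sigma>) \<F>"
  shows "((\<lambda>i. (D (x i, y i) - D 0) / x i) \<longlongrightarrow> Dx D 0 + Dy D 0 * \<sigma>) \<F>"
proof -
  have "((\<lambda>i. y i / x i * x i) \<longlongrightarrow> \<sigma> * 0) \<F>"
    by (intro tendsto_intros x y)
  then have "(y \<longlongrightarrow> \<sigma> * 0) \<F>"
    by (rule Lim_transform_eventually) (use x(2) in \<open>auto elim: eventually_mono\<close>)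
  then have y0: "(y \<longlongrightarrow> 0) \<F>" by simp
  have D': "Ck_on (Suc 0) D V" using D by simp
  have d: "D differentiable (at z)" if "z \<in> V" for z using D' that by auto
  moreover have "continuous_on V (Dy D)"
    using Ck_on_imp_continuous_on[OF Ck_on_SucD(2)[OF D']] .
  ultimately obtain q where q: "(q \<longlongrightarrow> Dy D 0) \<F>"
    "\<forall>\<^sub>F i in \<F>. D (x i, y i) = D (x i, 0) + q i * y i"
    using partial_quotient[OF V _ _ x(1) y0, of D] by blast
  have "((\<lambda>t. (D (t, 0) - D 0) / t) \<longlongrightarrow> Dx D 0) (at 0)"
    using has_real_derivative_along_x[OF frechet_derivative_partials[OF d, of 0, unfolded zero_prod_def]] V
    by (simp add: has_field_derivative_iff zero_prod_def)
  moreover have "filterlim x (at 0) \<F>" using x by (simp add: filterlim_at)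
  ultimately have "((\<lambda>i. (D (x i, 0) - D 0) / x i) \<longlongrightarrow> Dx D 0) \<F>" by (rule filterlim_compose)
  from tendsto_add[OF this tendsto_mult[OF q(1) y]]
  show ?thesis
    by (rule Lim_transform_eventually) (use q(2) in eventually_elim, simp add: add_divide_distrib diff_divide_distrib)
qed

text \<open>The derivatives exist by \<open>Ck_on\<close>, so it suffices to identify them on the
  axes: the \<open>x\<close>-axis determines \<open>Dx D 0\<close> and \<open>Dx (Dx D) 0\<close>,
  the \<open>y\<close>-axis \<open>Dy D 0\<close>.\<close>

lemma jets_of_bigo:
  fixes D :: "real \<times> real \<Rightarrow> real"
  assumes V: "open V" "0 \<in> V" and D: "Ck_on 2 D V"
    and O: "(\<lambda>(x, y). D (x, y) - (b * y + p * x^2 / 2 + m * x * y + n * y^2 / 2))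
              \<in> O[nhds 0](\<lambda>z. norm z ^ 3)"
  shows "D 0 = 0" "Dx D 0 = 0" "Dy D 0 = b" "Dx (Dx D) 0 = p"
proof -
  let ?q = "\<lambda>z. b * snd z + p * (fst z)^2 / 2 + m * fst z * snd z + n * (snd z)^2 / 2"
  obtain K where "\<forall>\<^sub>F z in nhds 0. norm (D z - ?q z) \<le> K * norm (norm z ^ 3)"
    using landau_o.bigE[OF O] by (auto simp: case_prod_unfold)
  then have K: "\<forall>\<^sub>F z in nhds 0. \<bar>D z - ?q z\<bar> \<le> K * norm z ^ 3" by simp
  from eventually_nhds_x_imp_x[OF this] show D0: "D 0 = 0" by simp
  have d: "D differentiable (at z)" if "z \<in> V" for z using D that by (auto simp: numeral_2_eq_2)
  note D1 = frechet_derivative_partials[OF d[OF V(2)], unfolded zero_prod_def]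
  have t0: "((\<lambda>t::real. (t, 0::real)) \<longlongrightarrow> 0) (at 0)" "((\<lambda>t::real. (0::real, t)) \<longlongrightarrow> 0) (at 0)"
    by (auto simp: zero_prod_def intro!: tendsto_intros)
  have Kx: "\<forall>\<^sub>F t in at 0. \<bar>D (t, 0) - p * t^2 / 2\<bar> \<le> K * \<bar>t\<bar> ^ 3"
    using eventually_compose_filterlim[OF K t0(1)] by (simp add: norm_Pair)
  have Ky: "\<forall>\<^sub>F t in at 0. \<bar>D (0, t) - (b * t + n * t^2 / 2)\<bar> \<le> K * \<bar>t\<bar> ^ 3"
    using eventually_compose_filterlim[OF K t0(2)] by (simp add: norm_Pair)
  have cube: "\<bar>t\<bar> ^ 3 = \<bar>t\<bar> * t^2" "\<bar>t\<bar> ^ 3 = \<bar>t\<bar>^2 * \<bar>t\<bar>" for t :: real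
    by (simp_all add: power3_eq_cube power2_eq_square)
  have nz: "\<forall>\<^sub>F t::real in at 0. t \<noteq> 0" by (simp add: eventually_at_filter)
  have lx2: "((\<lambda>t. (D (t, 0) - p * t^2 / 2) / t^2) \<longlongrightarrow> 0) (at 0)"
  proof (rule Lim_null_comparison)
    show "\<forall>\<^sub>F t in at 0. norm ((D (t, 0) - p * t^2 / 2) / t^2) \<le> K * \<bar>t\<bar>"
      using Kx nz by eventually_elim (simp add: pos_divide_le_eq cube(1) mult.assoc)
    show "((\<lambda>t. K * \<bar>t\<bar>) \<longlongrightarrow> 0) (at 0)" by (auto intro!: tendsto_eq_intros)
  qed
  have "((\<lambda>t. (D (t, 0) - p * t^2 / 2) / t^2 * t + p * t / 2) \<longlongrightarrow> 0 * 0 + p * 0 / 2) (at 0)"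
    by (intro tendsto_intros lx2) auto
  then have "((\<lambda>t. D (t, 0) / t) \<longlongrightarrow> 0 * 0 + p * 0 / 2) (at 0)"
    by (rule Lim_transform_eventually)
       (use nz in \<open>eventually_elim, auto simp: field_simps power2_eq_square\<close>)
  then have lx: "((\<lambda>t. D (t, 0) / t) \<longlongrightarrow> 0) (at 0)" by simp
  have "((\<lambda>t. D (t, 0) / t) \<longlongrightarrow> Dx D (0, 0)) (at 0)"
    using has_real_derivative_along_x[OF D1] D0 by (simp add: has_field_derivative_iff zero_prod_def)
  from tendsto_unique[OF _ this lx] show Dx0: "Dx D 0 = 0" by (simp add: zero_prod_def)
  have "((\<lambda>t. (D (0, t) - (b * t + n * t^2 / 2)) / t) \<longlongrightarrow> 0) (at 0)"
  proof (rule Lim_null_comparison)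
    show "\<forall>\<^sub>F t in at 0. norm ((D (0, t) - (b * t + n * t^2 / 2)) / t) \<le> K * \<bar>t\<bar>^2"
      using Ky nz by eventually_elim (simp add: pos_divide_le_eq cube(2) mult.assoc)
    show "((\<lambda>t. K * \<bar>t\<bar>^2) \<longlongrightarrow> 0) (at 0)" by (auto intro!: tendsto_eq_intros)
  qed
  moreover have "((\<lambda>t. b + n * t / 2) \<longlongrightarrow> b) (at 0)" by (auto intro!: tendsto_eq_intros)
  ultimately have "((\<lambda>t. (D (0, t) - (b * t + n * t^2 / 2)) / t + (b + n * t / 2)) \<longlongrightarrow> 0 + b) (at 0)"
    by (rule tendsto_add)
  then have "((\<lambda>t. D (0, t) / t) \<longlongrightarrow> 0 + b) (at 0)"
    by (rule Lim_transform_eventually)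
       (use nz in \<open>eventually_elim, auto simp: field_simps power2_eq_square\<close>)
  then have ly: "((\<lambda>t. D (0, t) / t) \<longlongrightarrow> b) (at 0)" by simp
  have "((\<lambda>t. D (0, t) / t) \<longlongrightarrow> Dy D (0, 0)) (at 0)"
    using has_real_derivative_along_y[OF D1] D0 by (simp add: has_field_derivative_iff zero_prod_def)
  from tendsto_unique[OF _ this ly] show "Dy D 0 = b" by (simp add: zero_prod_def)
  have "((\<lambda>t. (D (t, 0) - p * t^2 / 2) / t^2 + p / 2) \<longlongrightarrow> 0 + p / 2) (at 0)"
    by (intro tendsto_intros lx2)
  then have "((\<lambda>t. D (t, 0) / t^2) \<longlongrightarrow> 0 + p / 2) (at 0)"
    by (rule Lim_transform_eventually) (use nz in \<open>eventually_elim, auto simp: field_simps\<close>)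
  then have "((\<lambda>t. D (t, 0) / t^2) \<longlongrightarrow> p / 2) (at 0)" by simp
  moreover have "((\<lambda>t. D (t, 0) / t^2) \<longlongrightarrow> Dx (Dx D) 0 / 2) (at 0)"
    using second_order_x[OF V D] by (simp add: D0 Dx0)
  ultimately show "Dx (Dx D) 0 = p" using tendsto_unique[of "at (0::real)"] by fastforce
qed

section \<open>Singular points of the Lie-Cartan surface\<close>

lemma sum_atMost_4: "(\<Sum>k\<le>4. g k) = g 0 + g 1 + g 2 + g 3 + g (4::nat)" for g :: "nat \<Rightarrow> real"
proof -
  have 4: "(4::nat) = Suc (Suc (Suc (Suc 0)))" by simp
  show ?thesis unfolding 4 sum.atMost_Suc by (simp add: numeral_3_eq_3 numeral_2_eq_2)
qed

text \<open>The coefficients of the quartic in \<open>p\<close> form a family \<open>C\<close>; the operators \<open>fam_x\<close>, \<open>fam_y\<close>,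
  \<open>fam_p\<close> on families correspond to the partial derivatives of \<open>fib C\<close>.\<close>

definition fib :: "(nat \<Rightarrow> real \<times> real \<Rightarrow> real) \<Rightarrow> real \<times> real \<times> real \<Rightarrow> real" where
  "fib C = (\<lambda>(x, y, p). \<Sum>k\<le>4. C k (x, y) * p ^ k)"

abbreviation fam_x :: "(nat \<Rightarrow> real \<times> real \<Rightarrow> real) \<Rightarrow> nat \<Rightarrow> real \<times> real \<Rightarrow> real" where
  "fam_x C k \<equiv> Dx (C k)"

abbreviation fam_y :: "(nat \<Rightarrow> real \<times> real \<Rightarrow> real) \<Rightarrow> nat \<Rightarrow> real \<times> real \<Rightarrow> real" where
  "fam_y C k \<equiv> Dy (C k)"

text \<open>The bound \<open>k < 4\<close> matters at \<open>k = 4\<close>: without it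
  \<open>fib (fam_p C)\<close> would contain a term \<open>5 * C 5 (x, y) * p ^ 4\<close>.\<close>

definition fam_p :: "(nat \<Rightarrow> real \<times> real \<Rightarrow> real) \<Rightarrow> nat \<Rightarrow> real \<times> real \<Rightarrow> real" where
  "fam_p C k = (\<lambda>z. if k < 4 then real (Suc k) * C (Suc k) z else 0)"

lemma fib_expand:
  "fib C (x, y, p) = C 0 (x, y) + C 1 (x, y) * p + C 2 (x, y) * p^2 + C 3 (x, y) * p^3 + C 4 (x, y) * p^4"
  by (simp add: fib_def eval_nat_numeral)

lemma fam_p_simps:
  "fam_p C 0 z = C 1 z" "fam_p C (Suc 0) z = 2 * C 2 z" "fam_p C 1 z = 2 * C 2 z" "fam_p C 2 z = 3 * C 3 z"
  "fam_p C 3 z = 4 * C 4 z" "fam_p C 4 z = 0"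
  by (simp_all add: fam_p_def eval_nat_numeral)

lemma fib_has_derivative:
  assumes "\<And>k. C k differentiable (at (x, y))"
  shows "(fib C has_derivative (\<lambda>(h, k, l). fib (fam_x C) (x, y, p) * h + fib (fam_y C) (x, y, p) * k
            + fib (fam_p C) (x, y, p) * l)) (at (x, y, p))"
proof -
  have C: "((\<lambda>z. C j (fst z, fst (snd z))) has_derivative
      (\<lambda>v. Dx (C j) (x, y) * fst v + Dy (C j) (x, y) * fst (snd v))) (at (x, y, p))" for j
  proof -
    have "((\<lambda>z::real \<times> real \<times> real. (fst z, fst (snd z))) has_derivative (\<lambda>v. (fst v, fst (snd v)))) (at (x, y, p))"
      by (auto intro!: derivative_eq_intros)
    from has_derivative_compose[OF this, of "C j", simplified, OF frechet_derivative_partials[OF assms]]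
    show ?thesis by simp
  qed
  have P: "((\<lambda>z::real \<times> real \<times> real. snd (snd z) ^ n) has_derivative
      (\<lambda>v. of_nat n * p ^ (n - 1) * snd (snd v))) (at (x, y, p))" for n
    by (auto intro!: derivative_eq_intros)
  have f: "fib C = (\<lambda>z. \<Sum>k\<le>4. C k (fst z, fst (snd z)) * snd (snd z) ^ k)"
    by (simp add: fib_def case_prod_unfold)
  have "(fib C has_derivative (\<lambda>v. \<Sum>k\<le>4. C k (x, y) * (of_nat k * p ^ (k - 1) * snd (snd v))
      + (Dx (C k) (x, y) * fst v + Dy (C k) (x, y) * fst (snd v)) * p ^ k)) (at (x, y, p))"
    unfolding f using has_derivative_sum[OF has_derivative_mult[OF C P], where I = "{..4}"] by simp
  moreover have "(\<Sum>k\<le>4. C k (x, y) * (of_nat k * p ^ (k - 1) * l)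
      + (Dx (C k) (x, y) * h + Dy (C k) (x, y) * j) * p ^ k) =
      fib (fam_x C) (x, y, p) * h + fib (fam_y C) (x, y, p) * j + fib (fam_p C) (x, y, p) * l" for h j l
  proof -
    show ?thesis
      unfolding sum_atMost_4 fib_expand fam_p_simps by (simp add: algebra_simps)
  qed
  ultimately show ?thesis by (simp add: case_prod_unfold)
qed

lemma fib_frechet:
  assumes "\<And>k. C k differentiable (at (x, y))"
  shows "frechet_derivative (fib C) (at (x, y, p)) (h, k, l) =
     fib (fam_x C) (x, y, p) * h + fib (fam_y C) (x, y, p) * k + fib (fam_p C) (x, y, p) * l"
  by (subst frechet_derivative_at[OF fib_has_derivative[OF assms], symmetric]) simp_all

lemma continuous_on_fib:
  assumes "\<And>k. continuous_on V (C k)"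
  shows "continuous_on {z. (fst z, fst (snd z)) \<in> V} (fib C)"
  unfolding fib_def case_prod_unfold
  by (intro continuous_intros continuous_on_compose2[OF assms]) auto

lemma Ck_on_fam_p:
  assumes "open V" "\<And>k. Ck_on n (C k) V"
  shows "Ck_on n (fam_p C k) V"
  unfolding fam_p_def using assms by (cases "k < 4") (auto intro!: Ck_on_mult Ck_on_const)

text \<open>Differentiation in \<open>p\<close> recombines the coefficients with constant factors,
  so it commutes with differentiation in \<open>x\<close> and \<open>y\<close>.\<close>

lemma fam_p_partials:
  assumes "C (Suc k) differentiable (at z)"
  shows "Dx (fam_p C k) z = fam_p (fam_x C) k z" "Dy (fam_p C k) z = fam_p (fam_y C) k z"
proof -
  have "Dx (fam_p C k) z = fam_p (fam_x C) k z \<and> Dy (fam_p C k) z = fam_p (fam_y C) k z"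
  proof (cases "k < 4")
    case True
    have "((\<lambda>w. real (Suc k) * C (Suc k) w) has_derivative
        (\<lambda>(h, j). real (Suc k) * (Dx (C (Suc k)) z * h + Dy (C (Suc k)) z * j))) (at z)"
      using has_derivative_mult_right[OF frechet_derivative_partials[OF assms], of "real (Suc k)"]
      by (simp add: case_prod_unfold)
    from frechet_derivative_at[OF this, symmetric] True show ?thesis by (simp add: fam_p_def)
  next
    case False
    then show ?thesis by (simp add: fam_p_def)
  qed
  then show "Dx (fam_p C k) z = fam_p (fam_x C) k z" "Dy (fam_p C k) z = fam_p (fam_y C) k z" by auto
qed

text \<open>The 2-jets at the origin of the coefficients, without the entries that never matter; \<open>a\<close>, \<open>b\<close>, \<open>e\<close>
  stand for \<open>a20\<close>, \<open>b01\<close>, \<open>b20\<close>.\<close>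

locale axial_jets =
  fixes V :: "(real \<times> real) set" and C :: "nat \<Rightarrow> real \<times> real \<Rightarrow> real" and c a b e :: real
  assumes V: "open V" "(0, 0) \<in> V" and C3: "\<And>k. Ck_on 3 (C k) V" and c0: "c \<noteq> 0"
    and jet0: "\<And>k. C k (0, 0) = 0" and jetx: "\<And>k. Dx (C k) (0, 0) = 0"
    and jety: "Dy (C 0) (0, 0) = 1 / c" "Dy (C 1) (0, 0) = b / c" "Dy (C 2) (0, 0) = -6 / c"
      "Dy (C 3) (0, 0) = - b / c" "Dy (C 4) (0, 0) = 1 / c"
    and jetxx: "Dx (Dx (C 0)) (0, 0) = a / c" "Dx (Dx (C 1)) (0, 0) = e / c" "Dx (Dx (C 2)) (0, 0) = -6 * a / c"
      "Dx (Dx (C 3)) (0, 0) = - e / c" "Dx (Dx (C 4)) (0, 0) = a / c"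
begin

lemma V0: "0 \<in> V" using V(2) by (simp add: zero_prod_def)

lemma C_Ck: "Ck_on 2 (C k) V" "Ck_on 1 (C k) V"
  using Ck_on_mono[OF C3, of 2] Ck_on_mono[OF C3, of 1] by auto

lemma Cd_Ck: "Ck_on 2 (Dx (C k)) V" "Ck_on 2 (Dy (C k)) V" "Ck_on 1 (Dx (C k)) V" "Ck_on 1 (Dy (C k)) V"
proof -
  have "Ck_on (Suc 2) (C k) V" using C3[of k] by (simp add: numeral_3_eq_3 numeral_2_eq_2)
  then show *: "Ck_on 2 (Dx (C k)) V" "Ck_on 2 (Dy (C k)) V" by (rule Ck_on_SucD(2))+
  from Ck_on_mono[OF *(1), of 1] Ck_on_mono[OF *(2), of 1]
  show "Ck_on 1 (Dx (C k)) V" "Ck_on 1 (Dy (C k)) V" by auto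
qed

lemma Ck1_differentiable: "Ck_on 1 D V \<Longrightarrow> z \<in> V \<Longrightarrow> D differentiable (at z)"
  by simp

lemmas C_diff = Ck1_differentiable[OF C_Ck(2)]
lemmas Cx_diff = Ck1_differentiable[OF Cd_Ck(3)]
lemmas Cy_diff = Ck1_differentiable[OF Cd_Ck(4)]
lemmas Cp_diff = Ck1_differentiable[OF Ck_on_fam_p[OF V(1) C_Ck(2)]]

section \<open>The quartic on the projective line over the origin\<close>

definition \<phi> :: "real \<Rightarrow> real" where
  "\<phi> p = 1 - 6 * p^2 + p^4 + b * (p - p^3)"

abbreviation W :: "(real \<times> real \<times> real) set" where
  "W \<equiv> {z. (fst z, fst (snd z)) \<in> V}"

lemma open_W: "open W"
proof -
  have "open ((\<lambda>z. (fst z, fst (snd z))) -` V :: (real \<times> real \<times> real) set)"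
    by (rule open_vimage[OF V(1)]) (intro continuous_intros)
  then show ?thesis by (simp add: vimage_def)
qed

lemma fd_fib:
  assumes "z \<in> W"
  shows "frechet_derivative (fib C) (at z) (h, k, l) =
     fib (fam_x C) z * h + fib (fam_y C) z * k + fib (fam_p C) z * l"
  using assms by (cases z) (auto intro!: fib_frechet C_diff)

lemma fib_at_origin:
  "fib C (0, 0, p) = 0" "fib (fam_x C) (0, 0, p) = 0" "fib (fam_p C) (0, 0, p) = 0"
  "fib (fam_y C) (0, 0, p) = \<phi> p / c"
  using c0 by (auto simp: fib_expand jet0 jetx jety[unfolded One_nat_def] jety fam_p_simps \<phi>_def field_simps)

lemma critical_zero_iff: "critical_zero (fib C) (0, 0, p) \<longleftrightarrow> \<phi> p = 0"
proof -
  have d: "(fib C has_derivative (\<lambda>(h, k, l). \<phi> p / c * k)) (at (0, 0, p))"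
    using fib_has_derivative[of C 0 0 p, OF C_diff[OF V(2)]] by (simp add: fib_at_origin)
  have "critical_zero (fib C) (0, 0, p) \<longleftrightarrow> (\<lambda>(h::real, k, l::real). \<phi> p / c * k) = (\<lambda>_. 0)"
    unfolding critical_zero_def fib_at_origin(1) using has_derivative_unique[OF d] d by metis
  also have "\<dots> \<longleftrightarrow> \<phi> p = 0"
    using c0 by (auto simp: fun_eq_iff dest: spec[of _ 1])
  finally show ?thesis .
qed

text \<open>Over the origin the families \<open>C\<close> and \<open>fam_x C\<close> vanish
  identically in \<open>p\<close>, which removes the entries \<open>pp\<close> and
  \<open>xp\<close>. What remains is governed by \<open>xx\<close> and \<open>yp\<close>.\<close>

lemma hessian_fib:
  "hessian (fib C) (0, 0, p) (u1, u2, u3) (v1, v2, v3) =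
     (fib (fam_x (fam_x C)) (0, 0, p) * v1 + fib (fam_y (fam_x C)) (0, 0, p) * v2) * u1 +
     (fib (fam_x (fam_y C)) (0, 0, p) * v1 + fib (fam_y (fam_y C)) (0, 0, p) * v2
        + fib (fam_p (fam_y C)) (0, 0, p) * v3) * u2 +
     (fib (fam_p (fam_y C)) (0, 0, p) * v2) * u3"
proof -
  let ?z = "(0::real, 0::real, p)"
  have z: "?z \<in> W" using V by simp
  have px: "fib (fam_x (fam_p C)) ?z = 0"
    using jetx by (simp add: fib_expand fam_p_partials C_diff V fam_p_simps)
  have py: "fib (fam_y (fam_p C)) ?z = fib (fam_p (fam_y C)) ?z"
    by (simp add: fib_expand fam_p_partials C_diff V fam_p_simps)
  have pp: "fib (fam_p (fam_p C)) ?z = 0"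
    by (simp add: fib_expand fam_p_simps jet0)
  have xp: "fib (fam_p (fam_x C)) ?z = 0"
    by (simp add: fib_expand fam_p_simps jetx)
  let ?D = "\<lambda>v. (case v of (h, k, l) \<Rightarrow> fib (fam_x (fam_x C)) ?z * h + fib (fam_y (fam_x C)) ?z * k + fib (fam_p (fam_x C)) ?z * l) * u1
        + (case v of (h, k, l) \<Rightarrow> fib (fam_x (fam_y C)) ?z * h + fib (fam_y (fam_y C)) ?z * k + fib (fam_p (fam_y C)) ?z * l) * u2
        + (case v of (h, k, l) \<Rightarrow> fib (fam_x (fam_p C)) ?z * h + fib (fam_y (fam_p C)) ?z * k + fib (fam_p (fam_p C)) ?z * l) * u3"
  have "((\<lambda>w. fib (fam_x C) w * u1 + fib (fam_y C) w * u2 + fib (fam_p C) w * u3) has_derivative ?D) (at ?z)"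
    by (intro has_derivative_add has_derivative_mult_left fib_has_derivative Cx_diff Cy_diff Cp_diff V)
  then have "((\<lambda>w. frechet_derivative (fib C) (at w) (u1, u2, u3)) has_derivative ?D) (at ?z)"
    by (rule has_derivative_transform_within_open[OF _ open_W z]) (simp add: fd_fib)
  from frechet_derivative_at[OF this, symmetric] show ?thesis
    by (simp add: hessian_def px py pp xp)
qed

text \<open>The right-hand side is the Wronskian of \<open>1 - 6 p^2 + p^4\<close> and \<open>p - p^3\<close> up to sign, hence the roots
  of \<open>\<phi>\<close> are simple.\<close>

lemma \<phi>_wronskian: "\<phi> p = 0 \<Longrightarrow> (- 12 * p + 4 * p^3 + b * (1 - 3 * p^2)) * (p - p^3) = - ((1 + p^2)^3)"
proof -
  assume "\<phi> p = 0"
  then have "b * (p - p^3) = - (1 - 6 * p^2 + p^4)" by (simp add: \<phi>_def)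
  then have "(- 12 * p + 4 * p^3 + b * (1 - 3 * p^2)) * (p - p^3)
      = (- 12 * p + 4 * p^3) * (p - p^3) - (1 - 6 * p^2 + p^4) * (1 - 3 * p^2)"
  proof -
    have "(- 12 * p + 4 * p^3 + b * (1 - 3 * p^2)) * (p - p^3)
        = (- 12 * p + 4 * p^3) * (p - p^3) + (b * (p - p^3)) * (1 - 3 * p^2)" by algebra
    then show ?thesis unfolding \<open>b * (p - p^3) = - (1 - 6 * p^2 + p^4)\<close> by (simp only: mult_minus_left diff_conv_add_uminus)
  qed
  also have "\<dots> = - ((1 + p^2)^3)" by (simp add: algebra_simps eval_nat_numeral)
  finally show ?thesis .
qed

lemma nondegenerate_iff:
  assumes "\<phi> p = 0"
  shows "nondegenerate_hessian (fib C) (0, 0, p) \<longleftrightarrow> e - b * a \<noteq> 0"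
proof -
  define Hxx where "Hxx = fib (fam_x (fam_x C)) (0, 0, p)"
  define Hyp where "Hyp = fib (fam_p (fam_y C)) (0, 0, p)"
  have w: "(- 12 * p + 4 * p^3 + b * (1 - 3 * p^2)) * (p - p^3) = - ((1 + p^2)^3)"
    by (rule \<phi>_wronskian[OF assms])
  \<comment> \<open>One product formula yields two facts: its first factor is the derivative of
    \<open>\<phi>\<close>, hence \<open>c\<close> times the entry \<open>yp\<close>; its second is
    the factor of \<open>e - b * a\<close> in the entry \<open>xx\<close>.\<close>
  have "(1 + p^2)^3 \<noteq> 0" using zero_le_power2[of p] by (simp add: add_nonneg_eq_0_iff)
  with w have ne: "- 12 * p + 4 * p^3 + b * (1 - 3 * p^2) \<noteq> 0" "p - p^3 \<noteq> 0" by auto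
  have "Hyp = (- 12 * p + 4 * p^3 + b * (1 - 3 * p^2)) / c"
    using c0 by (auto simp: Hyp_def fib_expand fam_p_simps jety[unfolded One_nat_def] jety field_simps)
  then have Hyp: "Hyp \<noteq> 0" using ne c0 by simp
  have "Hxx = (a * (1 - 6 * p^2 + p^4) + e * (p - p^3)) / c"
    using c0 by (auto simp: Hxx_def fib_expand jetxx[unfolded One_nat_def] jetxx field_simps)
  also have "1 - 6 * p^2 + p^4 = - (b * (p - p^3))" using assms by (simp add: \<phi>_def)
  finally have "Hxx = (e - b * a) * (p - p^3) / c" by (simp add: algebra_simps)
  then have Hxx: "Hxx \<noteq> 0 \<longleftrightarrow> e - b * a \<noteq> 0" using ne c0 by auto
  show ?thesis unfolding Hxx[symmetric]
  proof
    assume nd: "nondegenerate_hessian (fib C) (0, 0, p)"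
    \<comment> \<open>The third component is chosen to cancel the coefficient of \<open>v2\<close>;
      against \<open>(1, 0, u3)\<close> the Hessian reduces to \<open>Hxx * v1\<close>.\<close>
    define u3 where "u3 = - fib (fam_y (fam_x C)) (0, 0, p) / Hyp"
    have "(1, 0, u3) \<noteq> (0 :: real \<times> real \<times> real)" by (simp add: zero_prod_def)
    with nd obtain v where "hessian (fib C) (0, 0, p) (1, 0, u3) v \<noteq> 0"
      unfolding nondegenerate_hessian_def by blast
    moreover obtain v1 v2 v3 where "v = (v1, v2, v3)" by (cases v)
    ultimately show "Hxx \<noteq> 0"
      using Hyp by (auto simp: hessian_fib Hxx_def[symmetric] Hyp_def[symmetric] u3_def field_simps)
  next
    assume H: "Hxx \<noteq> 0"
    show "nondegenerate_hessian (fib C) (0, 0, p)"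
      unfolding nondegenerate_hessian_def
    proof (intro allI impI)
      fix u :: "real \<times> real \<times> real" assume "u \<noteq> 0"
      moreover obtain u1 u2 u3 where u: "u = (u1, u2, u3)" by (cases u)
      ultimately have "u2 \<noteq> 0 \<or> u2 = 0 \<and> u1 \<noteq> 0 \<or> u2 = 0 \<and> u1 = 0 \<and> u3 \<noteq> 0"
        by (auto simp: zero_prod_def)
      then show "\<exists>v. hessian (fib C) (0, 0, p) u v \<noteq> 0"
      proof (elim disjE)
        assume "u2 \<noteq> 0"
        then show ?thesis using Hyp
          by (intro exI[of _ "(0, 0, 1)"]) (simp add: u hessian_fib Hyp_def[symmetric])
      next
        assume "u2 = 0 \<and> u1 \<noteq> 0"
        then show ?thesis using H
          by (intro exI[of _ "(1, 0, 0)"]) (simp add: u hessian_fib Hxx_def[symmetric])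
      next
        assume "u2 = 0 \<and> u1 = 0 \<and> u3 \<noteq> 0"
        then show ?thesis using Hyp
          by (intro exI[of _ "(0, 1, 0)"]) (simp add: u hessian_fib Hyp_def[symmetric])
      qed
    qed
  qed
qed

text \<open>The degree bounds the number of roots by four. The term with \<open>b\<close> vanishes
  at \<open>0\<close>, \<open>1\<close> and \<open>-1\<close>, where \<open>\<phi>\<close> has the
  values \<open>1\<close>, \<open>-4\<close>, \<open>-4\<close> whatever \<open>b\<close> is; with
  positive values far out this forces four sign changes.\<close>

lemma card_roots_\<phi>: "finite {p. \<phi> p = 0}" "card {p. \<phi> p = 0} = 4"
proof -
  define A where "A k = (if k = 0 then 1 else if k = 1 then b else if k = 2 then -6 else if k = 3 then - b else 1)"
    for k :: nat
  have "\<phi> p = (\<Sum>i\<le>4. A i * p ^ i)" for p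
    by (simp add: \<phi>_def A_def eval_nat_numeral algebra_simps)
  then have "{p. \<phi> p = 0} = {p. (\<Sum>i\<le>4. A i * p ^ i) = 0}" by simp
  moreover have "A 4 \<noteq> 0" by (simp add: A_def)
  ultimately have fin: "finite {p. \<phi> p = 0}" and le: "card {p. \<phi> p = 0} \<le> 4"
    using Transcendental.polyfun_rootbound[of A 4 4] by auto
  show "finite {p. \<phi> p = 0}" by (rule fin)
  \<comment> \<open>With \<open>\<bar>b\<bar> = M - 7\<close> the fourth powers cancel in the lower
    bound for \<open>\<phi>\<close>, leaving \<open>7 * M^3\<close> to dominate
    \<open>- 7 * M^2\<close>.\<close>
  define M where "M = \<bar>b\<bar> + 7"
  have M: "M \<ge> 7" "\<bar>b\<bar> = M - 7" by (auto simp: M_def)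
  have big: "\<phi> p > 0" if "\<bar>p\<bar> = M" for p
  proof -
    have "\<bar>b * (p - p^3)\<bar> \<le> (M - 7) * (M + M^3)"
    proof -
      have "\<bar>p - p^3\<bar> \<le> \<bar>p\<bar> + \<bar>p\<bar>^3" by (metis abs_triangle_ineq4 power_abs)
      then show ?thesis unfolding abs_mult M(2) that using M by (intro mult_left_mono) auto
    qed
    moreover have "p^2 = M^2" "p^4 = M^4" using that by (metis power2_abs, metis power_even_abs even_numeral)
    moreover have "1 - 6 * M^2 + M^4 - (M - 7) * (M + M^3) = 1 + 7 * M + 7 * M^2 * (M - 1)"
      by (simp add: algebra_simps eval_nat_numeral)
    moreover have "7 * M^2 * (M - 1) \<ge> 0" using M by simp
    ultimately show ?thesis unfolding \<phi>_def using M by linarith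
  qed
  have cont: "continuous_on S \<phi>" for S unfolding \<phi>_def by (intro continuous_intros)
  have v: "\<phi> (-M) > 0" "\<phi> (-1) < 0" "\<phi> 0 > 0" "\<phi> 1 < 0" "\<phi> M > 0"
    using big[of M] big[of "-M"] M(1) by (auto simp: \<phi>_def[of 0] \<phi>_def[of 1] \<phi>_def[of "-1"])
  obtain r1 where r1: "-M \<le> r1" "r1 \<le> -1" "\<phi> r1 = 0"
    using IVT2'[of \<phi> "-1" 0 "-M"] v M cont by force
  obtain r2 where r2: "-1 \<le> r2" "r2 \<le> 0" "\<phi> r2 = 0"
    using IVT'[of \<phi> "-1" 0 0] v cont by force
  obtain r3 where r3: "0 \<le> r3" "r3 \<le> 1" "\<phi> r3 = 0"
    using IVT2'[of \<phi> 1 0 0] v cont by force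
  obtain r4 where r4: "1 \<le> r4" "r4 \<le> M" "\<phi> r4 = 0"
    using IVT'[of \<phi> 1 0 M] v M cont by force
  have ne: "r1 \<noteq> -1" "r2 \<noteq> -1" "r2 \<noteq> 0" "r3 \<noteq> 0" "r3 \<noteq> 1" "r4 \<noteq> 1"
    using v r1 r2 r3 r4 by auto
  then have "r1 < r2" "r2 < r3" "r3 < r4" using r1 r2 r3 r4 by auto
  then have "card {r1, r2, r3, r4} = 4" by simp
  moreover have "{r1, r2, r3, r4} \<subseteq> {p. \<phi> p = 0}" using r1 r2 r3 r4 by auto
  ultimately show "card {p. \<phi> p = 0} = 4" using card_mono[OF fin] le by (metis le_antisym)
qed

end

section \<open>Saddle-nodes of the Lie-Cartan field\<close>

context axial_jets
begin

abbreviation g :: "real \<times> real \<times> real \<Rightarrow> real" where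
  "g \<equiv> fib (fam_p C)"

text \<open>The \<open>p\<close>-component of the field. The \<open>x\<close>-component is
  \<open>g\<close>, so in the coordinates \<open>(x, p)\<close> of the surface the orbits satisfy
  dp/dx = \<open>N / g\<close> wherever \<open>g\<close> is nonzero.\<close>

definition N :: "real \<times> real \<times> real \<Rightarrow> real" where
  "N z = - (fib (fam_x C) z + snd (snd z) * fib (fam_y C) z)"

lemma field_eq:
  assumes "z \<in> W"
  shows "lie_cartan_field (Some l) (fib C) z = (g z, snd (snd z) * g z, N z)"
proof (cases z)
  case (fields x y p)
  then show ?thesis using assms by (simp add: Let_def fd_fib N_def)
qed

lemma N_has_derivative:
  assumes "(x, y) \<in> V"
  shows "(N has_derivative (\<lambda>(h, k, l).
      - (fib (fam_x (fam_x C)) (x, y, p) + p * fib (fam_x (fam_y C)) (x, y, p)) * h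
      - (fib (fam_y (fam_x C)) (x, y, p) + p * fib (fam_y (fam_y C)) (x, y, p)) * k
      - (fib (fam_p (fam_x C)) (x, y, p) + fib (fam_y C) (x, y, p) + p * fib (fam_p (fam_y C)) (x, y, p)) * l))
    (at (x, y, p))"
proof -
  have "((\<lambda>z. - (fib (fam_x C) z + snd (snd z) * fib (fam_y C) z)) has_derivative
     (\<lambda>v. - ((case v of (h, k, l) \<Rightarrow> fib (fam_x (fam_x C)) (x, y, p) * h + fib (fam_y (fam_x C)) (x, y, p) * k
           + fib (fam_p (fam_x C)) (x, y, p) * l)
        + (snd (snd (x, y, p)) * (case v of (h, k, l) \<Rightarrow> fib (fam_x (fam_y C)) (x, y, p) * h + fib (fam_y (fam_y C)) (x, y, p) * k
           + fib (fam_p (fam_y C)) (x, y, p) * l) + snd (snd v) * fib (fam_y C) (x, y, p)))))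
     (at (x, y, p))"
    by (intro has_derivative_minus has_derivative_add has_derivative_mult fib_has_derivative
        Cx_diff Cy_diff assms has_derivative_snd has_derivative_ident)
  then show ?thesis
    unfolding N_def[abs_def] by (rule has_derivative_eq_rhs) (auto simp: fun_eq_iff algebra_simps)
qed

lemma field_has_derivative:
  "(lie_cartan_field (Some l0) (fib C) has_derivative
     (\<lambda>(h, k, l). (b / c * k, 0, - (a / c * h + fib (fam_y (fam_x C)) (0, 0, 0) * k + 1 / c * l))))
   (at (0, 0, 0))"
proof -
  have z: "(0, 0, 0) \<in> W" using V by simp
  have N': "(N has_derivative (\<lambda>(h, k, l). - (a / c * h + fib (fam_y (fam_x C)) (0, 0, 0) * k + 1 / c * l)))
      (at (0, 0, 0))"
    by (rule has_derivative_eq_rhs[OF N_has_derivative[OF V(2)]])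
       (simp add: fun_eq_iff fib_expand fam_p_simps jetx jetx[unfolded One_nat_def] jety jetxx)
  have "(g has_derivative (\<lambda>(h, k, l). fib (fam_x (fam_p C)) (0, 0, 0) * h +
      fib (fam_y (fam_p C)) (0, 0, 0) * k + fib (fam_p (fam_p C)) (0, 0, 0) * l)) (at (0, 0, 0))"
    by (intro fib_has_derivative Cp_diff V)
  then have g': "(g has_derivative (\<lambda>(h, k, l). b / c * k)) (at (0, 0, 0))"
    by (rule has_derivative_eq_rhs)
       (simp add: fun_eq_iff fib_expand fam_p_simps fam_p_partials C_diff V jet0 jetx jety
          jet0[unfolded One_nat_def] jetx[unfolded One_nat_def] jety[unfolded One_nat_def])
  have "((\<lambda>z. (g z, snd (snd z) * g z, N z)) has_derivative
     (\<lambda>v. (case v of (h, k, l) \<Rightarrow> b / c * k,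
        snd (snd (0::real, 0::real, 0::real)) * (case v of (h, k, l) \<Rightarrow> b / c * k) + snd (snd v) * g (0, 0, 0),
        case v of (h, k, l) \<Rightarrow> - (a / c * h + fib (fam_y (fam_x C)) (0, 0, 0) * k + 1 / c * l)))) (at (0, 0, 0))"
    by (intro has_derivative_Pair has_derivative_mult g' N' has_derivative_snd has_derivative_ident)
  then have "((\<lambda>z. (g z, snd (snd z) * g z, N z)) has_derivative
     (\<lambda>(h, k, l). (b / c * k, 0, - (a / c * h + fib (fam_y (fam_x C)) (0, 0, 0) * k + 1 / c * l)))) (at (0, 0, 0))"
    by (rule has_derivative_eq_rhs) (simp add: fun_eq_iff fib_at_origin)
  then show ?thesis
    by (rule has_derivative_transform_within_open[OF _ open_W z]) (simp add: field_eq)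
qed

lemma C_second_order:
  assumes "(x \<longlongrightarrow> 0) \<F>" "\<forall>\<^sub>F i in \<F>. x i \<noteq> 0" "((\<lambda>i. y i / (x i)^2) \<longlongrightarrow> \<eta>) \<F>"
  shows "((\<lambda>i. C k (x i, y i) / (x i)^2) \<longlongrightarrow> Dx (Dx (C k)) (0, 0) / 2 + Dy (C k) (0, 0) * \<eta>) \<F>"
  using second_jet_limit[OF V(1) V0 C_Ck(1) assms, of k] by (simp add: zero_prod_def jet0 jetx)

text \<open>Splitting off the factor \<open>y\<close> writes the equation of the surface as
  \<open>x^2 * T + y * S = 0\<close> with \<open>T\<close> tending to \<open>a / (2 * c)\<close> and
  \<open>S\<close> to \<open>1 / c\<close>. It is stated for arbitrary families on the surface so
  that it serves both a given center manifold and the one to be constructed.\<close>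

lemma surface_limit:
  assumes x: "(x \<longlongrightarrow> 0) \<F>" "\<forall>\<^sub>F i in \<F>. x i \<noteq> 0" and y: "(y \<longlongrightarrow> 0) \<F>" and p: "(p \<longlongrightarrow> 0) \<F>"
    and f: "\<forall>\<^sub>F i in \<F>. fib C (x i, y i, p i) = 0"
  shows "((\<lambda>i. y i / (x i)^2) \<longlongrightarrow> - a / 2) \<F>"
proof -
  have "\<exists>q. (q \<longlongrightarrow> Dy (C k) 0) \<F> \<and> (\<forall>\<^sub>F i in \<F>. C k (x i, y i) = C k (x i, 0) + q i * y i)" for k
  proof -
    have "continuous_on V (Dy (C k))" using Cd_Ck(4)[of k] by (rule Ck_on_imp_continuous_on)
    from partial_quotient[OF V(1) V0 C_diff this x(1) y] show ?thesis by blast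
  qed
  then have "\<forall>k. \<exists>q. (q \<longlongrightarrow> Dy (C k) 0) \<F> \<and> (\<forall>\<^sub>F i in \<F>. C k (x i, y i) = C k (x i, 0) + q i * y i)"
    by (intro allI)
  from choice[OF this] obtain q where q:
      "\<And>k. (q k \<longlongrightarrow> Dy (C k) 0) \<F>"
      "\<And>k. \<forall>\<^sub>F i in \<F>. C k (x i, y i) = C k (x i, 0) + q k i * y i"
    by blast
  have at0: "filterlim x (at 0) \<F>" using x by (simp add: filterlim_at)
  define S T where "S i = (\<Sum>k\<le>4. q k i * p i ^ k)" and "T i = (\<Sum>k\<le>4. C k (x i, 0) / (x i)^2 * p i ^ k)" for i
  have "(S \<longlongrightarrow> (\<Sum>k\<le>4. Dy (C k) 0 * 0 ^ k)) \<F>"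
    unfolding S_def by (intro tendsto_intros q p)
  then have S: "(S \<longlongrightarrow> 1 / c) \<F>" by (simp add: sum_atMost_4 jety zero_prod_def)
  have "((\<lambda>i. C k (x i, 0) / (x i)^2) \<longlongrightarrow> Dx (Dx (C k)) (0, 0) / 2) \<F>" for k
    using C_second_order[OF x, of "\<lambda>_. 0" 0] by simp
  then have "(T \<longlongrightarrow> (\<Sum>k\<le>4. Dx (Dx (C k)) (0, 0) / 2 * 0 ^ k)) \<F>"
    unfolding T_def by (intro tendsto_sum tendsto_mult tendsto_power p)
  then have T: "(T \<longlongrightarrow> a / c / 2) \<F>" by (simp add: sum_atMost_4 jetxx)
  have "\<forall>\<^sub>F i in \<F>. S i \<noteq> 0"
    using tendsto_imp_eventually_ne[OF S] c0 by simp
  moreover have "\<forall>\<^sub>F i in \<F>. \<forall>k\<in>{..4}. C k (x i, y i) = C k (x i, 0) + q k i * y i"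
    using q(2) by (simp add: eventually_ball_finite)
  ultimately have "\<forall>\<^sub>F i in \<F>. - (T i / S i) = y i / (x i)^2"
    using f x(2)
  proof eventually_elim
    case (elim i)
    have "0 = (\<Sum>k\<le>4. C k (x i, y i) * p i ^ k)" using elim(3) by (simp add: fib_def)
    also have "\<dots> = (\<Sum>k\<le>4. (x i)^2 * (C k (x i, 0) / (x i)^2 * p i ^ k) + y i * (q k i * p i ^ k))"
      by (rule sum.cong) (use elim in \<open>auto simp: algebra_simps\<close>)
    also have "\<dots> = (x i)^2 * T i + y i * S i"
      by (simp add: sum.distrib sum_distrib_left S_def T_def)
    finally show ?case using elim by (simp add: field_simps eq_neg_iff_add_eq_0)
  qed
  moreover have "((\<lambda>i. - (T i / S i)) \<longlongrightarrow> - (a / c / 2 / (1 / c))) \<F>"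
    by (intro tendsto_intros S T) (use c0 in simp)
  ultimately have "((\<lambda>i. y i / (x i)^2) \<longlongrightarrow> - (a / c / 2 / (1 / c))) \<F>"
    by (rule Lim_transform_eventually[rotated])
  then show ?thesis using c0 by simp
qed

text \<open>As \<open>p\<close> tends to \<open>0\<close> only \<open>C 1\<close> survives, and
  \<open>y\<close> behaving like \<open>- a * x^2 / 2\<close> turns its jet
  \<open>(e * x^2 / 2 + b * y) / c\<close> into the claimed multiple of \<open>x^2\<close>.\<close>

lemma g_limit:
  assumes x: "(x \<longlongrightarrow> 0) \<F>" "\<forall>\<^sub>F i in \<F>. x i \<noteq> 0" and y: "((\<lambda>i. y i / (x i)^2) \<longlongrightarrow> - a / 2) \<F>"
    and p: "(p \<longlongrightarrow> 0) \<F>"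
  shows "((\<lambda>i. g (x i, y i, p i) / (x i)^2) \<longlongrightarrow> (e - b * a) / (2 * c)) \<F>"
proof -
  note L = C_second_order[OF x y]
  let ?l = "\<lambda>k. Dx (Dx (C k)) (0, 0) / 2 + Dy (C k) (0, 0) * (- a / 2)"
  have "((\<lambda>i. C 1 (x i, y i) / (x i)^2 + 2 * (C 2 (x i, y i) / (x i)^2) * p i
      + 3 * (C 3 (x i, y i) / (x i)^2) * (p i)^2 + 4 * (C 4 (x i, y i) / (x i)^2) * (p i)^3)
    \<longlongrightarrow> ?l 1 + 2 * ?l 2 * 0 + 3 * ?l 3 * 0^2 + 4 * ?l 4 * 0^3) \<F>"
    by (intro tendsto_add tendsto_mult tendsto_const L p tendsto_power)
  moreover have "?l 1 + 2 * ?l 2 * 0 + 3 * ?l 3 * 0^2 + 4 * ?l 4 * 0^3 = (e - b * a) / (2 * c)"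
    using c0 by (simp add: jetxx[unfolded One_nat_def] jety[unfolded One_nat_def] field_simps)
  moreover have "C 1 (x i, y i) / (x i)^2 + 2 * (C 2 (x i, y i) / (x i)^2) * p i
      + 3 * (C 3 (x i, y i) / (x i)^2) * (p i)^2 + 4 * (C 4 (x i, y i) / (x i)^2) * (p i)^3
      = g (x i, y i, p i) / (x i)^2" for i
    by (simp add: fib_expand fam_p_simps fam_p_simps[unfolded One_nat_def] add_divide_distrib)
  ultimately show ?thesis by simp
qed

lemma saddle_node_fiber_coord:
  assumes "has_saddle_node_eigenvalues (fib C) (lie_cartan_field (Some p) (fib C)) (0, 0, p)"
  shows "p = 0"
proof -
  have z: "(0, 0, p) \<in> W" using V by simp
  have "\<phi> p \<noteq> 0"
  proof
    assume "\<phi> p = 0"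
    then have "frechet_derivative (fib C) (at (0, 0, p)) = (\<lambda>_. 0)"
      by (auto simp: fun_eq_iff fd_fib[OF z] fib_at_origin)
    then show False using assms by (simp add: has_saddle_node_eigenvalues_def)
  qed
  moreover have "p * \<phi> p / c = 0"
    using assms by (simp add: has_saddle_node_eigenvalues_def field_eq[OF z, simplified] field_eq[OF z]
        N_def fib_at_origin zero_prod_def)
  ultimately show ?thesis using c0 by simp
qed

text \<open>The initial velocity of a center manifold lies in the tangent plane and in the kernel,
  so it is \<open>x1\<close> times \<open>(1, 0, - a)\<close> with \<open>x1 \<noteq> 0\<close>.
  Comparing first components gives \<open>h = g / x'\<close>, so that \<open>h t / t^2\<close> tends
  to \<open>x1 * (e - b * a) / (2 * c)\<close>.\<close>

lemma saddle_node_imp: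
  assumes "quadratic_saddle_node_along (fib C) (lie_cartan_field (Some p0) (fib C)) (0, 0, p0) \<gamma>"
  shows "e - b * a \<noteq> 0"
proof -
  let ?X = "lie_cartan_field (Some p0) (fib C)"
  have p0: "p0 = 0"
    using assms saddle_node_fiber_coord by (simp add: quadratic_saddle_node_along_def)
  obtain h k where cm: "center_manifold (fib C) ?X (0, 0, 0) \<gamma> h" and k: "k \<noteq> 0"
    and h: "((\<lambda>t. h t / t^2) \<longlongrightarrow> k) (at 0)"
    using assms unfolding quadratic_saddle_node_along_def p0 by blast
  obtain \<delta> where \<delta>: "\<delta> > 0" and C1: "\<gamma> C1_differentiable_on {-\<delta><..<\<delta>}"
    and cmt: "\<And>t. t \<in> {-\<delta><..<\<delta>} \<Longrightarrow> vector_derivative \<gamma> (at t) \<noteq> 0 \<and> fib C (\<gamma> t) = 0 \<and>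
            ?X (\<gamma> t) = h t *\<^sub>R vector_derivative \<gamma> (at t)"
    and \<gamma>0: "\<gamma> 0 = (0, 0, 0)"
    and ker: "frechet_derivative ?X (at (0, 0, 0)) (vector_derivative \<gamma> (at 0)) = 0"
    using cm unfolding center_manifold_def by blast
  obtain D where D: "\<And>t. t \<in> {-\<delta><..<\<delta>} \<Longrightarrow> (\<gamma> has_vector_derivative D t) (at t)"
    and cD: "continuous_on {-\<delta><..<\<delta>} D"
    using C1 unfolding C1_differentiable_on_def by blast
  have vD: "vector_derivative \<gamma> (at t) = D t" if "t \<in> {-\<delta><..<\<delta>}" for t
    using D[OF that] by (rule vector_derivative_at)
  have ev: "\<forall>\<^sub>F t in at 0. t \<in> {-\<delta><..<\<delta>}"
    using \<delta> by (intro eventually_at_in_open') auto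
  define x y p where "x t = fst (\<gamma> t)" and "y t = fst (snd (\<gamma> t))" and "p t = snd (snd (\<gamma> t))" for t
  obtain x1 y1 p1 where D0: "D 0 = (x1, y1, p1)" by (cases "D 0")
  have \<gamma>d: "(\<gamma> has_derivative (\<lambda>t. t *\<^sub>R (x1, y1, p1))) (at 0)"
    using D[of 0] \<delta> by (simp add: has_vector_derivative_def D0)
  have xd: "(x has_real_derivative x1) (at 0)" and yd: "(y has_real_derivative y1) (at 0)"
    and pd: "(p has_real_derivative p1) (at 0)"
    using has_derivative_fst[OF \<gamma>d] has_derivative_fst[OF has_derivative_snd[OF \<gamma>d]]
      has_derivative_snd[OF has_derivative_snd[OF \<gamma>d]]
    by (simp_all add: x_def[abs_def] y_def[abs_def] p_def[abs_def] has_field_derivative_def mult_commute_abs)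
  have zero: "x 0 = 0" "y 0 = 0" "p 0 = 0" by (simp_all add: x_def y_def p_def \<gamma>0)
  have "\<phi> 0 = 1" by (simp add: \<phi>_def)
  have fd: "(fib C has_derivative (\<lambda>(h, k, l). 1 / c * k)) (at (\<gamma> 0))"
    using fib_has_derivative[of C 0 0 0, OF C_diff[OF V(2)]] by (simp add: fib_at_origin \<open>\<phi> 0 = 1\<close> \<gamma>0)
  \<comment> \<open>The same function is identically zero near \<open>0\<close>; the two derivatives
    together force the \<open>y\<close>-component of the velocity to vanish.\<close>
  have "((\<lambda>t. fib C (\<gamma> t)) has_derivative (\<lambda>t. 1 / c * (t * y1))) (at 0)"
    using has_derivative_compose[OF \<gamma>d fd] by simp
  moreover have "((\<lambda>t. fib C (\<gamma> t)) has_derivative (\<lambda>_. 0)) (at 0)"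
  proof (rule has_derivative_transform_within_open[of "\<lambda>_. 0" _ 0 UNIV "{-\<delta><..<\<delta>}"])
    show "((\<lambda>_. 0) has_derivative (\<lambda>_. 0)) (at (0::real))" by simp
  qed (use \<delta> cmt in auto)
  ultimately have "(\<lambda>t. 1 / c * (t * y1)) = (\<lambda>_. 0)" by (rule has_derivative_unique)
  from fun_cong[OF this, of 1] c0 have y1: "y1 = 0" by simp
  have "vector_derivative \<gamma> (at 0) = (x1, y1, p1)" using vD[of 0] \<delta> D0 by simp
  with ker frechet_derivative_at[OF field_has_derivative[of p0], symmetric] y1
  have "a / c * x1 + 1 / c * p1 = 0" by (simp add: zero_prod_def)
  then have "p1 = - a * x1" using c0 by (simp add: field_simps eq_neg_iff_add_eq_0)
  moreover have "(x1, y1, p1) \<noteq> 0"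
    using cmt[of 0] vD[of 0] \<delta> D0 by simp
  ultimately have x1: "x1 \<noteq> 0" using y1 by (auto simp: zero_prod_def)
  have xt: "((\<lambda>t. x t / t) \<longlongrightarrow> x1) (at 0)"
    using xd zero by (simp add: has_field_derivative_iff)
  have xne: "\<forall>\<^sub>F t in at 0. x t \<noteq> 0"
    using tendsto_imp_eventually_ne[OF xt x1] by eventually_elim auto
  have lim0: "(x \<longlongrightarrow> 0) (at 0)" "(y \<longlongrightarrow> 0) (at 0)" "(p \<longlongrightarrow> 0) (at 0)"
    using DERIV_isCont[OF xd] DERIV_isCont[OF yd] DERIV_isCont[OF pd] zero by (simp_all add: isCont_def)
  have \<gamma>xyp: "\<gamma> t = (x t, y t, p t)" for t by (simp add: x_def y_def p_def)
  have f0: "\<forall>\<^sub>F t in at 0. fib C (x t, y t, p t) = 0"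
    using ev by eventually_elim (use cmt \<gamma>xyp in metis)
  note yl = surface_limit[OF lim0(1) xne lim0(2,3) f0]
  note gl = g_limit[OF lim0(1) xne yl lim0(3)]
  have "isCont D 0" using cD \<delta> by (simp add: continuous_on_eq_continuous_at)
  then have "((\<lambda>t. fst (D t)) \<longlongrightarrow> x1) (at 0)"
    using tendsto_fst[of D "D 0" "at 0"] D0 by (simp add: isCont_def)
  note lims = tendsto_divide[OF tendsto_mult[OF gl tendsto_power[OF xt, of 2]] this x1]
  have "\<forall>\<^sub>F t in at 0. (x t, y t) \<in> V"
    by (rule eventually_pair_in_open[OF V(1) V0 lim0(1,2)])
  then have "\<forall>\<^sub>F t in at 0. g (x t, y t, p t) / (x t)^2 * (x t / t)^2 / fst (D t) = h t / t^2"
    using ev xne tendsto_imp_eventually_ne[OF \<open>((\<lambda>t. fst (D t)) \<longlongrightarrow> x1) (at 0)\<close> x1]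
  proof eventually_elim
    case (elim t)
    have "?X (\<gamma> t) = h t *\<^sub>R D t" using cmt[OF elim(2)] vD[OF elim(2)] by simp
    moreover have "fst (?X (\<gamma> t)) = g (x t, y t, p t)"
      using field_eq[of "\<gamma> t" p0] elim(1) by (simp add: \<gamma>xyp)
    ultimately have "g (x t, y t, p t) = h t * fst (D t)" by simp
    then show ?case using elim by (simp add: field_simps)
  qed
  then have "((\<lambda>t. h t / t^2) \<longlongrightarrow> (e - b * a) / (2 * c) * x1^2 / x1) (at 0)"
    by (rule Lim_transform_eventually[OF lims])
  from tendsto_unique[OF _ this h] k show ?thesis by auto
qed

end

section \<open>Implicit functions\<close>

text \<open>Linearization at the point first shows that \<open>y\<close> is Lipschitz there, then
  makes the error negligible. Working at a single point matters later: \<open>F\<close> will contain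
  the center slope, which at that stage is differentiable but not yet known to be of class
  \<open>C^1\<close>.\<close>

lemma implicit_curve_DERIV:
  fixes F :: "real \<times> real \<Rightarrow> real" and y :: "real \<Rightarrow> real"
  assumes F: "(F has_derivative (\<lambda>(h, k). A * h + B * k)) (at (t0, y t0))" and B: "B \<noteq> 0"
    and ev: "\<forall>\<^sub>F t in at t0. F (t, y t) = F (t0, y t0)" and y: "isCont y t0"
  shows "(y has_real_derivative - A / B) (at t0)"
  unfolding has_field_derivative_iff
proof (rule tendstoI)
  fix \<epsilon> :: real assume \<epsilon>: "\<epsilon> > 0"
  define K where "K = (2 * \<bar>A\<bar> + \<bar>B\<bar>) / \<bar>B\<bar>"
  have K: "K \<ge> 0" by (simp add: K_def)
  \<comment> \<open>The first bound lets half of \<open>\<bar>B * \<sigma>\<bar>\<close> be absorbed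
    on the left, which produces the Lipschitz constant \<open>K\<close>; the second keeps the
    remaining error below \<open>\<epsilon> * \<bar>B\<bar> * \<bar>\<tau>\<bar>\<close>.\<close>
  define \<eta> where "\<eta> = min (\<bar>B\<bar> / 2) (\<epsilon> * \<bar>B\<bar> / (2 * (1 + K)))"
  have \<eta>: "\<eta> > 0" "\<eta> \<le> \<bar>B\<bar> / 2" "\<eta> * (1 + K) \<le> \<epsilon> * \<bar>B\<bar> / 2"
  proof -
    show "\<eta> > 0" using \<epsilon> B K by (simp add: \<eta>_def)
    show "\<eta> \<le> \<bar>B\<bar> / 2" unfolding \<eta>_def by (rule min.cobounded1)
    have "\<eta> \<le> \<epsilon> * \<bar>B\<bar> / (2 * (1 + K))" by (simp add: \<eta>_def)
    then show "\<eta> * (1 + K) \<le> \<epsilon> * \<bar>B\<bar> / 2" using K by (simp add: field_simps)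
  qed
  obtain d where d: "d > 0" "\<And>z. norm (z - (t0, y t0)) < d \<Longrightarrow>
      norm (F z - F (t0, y t0) - (case z - (t0, y t0) of (h, k) \<Rightarrow> A * h + B * k)) \<le> \<eta> * norm (z - (t0, y t0))"
    using F \<eta>(1) unfolding has_derivative_at_alt by blast
  have "((\<lambda>t. (t, y t)) \<longlongrightarrow> (t0, y t0)) (at t0)"
    using y by (intro tendsto_Pair tendsto_ident_at) (simp add: isCont_def)
  then have "\<forall>\<^sub>F t in at t0. norm ((t, y t) - (t0, y t0)) < d"
    using tendstoD[OF _ d(1)] by (fastforce simp: dist_norm)
  moreover have "\<forall>\<^sub>F t in at t0. t \<noteq> t0" by (simp add: eventually_at_filter)
  ultimately show "\<forall>\<^sub>F t in at t0. dist ((y t - y t0) / (t - t0)) (- A / B) < \<epsilon>"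
    using ev
  proof eventually_elim
    case (elim t)
    define \<tau> \<sigma> where "\<tau> = t - t0" and "\<sigma> = y t - y t0"
    have \<tau>: "\<bar>\<tau>\<bar> > 0" using elim by (simp add: \<tau>_def)
    have "\<bar>A * \<tau> + B * \<sigma>\<bar> \<le> \<eta> * norm (\<tau>, \<sigma>)"
      using d(2)[OF elim(1)] elim(3) by (simp add: \<tau>_def \<sigma>_def abs_minus_commute)
    also have "\<dots> \<le> \<eta> * (\<bar>\<tau>\<bar> + \<bar>\<sigma>\<bar>)"
      using \<eta>(1) norm_Pair_le[of \<tau> \<sigma>] by (intro mult_left_mono) auto
    finally have 1: "\<bar>A * \<tau> + B * \<sigma>\<bar> \<le> \<eta> * (\<bar>\<tau>\<bar> + \<bar>\<sigma>\<bar>)" .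
    have "\<eta> * (\<bar>\<tau>\<bar> + \<bar>\<sigma>\<bar>) \<le> \<bar>B\<bar> / 2 * (\<bar>\<tau>\<bar> + \<bar>\<sigma>\<bar>)"
      using \<eta>(2) by (intro mult_right_mono) auto
    with 1 have "\<bar>B * \<sigma>\<bar> \<le> \<bar>A * \<tau>\<bar> + \<bar>B\<bar> / 2 * (\<bar>\<tau>\<bar> + \<bar>\<sigma>\<bar>)" by linarith
    then have "\<bar>\<sigma>\<bar> * \<bar>B\<bar> \<le> (2 * \<bar>A\<bar> + \<bar>B\<bar>) * \<bar>\<tau>\<bar>"
      unfolding abs_mult by (simp add: field_simps)
    then have "\<bar>\<sigma>\<bar> \<le> K * \<bar>\<tau>\<bar>" using B by (simp add: K_def field_simps)
    then have "\<eta> * (\<bar>\<tau>\<bar> + \<bar>\<sigma>\<bar>) \<le> \<eta> * (\<bar>\<tau>\<bar> + K * \<bar>\<tau>\<bar>)"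
      using \<eta>(1) by (intro mult_left_mono) auto
    also have "\<dots> = \<eta> * (1 + K) * \<bar>\<tau>\<bar>" by (simp add: algebra_simps)
    also have "\<dots> \<le> \<epsilon> * \<bar>B\<bar> / 2 * \<bar>\<tau>\<bar>" using \<eta>(3) by (intro mult_right_mono) auto
    also have "\<dots> < \<epsilon> * \<bar>B\<bar> * \<bar>\<tau>\<bar>" using \<epsilon> B \<tau> by simp
    finally have "\<bar>A * \<tau> + B * \<sigma>\<bar> < \<epsilon> * \<bar>B\<bar> * \<bar>\<tau>\<bar>" using 1 by simp
    moreover have "\<sigma> / \<tau> - (- A / B) = (A * \<tau> + B * \<sigma>) / (B * \<tau>)"
      using B \<tau> by (simp add: field_simps)
    ultimately show ?case
      using B \<tau> by (simp add: dist_real_def \<tau>_def[symmetric] \<sigma>_def[symmetric] abs_divide abs_mult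
          pos_divide_less_eq mult.assoc)
  qed
qed

text \<open>Opposite signs at \<open>r\<close> and \<open>- r\<close> give a zero by the
  intermediate value theorem, monotonicity makes it unique. The parameter space is left abstract
  because it is the \<open>(x, p)\<close>-plane for the surface and a line for the plane
  curve.\<close>

lemma implicit_function_monotone:
  fixes f :: "'s::t2_space \<Rightarrow> real \<Rightarrow> real"
  assumes U: "open U" "s0 \<in> U" and r: "r > 0" and f0: "f s0 0 = 0"
    and cs: "\<And>y. y \<in> {-r..r} \<Longrightarrow> continuous_on U (\<lambda>s. f s y)"
    and cy: "\<And>s. s \<in> U \<Longrightarrow> continuous_on {-r..r} (f s)"
    and mono: "\<And>s y z. s \<in> U \<Longrightarrow> -r \<le> y \<Longrightarrow> y < z \<Longrightarrow> z \<le> r \<Longrightarrow> f s y < f s z"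
  obtains U' Y where "open U'" "s0 \<in> U'" "U' \<subseteq> U" "continuous_on U' Y"
    "\<And>s. s \<in> U' \<Longrightarrow> \<bar>Y s\<bar> < r \<and> f s (Y s) = 0"
    "\<And>s y. s \<in> U' \<Longrightarrow> \<bar>y\<bar> \<le> r \<Longrightarrow> f s y = 0 \<Longrightarrow> y = Y s"
proof -
  define U' where "U' = {s\<in>U. f s r > 0} \<inter> {s\<in>U. f s (-r) < 0}"
  have op: "open {s\<in>U. f s y > 0}" "open {s\<in>U. f s y < 0}" if "y \<in> {-r..r}" for y
    using continuous_open_preimage[OF cs[OF that] U(1), of "{0<..}"]
      continuous_open_preimage[OF cs[OF that] U(1), of "{..<0}"]
    by (simp_all add: vimage_def Int_def)
  have U': "open U'" unfolding U'_def using op r by (intro open_Int) auto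
  have s0: "s0 \<in> U'" using mono[OF U(2), of 0 r] mono[OF U(2), of "-r" 0] f0 r U by (simp add: U'_def)
  have ex: "\<exists>y. \<bar>y\<bar> < r \<and> f s y = 0" if "s \<in> U'" for s
  proof -
    have "\<exists>y\<ge>-r. y \<le> r \<and> f s y = 0"
      using that r by (intro IVT' cy) (auto simp: U'_def)
    then obtain y where y: "-r \<le> y" "y \<le> r" "f s y = 0" by blast
    then have "y \<noteq> r" "y \<noteq> -r" using that by (auto simp: U'_def)
    with y show ?thesis by (intro exI[of _ y]) auto
  qed
  define Y where "Y s = (SOME y. \<bar>y\<bar> < r \<and> f s y = 0)" for s
  have Y: "\<bar>Y s\<bar> < r \<and> f s (Y s) = 0" if "s \<in> U'" for s
    unfolding Y_def using someI_ex[OF ex[OF that]] .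
  have uniq: "y = Y s" if "s \<in> U'" "\<bar>y\<bar> \<le> r" "f s y = 0" for s y
    using mono[of s y "Y s"] mono[of s "Y s" y] that Y[OF that(1)] by (force simp: U'_def)
  have "isCont Y s" if s: "s \<in> U'" for s
    unfolding isCont_def
  proof (rule tendstoI)
    fix \<epsilon> :: real assume \<epsilon>: "\<epsilon> > 0"
    \<comment> \<open>Small enough for \<open>\<epsilon>\<close> and for \<open>Y s - d\<close>,
      \<open>Y s + d\<close> to stay in the interval; the strict signs there persist for nearby
      parameters and trap \<open>Y t\<close> between them.\<close>
    define d where "d = min (\<epsilon> / 2) ((r - \<bar>Y s\<bar>) / 2)"
    have d: "d > 0" "d < \<epsilon>" "Y s - d \<in> {-r..r}" "Y s + d \<in> {-r..r}"
      using \<epsilon> Y[OF s] by (auto simp: d_def min_def abs_real_def field_simps split: if_splits)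
    let ?N = "U' \<inter> {t\<in>U. f t (Y s + d) > 0} \<inter> {t\<in>U. f t (Y s - d) < 0}"
    have "open ?N" using U' op d by (intro open_Int) auto
    moreover have "s \<in> ?N"
      using s d Y[OF s] mono[of s "Y s" "Y s + d"] mono[of s "Y s - d" "Y s"] by (auto simp: U'_def)
    ultimately have "\<forall>\<^sub>F t in at s. t \<in> ?N" by (rule eventually_at_in_open')
    then show "\<forall>\<^sub>F t in at s. dist (Y t) (Y s) < \<epsilon>"
    proof eventually_elim
      case (elim t)
      then have t: "f t (Y s + d) > 0" "f t (Y s - d) < 0" "t \<in> U" "t \<in> U'" by (auto simp: U'_def)
      have "\<not> Y s + d \<le> Y t"
      proof
        assume "Y s + d \<le> Y t"
        then have "f t (Y s + d) \<le> f t (Y t)"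
          using mono[OF t(3), of "Y s + d" "Y t"] d Y[OF t(4)] by (cases "Y s + d = Y t") (auto simp: abs_less_iff)
        then show False using t Y[OF t(4)] by simp
      qed
      moreover have "\<not> Y t \<le> Y s - d"
      proof
        assume "Y t \<le> Y s - d"
        then have "f t (Y t) \<le> f t (Y s - d)"
          using mono[OF t(3), of "Y t" "Y s - d"] d Y[OF t(4)] by (cases "Y t = Y s - d") (auto simp: abs_less_iff)
        then show False using t Y[OF t(4)] by simp
      qed
      ultimately show ?case using d by (auto simp: dist_real_def)
    qed
  qed
  then have "continuous_on U' Y" by (simp add: continuous_at_imp_continuous_on)
  then show ?thesis using that[OF U' s0 _ _ Y uniq] U'_def by blast
qed

lemma open_contains_box3:
  fixes A :: "(real \<times> real \<times> real) set"
  assumes "open A" "(0, 0, 0) \<in> A"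
  obtains \<rho> where "\<rho> > 0" "\<And>x y p. \<bar>x\<bar> \<le> \<rho> \<Longrightarrow> \<bar>y\<bar> \<le> \<rho> \<Longrightarrow> \<bar>p\<bar> \<le> \<rho> \<Longrightarrow> (x, y, p) \<in> A"
proof -
  obtain \<epsilon> where \<epsilon>: "\<epsilon> > 0" "ball (0, 0, 0) \<epsilon> \<subseteq> A"
    using assms open_contains_ball by blast
  show ?thesis
  proof (rule that[of "\<epsilon> / 4"])
    show "(x, y, p) \<in> A" if "\<bar>x\<bar> \<le> \<epsilon> / 4" "\<bar>y\<bar> \<le> \<epsilon> / 4" "\<bar>p\<bar> \<le> \<epsilon> / 4" for x y p
    proof -
      have "norm (x, y, p) \<le> \<bar>x\<bar> + (\<bar>y\<bar> + \<bar>p\<bar>)"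
        using norm_Pair_le[of x "(y, p)"] norm_Pair_le[of y p] by simp
      then have "norm (x, y, p) < \<epsilon>" using that \<epsilon> by linarith
      then have "(x, y, p) \<in> ball (0, 0, 0) \<epsilon>" by (simp flip: zero_prod_def)
      then show ?thesis using \<epsilon> by blast
    qed
  qed (use \<epsilon> in simp)
qed

lemma bounded_mult_null:
  fixes w u :: "'i \<Rightarrow> real"
  assumes "\<forall>\<^sub>F i in \<F>. \<bar>w i\<bar> \<le> B" "(u \<longlongrightarrow> 0) \<F>"
  shows "((\<lambda>i. w i * u i) \<longlongrightarrow> 0) \<F>"
proof (rule Lim_null_comparison)
  show "\<forall>\<^sub>F i in \<F>. norm (w i * u i) \<le> B * \<bar>u i\<bar>"
    using assms(1) by eventually_elim (auto simp: abs_mult intro: mult_right_mono)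
  show "((\<lambda>i. B * \<bar>u i\<bar>) \<longlongrightarrow> 0) \<F>"
    using tendsto_mult_left[OF tendsto_rabs_zero[OF assms(2)], of B] by simp
qed

section \<open>Expansion of the field and the surface as a graph over \<open>(x, p)\<close>\<close>

context axial_jets
begin

lemma isCont_C: "isCont (C k) (0, 0)" "isCont (Dx (C k)) (0, 0)" "isCont (Dy (C k)) (0, 0)"
  "isCont (Dx (Dx (C k))) (0, 0)" "isCont (Dy (Dx (C k))) (0, 0)"
  "isCont (Dx (Dy (C k))) (0, 0)" "isCont (Dy (Dy (C k))) (0, 0)"
proof -
  have *: "isCont D (0, 0)" if "Ck_on n D V" for D :: "real \<times> real \<Rightarrow> real" and n
    using Ck_on_imp_continuous_on[OF that] V by (simp add: continuous_on_eq_continuous_at)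
  have 1: "Ck_on (Suc 1) (Dx (C k)) V" "Ck_on (Suc 1) (Dy (C k)) V" using Cd_Ck by (simp_all add: numeral_2_eq_2)
  show "isCont (C k) (0, 0)" "isCont (Dx (C k)) (0, 0)" "isCont (Dy (C k)) (0, 0)"
    "isCont (Dx (Dx (C k))) (0, 0)" "isCont (Dy (Dx (C k))) (0, 0)"
    "isCont (Dx (Dy (C k))) (0, 0)" "isCont (Dy (Dy (C k))) (0, 0)"
    by (rule *[OF C3] *[OF Cd_Ck(1)] *[OF Cd_Ck(2)] *[OF Ck_on_SucD(2)[OF 1(1)]] *[OF Ck_on_SucD(2)[OF 1(2)]])+
qed

lemma isCont_fam_p: "(\<And>k. isCont (D k) z) \<Longrightarrow> isCont (fam_p D k) z"
  unfolding fam_p_def by (cases "k < 4") (auto intro!: continuous_intros)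

lemma fib_tendsto:
  assumes "\<And>k. isCont (D k) (0, 0)" "(x \<longlongrightarrow> 0) \<F>" "(y \<longlongrightarrow> 0) \<F>" "(p \<longlongrightarrow> 0) \<F>"
  shows "((\<lambda>i. fib D (x i, y i, p i)) \<longlongrightarrow> D 0 (0, 0)) \<F>"
proof -
  have "((\<lambda>i. \<Sum>k\<le>4. D k (x i, y i) * p i ^ k) \<longlongrightarrow> (\<Sum>k\<le>4. D k (0, 0) * 0 ^ k)) \<F>"
    by (intro tendsto_sum tendsto_mult tendsto_power isCont_tendsto_compose[OF assms(1)]
        tendsto_Pair assms)
  then show ?thesis by (simp add: fib_def sum_atMost_4)
qed

text \<open>The coefficient of \<open>x^2\<close> in \<open>N\<close> along
  \<open>y = - a * x^2 / 2\<close>, \<open>p = - a * x\<close>. Its first term is the third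
  derivative that class \<open>C^3\<close> of the coefficients provides.\<close>

definition n2 :: real where
  "n2 = - (Dx (Dx (Dx (C 0))) (0, 0) / 2 - Dy (Dx (C 0)) (0, 0) * a / 2 - a * e / c
           - a * Dx (Dy (C 0)) (0, 0) + b * a^2 / c)"

text \<open>The linear part of \<open>N\<close> is \<open>- (a * x + p) / c\<close>. With slope
  \<open>- a\<close> it collapses to \<open>- x^2 * w / c\<close>, so every term is of order
  \<open>x^2\<close>. Since \<open>w\<close> is merely bounded, its contribution is moved to the
  left instead of being given a limit.\<close>

lemma N_limit:
  assumes x: "(x \<longlongrightarrow> 0) \<F>" "\<forall>\<^sub>F i in \<F>. x i \<noteq> 0" and y: "((\<lambda>i. y i / (x i)^2) \<longlongrightarrow> - a / 2) \<F>"
    and w: "\<forall>\<^sub>F i in \<F>. \<bar>w i\<bar> \<le> B" and p: "\<And>i. p i = - a * x i + (x i)^2 * w i"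
  shows "((\<lambda>i. N (x i, y i, p i) / (x i)^2 + w i / c) \<longlongrightarrow> n2) \<F>"
proof -
  have "((\<lambda>i. y i / (x i)^2 * x i) \<longlongrightarrow> - a / 2 * 0) \<F>"
    by (intro tendsto_intros x y)
  then have "((\<lambda>i. y i / x i) \<longlongrightarrow> - a / 2 * 0) \<F>"
    by (rule Lim_transform_eventually) (use x(2) in \<open>eventually_elim, simp add: power2_eq_square\<close>)
  then have yx: "((\<lambda>i. y i / x i) \<longlongrightarrow> 0) \<F>" by simp
  have "((\<lambda>i. y i / x i * x i) \<longlongrightarrow> 0 * 0) \<F>" by (intro tendsto_intros x yx)
  then have "(y \<longlongrightarrow> 0 * 0) \<F>"
    by (rule Lim_transform_eventually) (use x(2) in \<open>eventually_elim, simp\<close>)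
  then have y0: "(y \<longlongrightarrow> 0) \<F>" by simp
  have wx: "((\<lambda>i. w i * x i) \<longlongrightarrow> 0) \<F>" by (rule bounded_mult_null[OF w x(1)])
  have "((\<lambda>i. - a + w i * x i) \<longlongrightarrow> - a + 0) \<F>" by (intro tendsto_intros wx)
  then have "((\<lambda>i. p i / x i) \<longlongrightarrow> - a + 0) \<F>"
    by (rule Lim_transform_eventually)
       (use x(2) in \<open>eventually_elim, simp add: p field_simps power2_eq_square\<close>)
  then have px: "((\<lambda>i. p i / x i) \<longlongrightarrow> - a) \<F>" by simp
  have "((\<lambda>i. - a * x i + x i * (w i * x i)) \<longlongrightarrow> - a * 0 + 0 * 0) \<F>" by (intro tendsto_intros x wx)
  then have p0: "(p \<longlongrightarrow> 0) \<F>" by (simp add: p[abs_def] power2_eq_square mult.assoc mult.left_commute mult.commute)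
  have t: "((\<lambda>i. D (x i, y i)) \<longlongrightarrow> D (0, 0)) \<F>" if "isCont D (0, 0)" for D :: "real \<times> real \<Rightarrow> real"
    by (rule isCont_tendsto_compose[OF that tendsto_Pair[OF x(1) y0]])
  let ?x0 = "\<lambda>i. (Dx (C 0) (x i, y i) - a / c * x i) / (x i)^2"
  let ?x1 = "\<lambda>i. Dx (C 1) (x i, y i) / x i"
  let ?y0 = "\<lambda>i. (Dy (C 0) (x i, y i) - 1 / c) / x i"
  have X0: "(?x0 \<longlongrightarrow> Dx (Dx (Dx (C 0))) (0, 0) / 2 + Dy (Dx (C 0)) (0, 0) * (- a / 2)) \<F>"
    using second_jet_limit[OF V(1) V0 Cd_Ck(1)[of 0] x y] by (simp add: zero_prod_def jetx jetxx)
  have X1: "(?x1 \<longlongrightarrow> e / c) \<F>"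
    using first_jet_limit[OF V(1) V0 Cd_Ck(3)[of 1] x yx] jetxx(2)
    by (simp add: zero_prod_def jetx jetx[unfolded One_nat_def])
  have Y0: "(?y0 \<longlongrightarrow> Dx (Dy (C 0)) (0, 0)) \<F>"
    using first_jet_limit[OF V(1) V0 Cd_Ck(4)[of 0] x yx] by (simp add: zero_prod_def jety)
  let ?s = "\<lambda>i. ?x0 i + ?x1 i * (p i / x i) + Dx (C 2) (x i, y i) * (p i / x i)^2
      + Dx (C 3) (x i, y i) * (p i / x i)^2 * p i + Dx (C 4) (x i, y i) * (p i / x i)^2 * (p i)^2
      + ?y0 i * (p i / x i) + Dy (C 1) (x i, y i) * (p i / x i)^2 + Dy (C 2) (x i, y i) * (p i / x i)^2 * p i
      + Dy (C 3) (x i, y i) * (p i / x i)^2 * (p i)^2 + Dy (C 4) (x i, y i) * (p i / x i)^2 * (p i)^3"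
  have "((\<lambda>i. - ?s i) \<longlongrightarrow> - ((Dx (Dx (Dx (C 0))) (0, 0) / 2 + Dy (Dx (C 0)) (0, 0) * (- a / 2)) + e / c * (- a)
      + Dx (C 2) (0, 0) * (- a)^2 + Dx (C 3) (0, 0) * (- a)^2 * 0 + Dx (C 4) (0, 0) * (- a)^2 * 0^2
      + Dx (Dy (C 0)) (0, 0) * (- a) + Dy (C 1) (0, 0) * (- a)^2 + Dy (C 2) (0, 0) * (- a)^2 * 0
      + Dy (C 3) (0, 0) * (- a)^2 * 0^2 + Dy (C 4) (0, 0) * (- a)^2 * 0^3)) \<F>"
    by (intro tendsto_minus tendsto_add tendsto_mult tendsto_power X0 X1 Y0 px p0 t isCont_C)
  then have "((\<lambda>i. - ?s i) \<longlongrightarrow> n2) \<F>"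
    by (simp add: n2_def jetx jety jety[unfolded One_nat_def] algebra_simps)
  moreover have "\<forall>\<^sub>F i in \<F>. - ?s i = N (x i, y i, p i) / (x i)^2 + w i / c"
    using x(2)
  proof eventually_elim
    case (elim i)
    have "(Dx (C 0) (x i, y i) - a / c * x i) / (x i)^2 + (Dy (C 0) (x i, y i) - 1 / c) / x i * (p i / x i)
        = Dx (C 0) (x i, y i) / (x i)^2 + Dy (C 0) (x i, y i) * p i / (x i)^2 - w i / c"
      using elim c0 by (simp add: p field_simps power2_eq_square)
    moreover have "N (x i, y i, p i) / (x i)^2 = - (Dx (C 0) (x i, y i) / (x i)^2 + Dx (C 1) (x i, y i) / x i * (p i / x i)
      + Dx (C 2) (x i, y i) * (p i / x i)^2
      + Dx (C 3) (x i, y i) * (p i / x i)^2 * p i + Dx (C 4) (x i, y i) * (p i / x i)^2 * (p i)^2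
      + Dy (C 0) (x i, y i) * p i / (x i)^2
      + Dy (C 1) (x i, y i) * (p i / x i)^2 + Dy (C 2) (x i, y i) * (p i / x i)^2 * p i
      + Dy (C 3) (x i, y i) * (p i / x i)^2 * (p i)^2 + Dy (C 4) (x i, y i) * (p i / x i)^2 * (p i)^3)"
      using elim by (simp add: N_def fib_expand field_simps eval_nat_numeral)
    ultimately show ?case by simp
  qed
  ultimately show ?thesis by (rule Lim_transform_eventually)
qed

lemma continuous_on_W:
  "continuous_on W g" "continuous_on W N" "continuous_on W (fib C)" "continuous_on W (fib (fam_y C))"
proof -
  have 1: "continuous_on V (C k)" "continuous_on V (Dx (C k))" "continuous_on V (Dy (C k))" for k
    using Ck_on_imp_continuous_on[OF C3] Ck_on_imp_continuous_on[OF Cd_Ck(1)]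
      Ck_on_imp_continuous_on[OF Cd_Ck(2)] by auto
  have "continuous_on V (fam_p C k)" for k
    unfolding fam_p_def by (cases "k < 4") (auto intro!: continuous_intros 1)
  then show "continuous_on W g" by (rule continuous_on_fib)
  show "continuous_on W N"
    unfolding N_def[abs_def] by (intro continuous_intros continuous_on_fib 1)
  show "continuous_on W (fib C)" "continuous_on W (fib (fam_y C))"
    by (intro continuous_on_fib 1)+
qed

lemma implicit_surface:
  obtains \<rho> Y where "\<rho> > 0" "continuous_on ({-\<rho><..<\<rho>} \<times> {-\<rho><..<\<rho>}) (\<lambda>(x, p). Y x p)"
    "\<And>x p. \<bar>x\<bar> < \<rho> \<Longrightarrow> \<bar>p\<bar> < \<rho> \<Longrightarrow>
       (x, Y x p) \<in> V \<and> fib C (x, Y x p, p) = 0 \<and> fib (fam_y C) (x, Y x p, p) \<noteq> 0"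
    "\<And>p. \<bar>p\<bar> < \<rho> \<Longrightarrow> Y 0 p = 0"
proof -
  have "open {z\<in>W. c * fib (fam_y C) z > 0}"
  proof -
    have "continuous_on W (\<lambda>z. c * fib (fam_y C) z)" by (intro continuous_intros continuous_on_W)
    from continuous_open_preimage[OF this open_W, of "{0<..}"] show ?thesis
      by (simp add: vimage_def Int_def)
  qed
  moreover have "(0, 0, 0) \<in> {z\<in>W. c * fib (fam_y C) z > 0}"
    using V c0 by (simp add: fib_at_origin \<phi>_def)
  ultimately obtain r where r: "r > 0"
    and box: "\<And>x y p. \<bar>x\<bar> \<le> r \<Longrightarrow> \<bar>y\<bar> \<le> r \<Longrightarrow> \<bar>p\<bar> \<le> r \<Longrightarrow> (x, y) \<in> V \<and> c * fib (fam_y C) (x, y, p) > 0"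
    by (rule open_contains_box3) auto
  have boxV: "(x, y) \<in> V" if "\<bar>x\<bar> \<le> r" "\<bar>y\<bar> \<le> r" for x y using box[of x y 0] that r by simp
  let ?U = "{-r<..<r} \<times> {-r<..<r}"
  \<comment> \<open>The factor \<open>c\<close> normalizes the \<open>y\<close>-derivative to
    \<open>1\<close> at the origin, so the function increases in \<open>y\<close> for either sign of
    \<open>c\<close>.\<close>
  let ?f = "\<lambda>s y. c * fib C (fst s, y, snd s)"
  obtain U' Z where U': "open U'" "(0, 0) \<in> U'" "U' \<subseteq> ?U" and Z: "continuous_on U' Z"
    and Zf: "\<And>s. s \<in> U' \<Longrightarrow> \<bar>Z s\<bar> < r \<and> ?f s (Z s) = 0"
    and uniq: "\<And>s y. s \<in> U' \<Longrightarrow> \<bar>y\<bar> \<le> r \<Longrightarrow> ?f s y = 0 \<Longrightarrow> y = Z s"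
  proof (rule implicit_function_monotone[of ?U "(0, 0)" r ?f])
    show "open ?U" by (intro open_Times) auto
    show "continuous_on ?U (\<lambda>s. ?f s y)" if "y \<in> {-r..r}" for y
      by (intro continuous_intros continuous_on_compose2[OF continuous_on_W(3)])
         (use that boxV in \<open>auto simp: abs_le_iff\<close>)
    show "continuous_on {-r..r} (?f s)" if "s \<in> ?U" for s
      by (intro continuous_intros continuous_on_compose2[OF continuous_on_W(3)])
         (use that boxV in \<open>auto simp: abs_le_iff\<close>)
    show "?f s y < ?f s z" if s: "s \<in> ?U" and yz: "-r \<le> y" "y < z" "z \<le> r" for s y z
    proof (rule DERIV_pos_imp_increasing[OF yz(2)])
      fix t assume t: "y \<le> t" "t \<le> z"
      obtain x p where xp: "s = (x, p)" by (cases s)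
      have in_box: "(x, t) \<in> V" "c * fib (fam_y C) (x, t, p) > 0" using box[of x t p] s t yz xp by auto
      have "((\<lambda>t. (x, t, p)) has_derivative (\<lambda>h. (0, h, 0))) (at t)"
        by (auto intro!: derivative_eq_intros)
      from has_derivative_mult_right[OF has_derivative_compose[OF this fib_has_derivative[of C x t p, OF C_diff[OF in_box(1)]]], of c]
      have "((\<lambda>t. ?f s t) has_real_derivative c * fib (fam_y C) (x, t, p)) (at t)"
        by (simp add: has_field_derivative_def xp mult.assoc[symmetric] mult_commute_abs)
      with in_box show "\<exists>y. (?f s has_real_derivative y) (at t) \<and> y > 0" by blast
    qed
  qed (use r in \<open>auto simp: fib_at_origin\<close>)
  obtain A B where AB: "open A" "open B" "(0::real) \<in> A" "(0::real) \<in> B" "A \<times> B \<subseteq> U'"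
    using open_prod_elim[OF U'(1,2)] by (metis mem_Sigma_iff)
  obtain \<epsilon>1 \<epsilon>2 where \<epsilon>: "\<epsilon>1 > 0" "ball 0 \<epsilon>1 \<subseteq> A" "\<epsilon>2 > 0" "ball 0 \<epsilon>2 \<subseteq> B"
    using AB open_contains_ball by metis
  define \<rho> where "\<rho> = min \<epsilon>1 \<epsilon>2"
  have in_U': "(x, p) \<in> U'" if "\<bar>x\<bar> < \<rho>" "\<bar>p\<bar> < \<rho>" for x p
    using that \<epsilon> AB by (auto simp: \<rho>_def subset_iff dist_real_def)
  show ?thesis
  proof (rule that[of \<rho> "\<lambda>x p. Z (x, p)"])
    show "\<rho> > 0" using \<epsilon> by (simp add: \<rho>_def)
    show "continuous_on ({-\<rho><..<\<rho>} \<times> {-\<rho><..<\<rho>}) (\<lambda>(x, p). Z (x, p))"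
      using continuous_on_subset[OF Z, of "{-\<rho><..<\<rho>} \<times> {-\<rho><..<\<rho>}"] in_U' by (force simp: abs_less_iff)
    show "(x, Z (x, p)) \<in> V \<and> fib C (x, Z (x, p), p) = 0 \<and> fib (fam_y C) (x, Z (x, p), p) \<noteq> 0"
      if "\<bar>x\<bar> < \<rho>" "\<bar>p\<bar> < \<rho>" for x p
      using Zf[OF in_U'[OF that]] in_U'[OF that] U'(3) box[of x "Z (x, p)" p] c0 by fastforce
    \<comment> \<open>The whole projective line over the origin lies in the surface, and uniqueness
      places it on the graph.\<close>
    show "Z (0, p) = 0" if "\<bar>p\<bar> < \<rho>" for p
      using uniq[of "(0, p)" 0] in_U'[of 0 p] that r by (simp add: fib_at_origin)
  qed
qed

end

section \<open>The center manifold\<close>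

lemma eventually_at_prod_principal:
  fixes Q :: "real \<times> 'b \<Rightarrow> bool"
  assumes "\<forall>\<^sub>F z in at 0 \<times>\<^sub>F principal S. Q z"
  obtains d where "d > 0" "\<And>x w. x \<noteq> 0 \<Longrightarrow> \<bar>x\<bar> \<le> d \<Longrightarrow> w \<in> S \<Longrightarrow> Q (x, w)"
proof -
  obtain Pf Pg where "eventually Pf (at (0::real))" "\<forall>w\<in>S. Pg w" "\<And>x y. Pf x \<Longrightarrow> Pg y \<Longrightarrow> Q (x, y)"
    using assms unfolding eventually_prod_filter eventually_principal by blast
  then show ?thesis using that unfolding eventually_at_le by (auto simp: dist_real_def)
qed

locale axial_surface = axial_jets +
  fixes \<rho> :: real and Y :: "real \<Rightarrow> real \<Rightarrow> real"
  assumes \<rho>: "\<rho> > 0" and Y_cont: "continuous_on ({-\<rho><..<\<rho>} \<times> {-\<rho><..<\<rho>}) (\<lambda>(x, p). Y x p)"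
    and Y_surface: "\<And>x p. \<bar>x\<bar> < \<rho> \<Longrightarrow> \<bar>p\<bar> < \<rho> \<Longrightarrow>
       (x, Y x p) \<in> V \<and> fib C (x, Y x p, p) = 0 \<and> fib (fam_y C) (x, Y x p, p) \<noteq> 0"
    and Y_0: "\<And>p. \<bar>p\<bar> < \<rho> \<Longrightarrow> Y 0 p = 0"
    and chi: "e - b * a \<noteq> 0"
begin

text \<open>Limits as \<open>x\<close> tends to \<open>0\<close> with \<open>w\<close> bounded are taken along arbitrary filters; this gives both
  the uniform estimates on strips and the behaviour along a single solution.\<close>

definition \<kappa> :: real where "\<kappa> = 2 / (e - b * a)"
definition P :: "real \<Rightarrow> real \<Rightarrow> real" where "P x w = - a * x + x^2 * w"
definition Z :: "real \<Rightarrow> real \<Rightarrow> real \<times> real \<times> real" where "Z x w = (x, Y x (P x w), P x w)"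
text \<open>Inserting \<open>p = P x w\<close> into dp/dx = \<open>N / g\<close> gives
  \<open>x^2 * w' = F x w - \<kappa> * w\<close>. The constant \<open>\<kappa>\<close> is chosen to
  cancel the linear term \<open>- 2 * w / (e - b * a)\<close> in the limit of
  \<open>N / g\<close>.\<close>

definition F :: "real \<Rightarrow> real \<Rightarrow> real" where
  "F x w = \<kappa> * w + N (Z x w) / g (Z x w) + a - 2 * x * w"
definition F0 :: real where "F0 = n2 / ((e - b * a) / (2 * c)) + a"

text \<open>\<open>dF\<close> is the derivative of \<open>F\<close> in \<open>w\<close>; \<open>Ny\<close>, \<open>Np\<close>, \<open>Yp\<close> are partial derivatives of \<open>N\<close> and \<open>Y\<close>.\<close>

definition Ny :: "real \<times> real \<times> real \<Rightarrow> real" where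
  "Ny z = - (fib (fam_y (fam_x C)) z + snd (snd z) * fib (fam_y (fam_y C)) z)"
definition Np :: "real \<times> real \<times> real \<Rightarrow> real" where
  "Np z = - (fib (fam_p (fam_x C)) z + fib (fam_y C) z + snd (snd z) * fib (fam_p (fam_y C)) z)"
definition Yp :: "real \<Rightarrow> real \<Rightarrow> real" where
  "Yp x w = - (g (Z x w) / fib (fam_y C) (Z x w))"
definition dF :: "real \<Rightarrow> real \<Rightarrow> real" where
  "dF x w = \<kappa> + (Ny (Z x w) * (Yp x w * x^2) + Np (Z x w) * x^2) / g (Z x w)
     - N (Z x w) * (fib (fam_p (fam_y C)) (Z x w) * (Yp x w * x^2) + fib (fam_p (fam_p C)) (Z x w) * x^2) / (g (Z x w))^2
     - 2 * x"

lemma \<kappa>_nz: "\<kappa> \<noteq> 0" using chi by (simp add: \<kappa>_def)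

lemma Y_isCont: "\<bar>x\<bar> < \<rho> \<Longrightarrow> \<bar>p\<bar> < \<rho> \<Longrightarrow> isCont (\<lambda>(x, p). Y x p) (x, p)"
  using Y_cont by (subst (asm) continuous_on_eq_continuous_at) (auto intro!: open_Times simp: abs_less_iff)

lemma P_limits:
  assumes x: "(x \<longlongrightarrow> 0) \<F>" "\<forall>\<^sub>F i in \<F>. x i \<noteq> 0" and w: "\<forall>\<^sub>F i in \<F>. \<bar>w i\<bar> \<le> B"
  shows "((\<lambda>i. P (x i) (w i)) \<longlongrightarrow> 0) \<F>" "((\<lambda>i. Y (x i) (P (x i) (w i))) \<longlongrightarrow> 0) \<F>"
    "((\<lambda>i. Y (x i) (P (x i) (w i)) / (x i)^2) \<longlongrightarrow> - a / 2) \<F>"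
    "((\<lambda>i. g (Z (x i) (w i)) / (x i)^2) \<longlongrightarrow> (e - b * a) / (2 * c)) \<F>"
    "((\<lambda>i. N (Z (x i) (w i)) / (x i)^2 + w i / c) \<longlongrightarrow> n2) \<F>"
    "((\<lambda>i. F (x i) (w i)) \<longlongrightarrow> F0) \<F>"
proof -
  have "((\<lambda>i. (x i)^2) \<longlongrightarrow> 0^2) \<F>" by (intro tendsto_intros x)
  from bounded_mult_null[OF w] this have "((\<lambda>i. w i * (x i)^2) \<longlongrightarrow> 0) \<F>" by simp
  then have "((\<lambda>i. - a * x i + w i * (x i)^2) \<longlongrightarrow> - a * 0 + 0) \<F>" by (intro tendsto_intros x)
  then show P: "((\<lambda>i. P (x i) (w i)) \<longlongrightarrow> 0) \<F>" by (simp add: P_def mult.commute)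
  have "isCont (\<lambda>(x, p). Y x p) (0, 0)" using \<rho> by (intro Y_isCont) auto
  from isCont_tendsto_compose[OF this tendsto_Pair[OF x(1) P]]
  show Y: "((\<lambda>i. Y (x i) (P (x i) (w i))) \<longlongrightarrow> 0) \<F>" using Y_0[of 0] \<rho> by simp
  have "\<forall>\<^sub>F i in \<F>. fib C (x i, Y (x i) (P (x i) (w i)), P (x i) (w i)) = 0"
    using tendstoD[OF x(1) \<rho>] tendstoD[OF P \<rho>]
    by eventually_elim (use Y_surface in \<open>simp add: dist_real_def\<close>)
  from surface_limit[OF x Y P this]
  show y: "((\<lambda>i. Y (x i) (P (x i) (w i)) / (x i)^2) \<longlongrightarrow> - a / 2) \<F>" .
  show G: "((\<lambda>i. g (Z (x i) (w i)) / (x i)^2) \<longlongrightarrow> (e - b * a) / (2 * c)) \<F>"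
    unfolding Z_def by (rule g_limit[OF x y P])
  show N: "((\<lambda>i. N (Z (x i) (w i)) / (x i)^2 + w i / c) \<longlongrightarrow> n2) \<F>"
    unfolding Z_def by (rule N_limit[OF x y w]) (simp add: P_def)
  let ?k = "(e - b * a) / (2 * c)"
  have k: "?k \<noteq> 0" using chi c0 by simp
  \<comment> \<open>No limit of \<open>w\<close> is available, so all terms of \<open>F\<close>
    containing \<open>w\<close> are collected into one product of \<open>w\<close> with a bracket
    tending to \<open>0\<close>.\<close>
  have "((\<lambda>i. \<kappa> - 1 / c / (g (Z (x i) (w i)) / (x i)^2) - 2 * x i) \<longlongrightarrow> \<kappa> - 1 / c / ?k - 2 * 0) \<F>"
    by (intro tendsto_intros G k x)
  moreover have "\<kappa> - 1 / c / ?k - 2 * 0 = 0" using chi c0 by (simp add: \<kappa>_def field_simps)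
  ultimately have "((\<lambda>i. \<kappa> - 1 / c / (g (Z (x i) (w i)) / (x i)^2) - 2 * x i) \<longlongrightarrow> 0) \<F>" by simp
  from bounded_mult_null[OF w this]
  have "((\<lambda>i. (N (Z (x i) (w i)) / (x i)^2 + w i / c) / (g (Z (x i) (w i)) / (x i)^2) + a
      + w i * (\<kappa> - 1 / c / (g (Z (x i) (w i)) / (x i)^2) - 2 * x i)) \<longlongrightarrow> n2 / ?k + a + 0) \<F>"
    by (intro tendsto_intros N G k)
  moreover have "\<forall>\<^sub>F i in \<F>. (N (Z (x i) (w i)) / (x i)^2 + w i / c) / (g (Z (x i) (w i)) / (x i)^2) + a
      + w i * (\<kappa> - 1 / c / (g (Z (x i) (w i)) / (x i)^2) - 2 * x i) = F (x i) (w i)"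
    using x(2) tendsto_imp_eventually_ne[OF G k]
    by eventually_elim (simp add: F_def add_divide_distrib algebra_simps)
  ultimately have "((\<lambda>i. F (x i) (w i)) \<longlongrightarrow> n2 / ?k + a + 0) \<F>" by (rule Lim_transform_eventually)
  then show "((\<lambda>i. F (x i) (w i)) \<longlongrightarrow> F0) \<F>" by (simp add: F0_def)
qed

text \<open>The term \<open>Np * x^2 / g\<close> tends to \<open>- \<kappa>\<close> and cancels
  \<open>\<kappa>\<close>. The others vanish because \<open>Yp\<close> tends to \<open>0\<close>:
  \<open>g\<close> does, while the \<open>y\<close>-derivative tends to \<open>1 / c\<close>. In the
  term with \<open>N / x^2\<close>, which is bounded but need not converge, the part
  \<open>w / c\<close> is again split off.\<close>

lemma dF_limit:
  assumes x: "(x \<longlongrightarrow> 0) \<F>" "\<forall>\<^sub>F i in \<F>. x i \<noteq> 0" and w: "\<forall>\<^sub>F i in \<F>. \<bar>w i\<bar> \<le> B"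
  shows "((\<lambda>i. dF (x i) (w i)) \<longlongrightarrow> 0) \<F>"
proof -
  let ?Z = "\<lambda>i. Z (x i) (w i)" and ?k = "(e - b * a) / (2 * c)"
  note L = P_limits[OF x w]
  have k: "?k \<noteq> 0" using chi c0 by simp
  have fibl: "((\<lambda>i. fib D (?Z i)) \<longlongrightarrow> D 0 (0, 0)) \<F>" if "\<And>k. isCont (D k) (0, 0)" for D
    unfolding Z_def by (rule fib_tendsto[OF that x(1) L(2,1)])
  have fy: "((\<lambda>i. fib (fam_y C) (?Z i)) \<longlongrightarrow> 1 / c) \<F>"
    using fibl[of "fam_y C", OF isCont_C(3)] by (simp add: jety)
  have gl: "((\<lambda>i. g (?Z i)) \<longlongrightarrow> 0) \<F>"
    using fibl[of "fam_p C", OF isCont_fam_p[OF isCont_C(1)]] by (simp add: fam_p_simps jet0 jet0[unfolded One_nat_def])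
  have sZ: "snd (snd (?Z i)) = P (x i) (w i)" for i by (simp add: Z_def)
  have "((\<lambda>i. - (g (?Z i) / fib (fam_y C) (?Z i))) \<longlongrightarrow> - (0 / (1 / c))) \<F>"
    by (intro tendsto_intros gl fy) (use c0 in simp)
  then have rl: "((\<lambda>i. Yp (x i) (w i)) \<longlongrightarrow> 0) \<F>" by (simp add: Yp_def)
  have Nyl: "((\<lambda>i. Ny (?Z i)) \<longlongrightarrow> - (Dy (Dx (C 0)) (0, 0) + 0 * Dy (Dy (C 0)) (0, 0))) \<F>"
    unfolding Ny_def sZ by (intro tendsto_minus tendsto_add tendsto_mult L(1) fibl isCont_C)
  have "((\<lambda>i. Np (?Z i)) \<longlongrightarrow> - (fam_p (fam_x C) 0 (0, 0) + 1 / c + 0 * fam_p (fam_y C) 0 (0, 0))) \<F>"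
    unfolding Np_def sZ by (intro tendsto_minus tendsto_add tendsto_mult L(1) fy fibl isCont_C isCont_fam_p)
  then have Npl: "((\<lambda>i. Np (?Z i)) \<longlongrightarrow> - (1 / c)) \<F>"
    by (simp add: fam_p_simps jetx jetx[unfolded One_nat_def])
  have gyl: "((\<lambda>i. fib (fam_p (fam_y C)) (?Z i)) \<longlongrightarrow> fam_p (fam_y C) 0 (0, 0)) \<F>"
    by (intro fibl isCont_C isCont_fam_p)
  have "((\<lambda>i. fib (fam_p (fam_p C)) (?Z i)) \<longlongrightarrow> fam_p (fam_p C) 0 (0, 0)) \<F>"
    by (intro fibl isCont_C isCont_fam_p)
  then have gpl: "((\<lambda>i. fib (fam_p (fam_p C)) (?Z i)) \<longlongrightarrow> 0) \<F>"
    by (simp add: fam_p_simps jet0 fam_p_simps[unfolded One_nat_def])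
  let ?gx = "\<lambda>i. g (?Z i) / (x i)^2"
  let ?u = "\<lambda>i. (fib (fam_p (fam_y C)) (?Z i) * Yp (x i) (w i) + fib (fam_p (fam_p C)) (?Z i)) / (?gx i)^2"
  have "(?u \<longlongrightarrow> (fam_p (fam_y C) 0 (0, 0) * 0 + 0) / ?k^2) \<F>"
    by (intro tendsto_divide tendsto_add tendsto_mult tendsto_power gyl gpl rl L(4)) (use k in simp)
  then have ul: "(?u \<longlongrightarrow> 0) \<F>" by simp
  have ucl: "((\<lambda>i. w i * (?u i / c)) \<longlongrightarrow> 0) \<F>"
    by (rule bounded_mult_null[OF w]) (use tendsto_divide[OF ul tendsto_const, of c] c0 in simp)
  have "((\<lambda>i. \<kappa> + (Ny (?Z i) * Yp (x i) (w i) + Np (?Z i)) / ?gx i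
      - ((N (?Z i) / (x i)^2 + w i / c) * ?u i - w i * (?u i / c)) - 2 * x i)
    \<longlongrightarrow> \<kappa> + (- (Dy (Dx (C 0)) (0, 0) + 0 * Dy (Dy (C 0)) (0, 0)) * 0 + - (1 / c)) / ?k
      - (n2 * 0 - 0) - 2 * 0) \<F>"
    by (intro tendsto_add tendsto_diff tendsto_divide tendsto_mult tendsto_const Nyl rl Npl L(4) L(5) ul ucl x k)
  moreover have "\<kappa> + (- (Dy (Dx (C 0)) (0, 0) + 0 * Dy (Dy (C 0)) (0, 0)) * 0 + - (1 / c)) / ?k
      - (n2 * 0 - 0) - 2 * 0 = 0"
    using chi c0 by (simp add: \<kappa>_def field_simps)
  moreover have "\<forall>\<^sub>F i in \<F>. \<kappa> + (Ny (?Z i) * Yp (x i) (w i) + Np (?Z i)) / ?gx i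
      - ((N (?Z i) / (x i)^2 + w i / c) * ?u i - w i * (?u i / c)) - 2 * x i = dF (x i) (w i)"
    using x(2) tendsto_imp_eventually_ne[OF L(4) k]
  proof eventually_elim
    case (elim i)
    have "(N (?Z i) / (x i)^2 + w i / c) * ?u i - w i * (?u i / c) = N (?Z i) / (x i)^2 * ?u i"
    proof -
      have "(A + v / c) * u - v * (u / c) = A * u" for A u v :: real
        by (simp add: algebra_simps)
      then show ?thesis .
    qed
    also have "\<dots> = N (?Z i) * (fib (fam_p (fam_y C)) (?Z i) * (Yp (x i) (w i) * (x i)^2)
        + fib (fam_p (fam_p C)) (?Z i) * (x i)^2) / (g (?Z i))^2"
      using elim by (simp add: field_simps power2_eq_square)
    finally show ?case using elim by (simp add: dF_def algebra_simps)
  qed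
  ultimately show ?thesis by (auto intro: Lim_transform_eventually)
qed

lemma Z_in_W: "\<bar>x\<bar> < \<rho> \<Longrightarrow> \<bar>P x w\<bar> < \<rho> \<Longrightarrow> Z x w \<in> W"
  using Y_surface by (simp add: Z_def)

lemma F_deriv:
  assumes x: "\<bar>x\<bar> < \<rho>" "\<bar>P x w\<bar> < \<rho>" and g: "g (Z x w) \<noteq> 0"
  shows "(F x has_real_derivative dF x w) (at w)"
proof -
  have V': "(x, Y x (P x w)) \<in> V" and fy: "fib (fam_y C) (Z x w) \<noteq> 0"
    using Y_surface[OF x] by (auto simp: Z_def)
  have "(Y x has_real_derivative - g (Z x w) / fib (fam_y C) (Z x w)) (at (P x w))"
  proof (rule implicit_curve_DERIV[where F = "\<lambda>(t, y). fib C (x, y, t)"])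
    have "((\<lambda>z::real \<times> real. (x, snd z, fst z)) has_derivative (\<lambda>v. (0, snd v, fst v))) (at (P x w, Y x (P x w)))"
      by (auto intro!: derivative_eq_intros)
    from has_derivative_compose[OF this, of "fib C", simplified, OF fib_has_derivative[OF C_diff[OF V']]]
    show "((\<lambda>(t, y). fib C (x, y, t)) has_derivative
        (\<lambda>(h, k). g (Z x w) * h + fib (fam_y C) (Z x w) * k)) (at (P x w, Y x (P x w)))"
      by (simp add: case_prod_unfold Z_def add.commute)
    have "\<forall>\<^sub>F t in at (P x w). t \<in> {-\<rho><..<\<rho>}" using x by (intro eventually_at_in_open') auto
    then show "\<forall>\<^sub>F t in at (P x w). (case (t, Y x t) of (t, y) \<Rightarrow> fib C (x, y, t)) =
        (case (P x w, Y x (P x w)) of (t, y) \<Rightarrow> fib C (x, y, t))"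
      by eventually_elim (use Y_surface x in auto)
    show "isCont (Y x) (P x w)"
      using isCont_o2[where f = "\<lambda>p. (x, p)" and a = "P x w" and g = "\<lambda>(x, p). Y x p"] Y_isCont[OF x] by simp
  qed (rule fy)
  then have Yd: "(Y x has_real_derivative Yp x w) (at (P x w))" by (simp add: Yp_def)
  have Pd: "(P x has_real_derivative x^2) (at w)"
    unfolding P_def[abs_def] by (auto intro!: derivative_eq_intros)
  from DERIV_chain2[OF Yd Pd]
  have YP: "((\<lambda>w. Y x (P x w)) has_real_derivative Yp x w * x^2) (at w)" .
  have Zd: "(Z x has_derivative (\<lambda>h. (0, Yp x w * x^2 * h, x^2 * h))) (at w)"
    unfolding Z_def[abs_def]
    by (intro has_derivative_Pair has_derivative_const) (use YP Pd in \<open>simp_all add: has_field_derivative_def\<close>)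
  have Nd: "((\<lambda>w. N (Z x w)) has_real_derivative Ny (Z x w) * (Yp x w * x^2) + Np (Z x w) * x^2) (at w)"
    unfolding has_field_derivative_def
    by (rule has_derivative_eq_rhs[OF has_derivative_compose[OF Zd N_has_derivative[OF V', of "P x w", folded Z_def]]])
       (simp add: Ny_def Np_def fun_eq_iff algebra_simps, simp add: Z_def algebra_simps)
  have px: "fib (fam_y (fam_p C)) (Z x w) = fib (fam_p (fam_y C)) (Z x w)"
    by (simp add: Z_def fib_expand fam_p_partials C_diff V' fam_p_simps)
  have gd: "((\<lambda>w. g (Z x w)) has_real_derivative fib (fam_p (fam_y C)) (Z x w) * (Yp x w * x^2)
      + fib (fam_p (fam_p C)) (Z x w) * x^2) (at w)"
    unfolding has_field_derivative_def
    by (rule has_derivative_eq_rhs[OF has_derivative_compose[OF Zd fib_has_derivative[OF Cp_diff[OF V'], where p = "P x w", folded Z_def]]])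
       (simp add: px fun_eq_iff algebra_simps)
  show ?thesis
    unfolding F_def[abs_def] dF_def
    by (rule derivative_eq_intros Nd gd g refl | (use g in \<open>simp add: field_simps power2_eq_square\<close>))+
qed

lemma F_continuous:
  assumes "\<And>x w. x \<in> A \<Longrightarrow> w \<in> S \<Longrightarrow> \<bar>x\<bar> < \<rho> \<and> \<bar>P x w\<bar> < \<rho> \<and> g (Z x w) \<noteq> 0"
  shows "continuous_on (A \<times> S) (\<lambda>(x, w). F x w)"
proof -
  have Yc: "continuous_on (A \<times> S) (\<lambda>v. Y (fst v) (P (fst v) (snd v)))"
    using continuous_on_compose2[OF Y_cont, of "A \<times> S" "\<lambda>v. (fst v, P (fst v) (snd v))"] assms
    unfolding P_def by (force intro!: continuous_intros simp: abs_less_iff)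
  have Zc: "continuous_on (A \<times> S) (\<lambda>v. Z (fst v) (snd v))"
    unfolding Z_def using Yc by (auto intro!: continuous_intros simp: P_def)
  have "(\<lambda>v. Z (fst v) (snd v)) ` (A \<times> S) \<subseteq> W" using assms Z_in_W by auto
  note c = continuous_on_compose2[OF continuous_on_W(1) Zc this] continuous_on_compose2[OF continuous_on_W(2) Zc this]
  have "continuous_on (A \<times> S) (\<lambda>v. F (fst v) (snd v))"
    unfolding F_def by (intro continuous_intros c) (use assms in auto)
  then show ?thesis by (simp add: case_prod_unfold)
qed

lemma center_slope:
  obtains \<delta> w where "\<delta> > 0" "\<delta> \<le> \<rho>" "(w \<longlongrightarrow> F0 / \<kappa>) (at 0)"
    "\<And>x. \<bar>x\<bar> < \<delta> \<Longrightarrow> x \<noteq> 0 \<Longrightarrow> \<bar>P x (w x)\<bar> < \<rho> \<and> g (Z x (w x)) \<noteq> 0 \<and>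
        (w has_real_derivative - (\<kappa> * w x - F x (w x)) / x^2) (at x)"
    "\<exists>B. \<forall>\<^sub>F x in at 0. \<bar>w x\<bar> \<le> B"
proof -
  \<comment> \<open>Then \<open>\<bar>\<kappa>\<bar> * B\<close> exceeds
    \<open>\<bar>F0\<bar>\<close> by \<open>1\<close>, and the limit of \<open>F\<close> keeps it
    below this bound on a thin strip.\<close>
  define B where "B = (\<bar>F0\<bar> + 1) / \<bar>\<kappa>\<bar>"
  have B: "B \<ge> 0" "\<bar>\<kappa>\<bar> * B = \<bar>F0\<bar> + 1" using \<kappa>_nz by (simp_all add: B_def)
  let ?\<F> = "at (0::real) \<times>\<^sub>F principal {-B..B}"
  have x: "(fst \<longlongrightarrow> 0) ?\<F>" "\<forall>\<^sub>F i in ?\<F>. fst i \<noteq> 0"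
    using filterlim_fst[of "at (0::real)" "principal {-B..B}"] by (simp_all add: filterlim_at)
  have w: "\<forall>\<^sub>F i in ?\<F>. \<bar>snd i\<bar> \<le> B"
    using filterlim_snd[of "principal {-B..B}" "at (0::real)"]
    by (simp add: filterlim_principal abs_le_iff minus_le_iff conj_commute)
  note L = P_limits[OF x w]
  have k: "(e - b * a) / (2 * c) \<noteq> 0" using chi c0 by simp
  have "\<forall>\<^sub>F z in ?\<F>. \<bar>fst z\<bar> < \<rho> \<and> \<bar>P (fst z) (snd z)\<bar> < \<rho> \<and> g (Z (fst z) (snd z)) \<noteq> 0 \<and>
      \<bar>F (fst z) (snd z)\<bar> \<le> \<bar>\<kappa>\<bar> * B \<and> \<bar>dF (fst z) (snd z)\<bar> \<le> \<bar>\<kappa>\<bar> / 2"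
    using tendstoD[OF x(1) \<rho>] tendstoD[OF L(1) \<rho>] tendsto_imp_eventually_ne[OF L(4) k]
      tendstoD[OF L(6) zero_less_one] tendstoD[OF dF_limit[OF x w], of "\<bar>\<kappa>\<bar> / 2", simplified, OF \<kappa>_nz]
  proof eventually_elim
    case (elim z)
    then have "\<bar>F (fst z) (snd z) - F0\<bar> < 1" by (simp add: dist_real_def)
    then have "\<bar>F (fst z) (snd z)\<bar> \<le> \<bar>\<kappa>\<bar> * B" unfolding B(2) by linarith
    with elim show ?case by (auto simp: dist_real_def)
  qed
  \<comment> \<open>The product filter makes all estimates uniform in
    \<open>w \<in> {-B..B}\<close>. The bound \<open>\<bar>\<kappa>\<bar> / 2\<close> on
    \<open>dF\<close> will be the Lipschitz constant, strictly below
    \<open>\<bar>\<kappa>\<bar>\<close> as the contraction demands.\<close>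
  then obtain d where d: "d > 0" and good: "\<And>x w. x \<noteq> 0 \<Longrightarrow> \<bar>x\<bar> \<le> d \<Longrightarrow> w \<in> {-B..B} \<Longrightarrow>
      \<bar>x\<bar> < \<rho> \<and> \<bar>P x w\<bar> < \<rho> \<and> g (Z x w) \<noteq> 0 \<and> \<bar>F x w\<bar> \<le> \<bar>\<kappa>\<bar> * B \<and> \<bar>dF x w\<bar> \<le> \<bar>\<kappa>\<bar> / 2"
    by (rule eventually_at_prod_principal) auto
  have good': "\<bar>x\<bar> < \<rho> \<and> \<bar>P x w\<bar> < \<rho> \<and> g (Z x w) \<noteq> 0 \<and> \<bar>F x w\<bar> \<le> \<bar>\<kappa>\<bar> * B \<and> \<bar>dF x w\<bar> \<le> \<bar>\<kappa>\<bar> / 2"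
    if "x \<in> {-d..d} - {0}" "w \<in> {-B..B}" for x w
    using good[of x w] that by (auto simp: abs_le_iff)
  have Fc: "continuous_on (({-d..d} - {0}) \<times> {-B..B}) (\<lambda>(x, w). F x w)"
    by (rule F_continuous) (use good' in blast)
  have FL: "\<bar>F x u - F x v\<bar> \<le> \<bar>\<kappa>\<bar> / 2 * \<bar>u - v\<bar>"
    if "x \<in> {-d..d} - {0}" "u \<in> {-B..B}" "v \<in> {-B..B}" for x u v
  proof -
    have "norm (F x u - F x v) \<le> \<bar>\<kappa>\<bar> / 2 * norm (u - v)"
      by (rule field_differentiable_bound[of "{-B..B}" "F x" "dF x"])
         (use F_deriv good'[OF that(1)] that in \<open>auto intro: has_field_derivative_at_within\<close>)
    then show ?thesis by simp
  qed
  have Fl: "((\<lambda>(x, w). F x w) \<longlongrightarrow> F0) ?\<F>" using L(6) by (simp add: case_prod_unfold)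
  obtain w where w: "\<And>x. x \<in> {-d<..<d} - {0} \<Longrightarrow> (w has_real_derivative - (\<kappa> * w x - F x (w x)) / x^2) (at x)"
    "\<And>x. x \<in> {-d<..<d} - {0} \<Longrightarrow> \<bar>w x\<bar> \<le> B" "(w \<longlongrightarrow> F0 / \<kappa>) (at 0)"
    by (rule two_sided_solution[OF \<kappa>_nz d B(1) Fc _ FL _ _ Fl])
       (use good' \<kappa>_nz in auto)
  show ?thesis
  proof (rule that[of "min d \<rho>" w])
    fix x :: real assume "\<bar>x\<bar> < min d \<rho>" "x \<noteq> 0"
    then have x: "x \<in> {-d<..<d} - {0}" by (auto simp: abs_less_iff)
    then have "w x \<in> {-B..B}" using w(2)[OF x] by (auto simp: abs_le_iff)
    with good'[of x "w x"] x w(1)[OF x]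
    show "\<bar>P x (w x)\<bar> < \<rho> \<and> g (Z x (w x)) \<noteq> 0 \<and> (w has_real_derivative - (\<kappa> * w x - F x (w x)) / x^2) (at x)"
      by auto
  next
    have "\<forall>\<^sub>F x in at 0. x \<in> {-d<..<d} - {0}"
      using d by (intro eventually_at_in_open) auto
    then have "\<forall>\<^sub>F x in at 0. \<bar>w x\<bar> \<le> B" by (rule eventually_mono) (rule w(2))
    then show "\<exists>B. \<forall>\<^sub>F x in at 0. \<bar>w x\<bar> \<le> B" by blast
  qed (use d \<rho> w in auto)
qed

lemma saddle_node_eigenvalues:
  "has_saddle_node_eigenvalues (fib C) (lie_cartan_field (Some 0) (fib C)) (0, 0, 0)"
proof -
  let ?X = "lie_cartan_field (Some 0) (fib C)"
  have z: "(0, 0, 0) \<in> W" using V by simp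
  have \<phi>0: "\<phi> 0 = 1" by (simp add: \<phi>_def)
  have fd: "frechet_derivative (fib C) (at (0, 0, 0)) (h, k, l) = k / c" for h k l
    by (simp add: fd_fib[OF z] fib_at_origin \<phi>0)
  have Xd: "frechet_derivative ?X (at (0, 0, 0)) (h, k, l)
      = (b / c * k, 0, - (a / c * h + fib (fam_y (fam_x C)) (0, 0, 0) * k + 1 / c * l))" for h k l
    by (simp add: frechet_derivative_at[OF field_has_derivative, symmetric])
  have "frechet_derivative (fib C) (at (0, 0, 0)) (0, 1, 0) \<noteq> 0" using c0 by (simp add: fd)
  then have "frechet_derivative (fib C) (at (0, 0, 0)) \<noteq> (\<lambda>_. 0)" by metis
  moreover have "fib C differentiable (at (0, 0, 0))"
    using fib_has_derivative[of C, OF C_diff[OF V(2)]] unfolding differentiable_def by blast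
  moreover have "?X differentiable (at (0, 0, 0))"
    using field_has_derivative by (auto simp: differentiable_def)
  moreover have "?X (0, 0, 0) = 0"
    using field_eq[OF z] by (simp add: N_def fib_at_origin zero_prod_def)
  moreover have "\<exists>v\<in>surface_tangent (fib C) (0, 0, 0). v \<noteq> 0 \<and> frechet_derivative ?X (at (0, 0, 0)) v = 0"
    by (rule bexI[of _ "(1, 0, - a)"]) (simp_all only: surface_tangent_def mem_Collect_eq fd Xd, simp_all add: zero_prod_def)
  moreover have "\<exists>w\<in>surface_tangent (fib C) (0, 0, 0). w \<noteq> 0 \<and>
      (\<exists>\<nu>. \<nu> \<noteq> 0 \<and> frechet_derivative ?X (at (0, 0, 0)) w = \<nu> *\<^sub>R w)"
  proof (rule bexI[of _ "(0, 0, 1)"], intro conjI exI[of _ "- 1 / c"])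
    show "(0::real, 0::real, 1::real) \<noteq> 0" by (simp add: zero_prod_def)
    show "- 1 / c \<noteq> 0" using c0 by simp
    show "frechet_derivative ?X (at (0, 0, 0)) (0, 0, 1) = (- 1 / c) *\<^sub>R (0, 0, 1)" unfolding Xd by simp
    show "(0, 0, 1) \<in> surface_tangent (fib C) (0, 0, 0)" by (simp add: surface_tangent_def fd)
  qed
  ultimately show ?thesis
    unfolding has_saddle_node_eigenvalues_def using fib_at_origin(1) by blast
qed

text \<open>Parametrized by \<open>x\<close>, the curve has velocity \<open>(1, p x, q x)\<close>,
  and the field along it is \<open>g (\<gamma> x)\<close> times this velocity; so \<open>h\<close>
  is \<open>g\<close> along the curve and its quadratic coefficient is known from
  \<open>g_limit\<close>.\<close>

lemma center_manifold_exists: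
  "\<exists>\<gamma>. quadratic_saddle_node_along (fib C) (lie_cartan_field (Some 0) (fib C)) (0, 0, 0) \<gamma> \<and>
      transversal_to_fiber \<gamma>"
proof -
  let ?X = "lie_cartan_field (Some 0) (fib C)"
  obtain \<delta> w B where \<delta>: "\<delta> > 0" "\<delta> \<le> \<rho>" and wl: "(w \<longlongrightarrow> F0 / \<kappa>) (at 0)"
    and wd: "\<And>x. \<bar>x\<bar> < \<delta> \<Longrightarrow> x \<noteq> 0 \<Longrightarrow> \<bar>P x (w x)\<bar> < \<rho> \<and> g (Z x (w x)) \<noteq> 0 \<and>
        (w has_real_derivative - (\<kappa> * w x - F x (w x)) / x^2) (at x)"
    and wB: "\<forall>\<^sub>F x in at 0. \<bar>w x\<bar> \<le> B"
    using center_slope by metis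
  define p where "p x = P x (w x)" for x
  define y where "y x = Y x (p x)" for x
  define \<gamma> where "\<gamma> x = (x, y x, p x)" for x
  \<comment> \<open>At \<open>0\<close> the quotient is \<open>0 / 0\<close>; the value
    \<open>- a\<close> is the slope of the kernel and will be the limit.\<close>
  define q where "q x = (if x = 0 then - a else N (\<gamma> x) / g (\<gamma> x))" for x
  have \<gamma>Z: "\<gamma> x = Z x (w x)" for x by (simp add: \<gamma>_def Z_def y_def p_def)
  have p0: "p 0 = 0" and y0: "y 0 = 0" using Y_0[of 0] \<rho> by (simp_all add: p_def P_def y_def)
  have pb: "\<bar>p x\<bar> < \<rho>" if "\<bar>x\<bar> < \<delta>" for x
    using wd[OF that] p0 \<rho> by (cases "x = 0") (auto simp: p_def)
  have surf: "(x, y x) \<in> V" "fib C (\<gamma> x) = 0" "fib (fam_y C) (\<gamma> x) \<noteq> 0" if "\<bar>x\<bar> < \<delta>" for x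
    using Y_surface[of x "p x"] pb[OF that] that \<delta> by (auto simp: y_def \<gamma>_def)
  have x: "((\<lambda>x. x) \<longlongrightarrow> 0) (at (0::real))" "\<forall>\<^sub>F x in at (0::real). x \<noteq> 0"
    by (simp_all add: eventually_at_filter)
  note L = P_limits[OF x wB]
  have pd: "(p has_real_derivative q x) (at x)" if "\<bar>x\<bar> < \<delta>" for x
  proof (cases "x = 0")
    case True
    have "((\<lambda>x. - a + w x * x) \<longlongrightarrow> - a + 0) (at 0)"
      by (intro tendsto_intros bounded_mult_null[OF wB x(1)])
    then have "((\<lambda>x. p x / x) \<longlongrightarrow> - a + 0) (at 0)"
      by (rule Lim_transform_eventually)
         (use x(2) in \<open>eventually_elim, simp add: p_def P_def field_simps power2_eq_square\<close>)
    then show ?thesis using True p0 by (simp add: has_field_derivative_iff q_def)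
  next
    case False
    have "(p has_real_derivative - a + (2 * x * w x + x^2 * (- (\<kappa> * w x - F x (w x)) / x^2))) (at x)"
      unfolding p_def[abs_def] P_def
      using wd[OF that False] by (auto intro!: derivative_eq_intros)
    moreover have "- a + (2 * x * w x + x^2 * (- (\<kappa> * w x - F x (w x)) / x^2)) = q x"
      using False by (simp add: q_def \<gamma>Z F_def)
    ultimately show ?thesis by simp
  qed
  have pc: "isCont p x" if "\<bar>x\<bar> < \<delta>" for x using pd[OF that] by (rule DERIV_isCont)
  have yd: "(y has_real_derivative p x) (at x)" if xd: "\<bar>x\<bar> < \<delta>" for x
  proof -
    have ev: "\<forall>\<^sub>F t in at x. t \<in> {-\<delta><..<\<delta>}" using xd by (intro eventually_at_in_open') auto
    \<comment> \<open>Implicit differentiation along the curve. Since \<open>g * q = N\<close> and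
      \<open>N\<close> contains minus the \<open>x\<close>-derivative and \<open>- p\<close> times
      the \<open>y\<close>-derivative, the quotient simplifies to \<open>p\<close>: the curve
      satisfies dy = \<open>p\<close> dx.\<close>
    have "(y has_real_derivative - (fib (fam_x C) (\<gamma> x) + g (\<gamma> x) * q x) / fib (fam_y C) (\<gamma> x)) (at x)"
    proof (rule implicit_curve_DERIV[where F = "\<lambda>(t, y). fib C (t, y, p t)"])
      have "((\<lambda>z::real \<times> real. p (fst z)) has_derivative (\<lambda>v. q x * fst v)) (at (x, y x))"
        using has_derivative_compose[OF has_derivative_fst[OF has_derivative_ident], of p "(*) (q x)" "(x, y x)" UNIV] pd[OF xd]
        by (simp add: has_field_derivative_def)
      then have "((\<lambda>z::real \<times> real. (fst z, snd z, p (fst z))) has_derivative (\<lambda>v. (fst v, snd v, q x * fst v))) (at (x, y x))"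
        by (intro has_derivative_Pair has_derivative_fst has_derivative_snd has_derivative_ident)
      from has_derivative_compose[OF this, of "fib C", simplified, OF fib_has_derivative[OF C_diff[OF surf(1)[OF xd]]]]
      show "((\<lambda>(t, y). fib C (t, y, p t)) has_derivative
          (\<lambda>(h, k). (fib (fam_x C) (\<gamma> x) + g (\<gamma> x) * q x) * h + fib (fam_y C) (\<gamma> x) * k)) (at (x, y x))"
        by (simp add: case_prod_unfold \<gamma>_def algebra_simps)
      show "\<forall>\<^sub>F t in at x. (case (t, y t) of (t, y) \<Rightarrow> fib C (t, y, p t)) =
          (case (x, y x) of (t, y) \<Rightarrow> fib C (t, y, p t))"
        using ev by eventually_elim (use surf(2) xd in \<open>auto simp: \<gamma>_def\<close>)
      show "isCont y x"
        unfolding y_def[abs_def]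
        using isCont_o2[where f = "\<lambda>x. (x, p x)" and a = x and g = "\<lambda>(x, p). Y x p"]
          Y_isCont[of x "p x"] pb[OF xd] pc[OF xd] xd \<delta> by (simp add: isCont_Pair)
    qed (rule surf(3)[OF xd])
    moreover have "g (\<gamma> x) * q x = N (\<gamma> x)"
    proof (cases "x = 0")
      case True
      then show ?thesis by (simp add: \<gamma>_def y0 p0 fib_at_origin N_def)
    next
      case False
      then show ?thesis using wd[OF xd] by (simp add: q_def \<gamma>Z)
    qed
    then have "- (fib (fam_x C) (\<gamma> x) + g (\<gamma> x) * q x) / fib (fam_y C) (\<gamma> x) = p x"
      using surf(3)[OF xd] by (simp add: N_def \<gamma>_def)
    ultimately show ?thesis by simp
  qed
  have \<gamma>d: "(\<gamma> has_vector_derivative (1, p x, q x)) (at x)" if "\<bar>x\<bar> < \<delta>" for x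
    unfolding \<gamma>_def[abs_def]
    by (intro has_vector_derivative_Pair has_vector_derivative_id)
       (use pd[OF that] yd[OF that] in \<open>simp_all add: has_real_derivative_iff_has_vector_derivative\<close>)
  have qc: "isCont q x" if xd: "\<bar>x\<bar> < \<delta>" for x
  proof (cases "x = 0")
    case True
    \<comment> \<open>Here convergence of \<open>w\<close> to \<open>F0 / \<kappa>\<close> enters,
      not just boundedness: it makes \<open>F0 - \<kappa> * w\<close> tend to \<open>0\<close>,
      which gives \<open>p\<close> a continuous derivative at \<open>0\<close>.\<close>
    have "((\<lambda>x. F x (w x) - \<kappa> * w x - a + 2 * x * w x) \<longlongrightarrow> F0 - \<kappa> * (F0 / \<kappa>) - a + 2 * 0 * (F0 / \<kappa>)) (at 0)"
      by (intro tendsto_intros L wl)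
    then have "(q \<longlongrightarrow> F0 - \<kappa> * (F0 / \<kappa>) - a + 2 * 0 * (F0 / \<kappa>)) (at 0)"
      by (rule Lim_transform_eventually) (use x(2) in \<open>eventually_elim, simp add: q_def \<gamma>Z F_def\<close>)
    then show ?thesis using True \<kappa>_nz by (simp add: isCont_def q_def)
  next
    case False
    have zW: "\<gamma> x \<in> W" using surf(1)[OF xd] by (simp add: \<gamma>_def)
    have \<gamma>c: "isCont \<gamma> x" using has_vector_derivative_continuous[OF \<gamma>d[OF xd]] by simp
    have "isCont g (\<gamma> x)" "isCont N (\<gamma> x)"
      using continuous_on_W(1,2) zW unfolding continuous_on_eq_continuous_at[OF open_W] by blast+
    moreover have "g (\<gamma> x) \<noteq> 0" using wd[OF xd False] by (simp add: \<gamma>Z)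
    ultimately have "isCont (\<lambda>x. N (\<gamma> x) / g (\<gamma> x)) x"
      by (intro isCont_divide isCont_o2[OF \<gamma>c])
    moreover have "\<forall>\<^sub>F t in nhds x. q t = N (\<gamma> t) / g (\<gamma> t)"
      using t1_space_nhds[OF False] by eventually_elim (simp add: q_def)
    ultimately show ?thesis using isCont_cong by fastforce
  qed
  have vd: "vector_derivative \<gamma> (at x) = (1, p x, q x)" if "\<bar>x\<bar> < \<delta>" for x
    using \<gamma>d[OF that] by (rule vector_derivative_at)
  have vd0: "vector_derivative \<gamma> (at 0) = (1, 0, - a)" using vd[of 0] \<delta> p0 by (simp add: q_def)
  have "center_manifold (fib C) ?X (0, 0, 0) \<gamma> (\<lambda>x. g (\<gamma> x))"
    unfolding center_manifold_def
  proof (intro conjI exI[of _ \<delta>] ballI)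
    show "\<gamma> 0 = (0, 0, 0)" by (simp add: \<gamma>_def y0 p0)
    show "frechet_derivative ?X (at (0, 0, 0)) (vector_derivative \<gamma> (at 0)) = 0"
      unfolding vd0 frechet_derivative_at[OF field_has_derivative, symmetric] by (simp add: zero_prod_def)
    show "\<gamma> C1_differentiable_on {-\<delta><..<\<delta>}"
      unfolding C1_differentiable_on_def
    proof (intro exI conjI ballI)
      show "(\<gamma> has_vector_derivative (1, p x, q x)) (at x)" if "x \<in> {-\<delta><..<\<delta>}" for x
        using \<gamma>d that by (auto simp: abs_less_iff)
      show "continuous_on {-\<delta><..<\<delta>} (\<lambda>x. (1, p x, q x))"
        by (intro continuous_intros continuous_at_imp_continuous_on ballI pc qc) auto
    qed
    fix t assume "t \<in> {-\<delta><..<\<delta>}"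
    then have t: "\<bar>t\<bar> < \<delta>" by auto
    show "vector_derivative \<gamma> (at t) \<noteq> 0" unfolding vd[OF t] by (simp add: zero_prod_def)
    show "fib C (\<gamma> t) = 0" by (rule surf(2)[OF t])
    have "\<gamma> t \<in> W" using surf(1)[OF t] by (simp add: \<gamma>_def)
    have "g (\<gamma> t) * q t = N (\<gamma> t)"
    proof (cases "t = 0")
      case True
      then show ?thesis by (simp add: \<gamma>_def y0 p0 fib_at_origin N_def)
    next
      case False
      then show ?thesis using wd[OF t] by (simp add: q_def \<gamma>Z)
    qed
    then show "?X (\<gamma> t) = g (\<gamma> t) *\<^sub>R vector_derivative \<gamma> (at t)"
      unfolding vd[OF t] field_eq[OF \<open>\<gamma> t \<in> W\<close>] by (simp add: \<gamma>_def mult.commute)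
  qed (rule \<delta>)
  moreover have "((\<lambda>x. g (\<gamma> x) / x^2) \<longlongrightarrow> (e - b * a) / (2 * c)) (at 0)"
    using L(4) by (simp add: \<gamma>Z)
  moreover have "(e - b * a) / (2 * c) \<noteq> 0" using chi c0 by simp
  ultimately have "quadratic_saddle_node_along (fib C) ?X (0, 0, 0) \<gamma>"
    unfolding quadratic_saddle_node_along_def using saddle_node_eigenvalues by blast
  moreover have "transversal_to_fiber \<gamma>"
    unfolding transversal_to_fiber_def vd0 by (auto simp: span_singleton)
  ultimately show ?thesis by blast
qed

end

lemma (in axial_jets) saddle_node_exists:
  assumes "e - b * a \<noteq> 0"
  shows "\<exists>\<gamma>. quadratic_saddle_node_along (fib C) (lie_cartan_field (Some 0) (fib C)) (0, 0, 0) \<gamma> \<and>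
      transversal_to_fiber \<gamma>"
proof -
  obtain \<rho> Y where 1: "\<rho> > 0" "continuous_on ({-\<rho><..<\<rho>} \<times> {-\<rho><..<\<rho>}) (\<lambda>(x, p). Y x p)"
    and 2: "\<And>x p. \<bar>x\<bar> < \<rho> \<Longrightarrow> \<bar>p\<bar> < \<rho> \<Longrightarrow>
       (x, Y x p) \<in> V \<and> fib C (x, Y x p, p) = 0 \<and> fib (fam_y C) (x, Y x p, p) \<noteq> 0"
    and 3: "\<And>p. \<bar>p\<bar> < \<rho> \<Longrightarrow> Y 0 p = 0"
    by (rule implicit_surface) blast
  interpret axial_surface V C c a b e \<rho> Y
    by unfold_locales (fact 1 2 3 assms)+
  show ?thesis by (rule center_manifold_exists)
qed

section \<open>Contact of the curves\<close>

lemma rank_first_column_zero: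
  "rank (vector [vector [0, 1], vector [0, t]] :: real^2^2) = 1"
proof -
  let ?M = "vector [vector [0, 1], vector [0, t]] :: real^2^2" and ?v = "vector [1, t] :: real^2"
  have M: "?M *v x = (x $ 2) *\<^sub>R ?v" for x
    by (simp add: vec_eq_iff forall_2 matrix_vector_mult_def sum_2)
  have "range (\<lambda>x. ?M *v x) = span {?v}"
  proof -
    have "k *\<^sub>R ?v \<in> range (\<lambda>x. ?M *v x)" for k
      by (rule range_eqI[of _ _ "vector [0, k]"]) (simp add: M)
    then show ?thesis by (auto simp: span_singleton M)
  qed
  moreover have "?v \<noteq> 0" by (metis vector_2(1) zero_index zero_neq_one)
  ultimately show ?thesis by (simp add: rank_dim_range)
qed

text \<open>The relation \<open>A0 (x, y x) = 0\<close> alone forces \<open>y x\<close> to behave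
  like \<open>- a * x^2 / 2\<close>. Asking only that \<open>y\<close> tend to \<open>0\<close>
  allows use with any branch \<open>y\<close> that the definition of contact may offer.\<close>

lemma contact_limit:
  assumes V: "open V" "0 \<in> V" and C2: "Ck_on 2 A0 V" "Ck_on 2 A1 V"
    and j0: "A0 0 = 0" "Dx A0 0 = 0" "Dy A0 0 = 1" "Dx (Dx A0) 0 = a"
    and j1: "A1 0 = 0" "Dx A1 0 = 0" "Dy A1 0 = b" "Dx (Dx A1) 0 = e"
    and y: "(y \<longlongrightarrow> 0) (at 0)" and A0: "\<forall>\<^sub>F x in at 0. A0 (x, y x) = 0"
  shows "((\<lambda>x. A1 (x, y x) / x^2) \<longlongrightarrow> (e - b * a) / 2) (at 0)"
proof -
  have x: "((\<lambda>x. x) \<longlongrightarrow> 0) (at (0::real))" "\<forall>\<^sub>F x in at (0::real). x \<noteq> 0"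
    by (simp_all add: eventually_at_filter)
  have C2': "Ck_on (Suc (Suc 0)) A0 V" using C2(1) by (simp add: numeral_2_eq_2)
  have "A0 differentiable (at z)" if "z \<in> V" for z using C2' that by auto
  from partial_quotient[OF V this Ck_on_imp_continuous_on[OF Ck_on_SucD(2)[OF C2']] x(1) y]
  obtain q where q: "(q \<longlongrightarrow> Dy A0 0) (at 0)" "\<forall>\<^sub>F x in at 0. A0 (x, y x) = A0 (x, 0) + q x * y x"
    by blast
  have q1: "(q \<longlongrightarrow> 1) (at 0)" using q(1) j0 by simp
  have "((\<lambda>x. A0 (x, 0) / x^2) \<longlongrightarrow> a / 2) (at 0)"
    using second_order_x[OF V C2(1)] by (simp add: j0)
  from tendsto_minus[OF tendsto_divide[OF this q1]]
  have "((\<lambda>x. - (A0 (x, 0) / x^2 / q x)) \<longlongrightarrow> - (a / 2 / 1)) (at 0)" by simp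
  moreover have "\<forall>\<^sub>F x in at 0. - (A0 (x, 0) / x^2 / q x) = y x / x^2"
    using q(2) A0 x(2) tendsto_imp_eventually_ne[OF q1 one_neq_zero]
    by eventually_elim (simp add: field_simps eq_neg_iff_add_eq_0)
  ultimately have "((\<lambda>x. y x / x^2) \<longlongrightarrow> - (a / 2 / 1)) (at 0)"
    by (rule Lim_transform_eventually)
  from second_jet_limit[OF V C2(2) x this] show ?thesis
    by (simp add: j1 diff_divide_distrib)
qed

lemma quadratic_contact_iff:
  assumes V: "open V" "0 \<in> V" and C2: "Ck_on 2 A0 V" "Ck_on 2 A1 V"
    and j0: "A0 0 = 0" "Dx A0 0 = 0" "Dy A0 0 = 1" "Dx (Dx A0) 0 = a"
    and j1: "A1 0 = 0" "Dx A1 0 = 0" "Dy A1 0 = b" "Dx (Dx A1) 0 = e"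
  shows "quadratic_contact_at_0 A0 A1 \<longleftrightarrow> e - b * a \<noteq> 0"
proof -
  note lim = contact_limit[OF V C2 j0 j1]
  \<comment> \<open>The definition of contact quantifies existentially over \<open>y\<close>,
    \<open>s'\<close> and \<open>s2\<close>. Two evaluations of the limit of
    \<open>A1 (x, y x) / x^2\<close> determine \<open>s2\<close> for every such choice.\<close>
  have second: "s2 = e - b * a"
    if "\<delta> > 0" "y 0 = 0" "continuous_on {-\<delta><..<\<delta>} y"
      "\<And>x. x \<in> {-\<delta><..<\<delta>} \<Longrightarrow> A0 (x, y x) = 0 \<and> ((\<lambda>t. A1 (t, y t)) has_real_derivative s' x) (at x)"
      "s' 0 = 0" "(s' has_real_derivative s2) (at 0)" for y :: "real \<Rightarrow> real" and \<delta> s' s2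
  proof -
    have ev: "\<forall>\<^sub>F x in at 0. x \<in> {-\<delta><..<\<delta>}" using that(1) by (intro eventually_at_in_open') auto
    have "isCont y 0" using that(1,3) by (simp add: continuous_on_eq_continuous_at)
    then have "(y \<longlongrightarrow> 0) (at 0)" using that(2) by (simp add: isCont_def)
    moreover have "\<forall>\<^sub>F x in at 0. A0 (x, y x) = 0" using ev by eventually_elim (use that(4) in blast)
    ultimately have 1: "((\<lambda>x. A1 (x, y x) / x^2) \<longlongrightarrow> (e - b * a) / 2) (at 0)" by (rule lim)
    have "((\<lambda>x. A1 (x, y x) / x^2) \<longlongrightarrow> s2 / 2) (at 0)"
    proof (rule DERIV_second_order_quotient[where s' = s'])
      show "\<forall>\<^sub>F x in at 0. ((\<lambda>t. A1 (t, y t)) has_real_derivative s' x) (at x)"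
        using ev by eventually_elim (use that(4) in blast)
      show "isCont (\<lambda>x. A1 (x, y x)) 0" using that(4)[of 0] that(1) by (auto intro: DERIV_isCont)
      show "A1 (0, y 0) = 0" using that(2) j1 by (simp add: zero_prod_def)
    qed (rule that(5,6))+
    from tendsto_unique[OF _ this 1] show ?thesis by simp
  qed
  have rk: "rank (vector [vector [Dx A0 0, Dy A0 0], vector [Dx A1 0, Dy A1 0]] :: real^2^2) = 1"
    using rank_first_column_zero[of b] by (simp add: j0 j1)
  have C2': "Ck_on (Suc (Suc 0)) A0 V" "Ck_on (Suc (Suc 0)) A1 V" using C2 by (simp_all add: numeral_2_eq_2)
  have d: "A0 differentiable (at z)" "A1 differentiable (at z)" if "z \<in> V" for z
    using C2' that by auto
  have dd: "Dx A0 differentiable (at 0)" "Dy A0 differentiable (at 0)"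
      "Dx A1 differentiable (at 0)" "Dy A1 differentiable (at 0)"
    using C2' V by auto
  have Dyc: "continuous_on V (Dy A0)" using Ck_on_imp_continuous_on[OF Ck_on_SucD(2)[OF C2'(1)]] .
  have A0c: "continuous_on V A0" using C2(1) by (rule Ck_on_imp_continuous_on)
  obtain \<delta> y where \<delta>: "\<delta> > 0" and y0: "y 0 = 0" and yc: "continuous_on {-\<delta><..<\<delta>} y"
    and yV: "\<And>x. x \<in> {-\<delta><..<\<delta>} \<Longrightarrow> (x, y x) \<in> V \<and> A0 (x, y x) = 0 \<and> Dy A0 (x, y x) \<noteq> 0"
  proof -
    have "open {z\<in>V. Dy A0 z > 0}"
      using continuous_open_preimage[OF Dyc V(1), of "{0<..}"] by (simp add: vimage_def Int_def)
    moreover have "0 \<in> {z\<in>V. Dy A0 z > 0}" using V j0 by simp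
    ultimately obtain A B where "open A" "open B" "(0 :: real \<times> real) \<in> A \<times> B"
        "A \<times> B \<subseteq> {z\<in>V. Dy A0 z > 0}"
      by (rule open_prod_elim)
    then have AB: "open A" "open B" "0 \<in> A" "0 \<in> B" "A \<times> B \<subseteq> {z\<in>V. Dy A0 z > 0}"
      by (simp_all add: zero_prod_def)
    obtain r where r: "r > 0" "cball 0 r \<subseteq> B" using AB open_contains_cball by blast
    have box: "(x, t) \<in> V" "Dy A0 (x, t) > 0" if "x \<in> A" "t \<in> {-r..r}" for x t
    proof -
      have "t \<in> B" using that r by (auto simp: subset_iff dist_real_def abs_le_iff)
      then show "(x, t) \<in> V" "Dy A0 (x, t) > 0" using AB that by auto
    qed
    obtain U' y where U': "open U'" "0 \<in> U'" "U' \<subseteq> A" "continuous_on U' y"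
      and y: "\<And>x. x \<in> U' \<Longrightarrow> \<bar>y x\<bar> < r \<and> A0 (x, y x) = 0"
      and uniq: "\<And>x t. x \<in> U' \<Longrightarrow> \<bar>t\<bar> \<le> r \<Longrightarrow> A0 (x, t) = 0 \<Longrightarrow> t = y x"
    proof (rule implicit_function_monotone[OF AB(1,3) r(1), of "\<lambda>x t. A0 (x, t)"])
      show "continuous_on A (\<lambda>x. A0 (x, t))" if "t \<in> {-r..r}" for t
        by (intro continuous_on_compose2[OF A0c] continuous_intros) (use box that in auto)
      show "continuous_on {-r..r} (\<lambda>t. A0 (x, t))" if "x \<in> A" for x
        by (intro continuous_on_compose2[OF A0c] continuous_intros) (use box that in auto)
      show "A0 (x, t) < A0 (x, u)" if x: "x \<in> A" and tu: "-r \<le> t" "t < u" "u \<le> r" for x t u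
      proof (rule DERIV_pos_imp_increasing[OF tu(2)])
        fix v assume "t \<le> v" "v \<le> u"
        then have "v \<in> {-r..r}" using tu by auto
        from box[OF x this] has_real_derivative_along_y[OF frechet_derivative_partials[OF d(1)]]
        show "\<exists>l. ((\<lambda>t. A0 (x, t)) has_real_derivative l) (at v) \<and> l > 0" by blast
      qed
    qed (use j0 in \<open>auto simp: zero_prod_def\<close>)
    obtain \<delta> where \<delta>: "\<delta> > 0" "ball 0 \<delta> \<subseteq> U'" using U' open_contains_ball by blast
    have sub: "{-\<delta><..<\<delta>} \<subseteq> U'" using \<delta> by (auto simp: subset_iff dist_real_def abs_less_iff)
    show ?thesis
    proof (rule that[OF \<delta>(1)])
      show "y 0 = 0" using uniq[OF U'(2), of 0] r j0 by (simp add: zero_prod_def)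
      show "continuous_on {-\<delta><..<\<delta>} y" using U'(4) sub by (rule continuous_on_subset)
      fix x assume "x \<in> {-\<delta><..<\<delta>}"
      then have "x \<in> U'" using sub by blast
      moreover from this have "y x \<in> {-r..r}" using y[of x] by (auto simp: abs_less_iff)
      ultimately show "(x, y x) \<in> V \<and> A0 (x, y x) = 0 \<and> Dy A0 (x, y x) \<noteq> 0"
        using y[of x] box[of x "y x"] U'(3) by auto
    qed
  qed
  define y' where "y' x = - Dx A0 (x, y x) / Dy A0 (x, y x)" for x
  define s' where "s' x = Dx A1 (x, y x) + Dy A1 (x, y x) * y' x" for x
  have yd: "(y has_real_derivative y' x) (at x)" if x: "x \<in> {-\<delta><..<\<delta>}" for x
    unfolding y'_def
  proof (rule implicit_curve_DERIV[OF frechet_derivative_partials[OF d(1)]])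
    have "\<forall>\<^sub>F t in at x. t \<in> {-\<delta><..<\<delta>}" using x by (intro eventually_at_in_open') auto
    then show "\<forall>\<^sub>F t in at x. A0 (t, y t) = A0 (x, y x)" by eventually_elim (use yV x in simp)
    show "isCont y x" using yc x by (simp add: continuous_on_eq_continuous_at)
  qed (use yV x in auto)
  have comp: "((\<lambda>t. D (t, y t)) has_real_derivative Dx D (x, y x) + Dy D (x, y x) * y' x) (at x)"
    if x: "x \<in> {-\<delta><..<\<delta>}" and D: "D differentiable (at (x, y x))" for x and D :: "real \<times> real \<Rightarrow> real"
  proof -
    have "((\<lambda>t. (t, y t)) has_derivative (\<lambda>h. (h, y' x * h))) (at x)"
      using yd[OF x] by (intro has_derivative_Pair has_derivative_ident) (simp add: has_field_derivative_def)
    from has_derivative_compose[OF this frechet_derivative_partials[OF D]]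
    show ?thesis
      unfolding has_field_derivative_def by (rule has_derivative_eq_rhs) (simp add: fun_eq_iff algebra_simps)
  qed
  have zy: "(0, y 0) = 0" using y0 by (simp add: zero_prod_def)
  have z\<delta>: "0 \<in> {-\<delta><..<\<delta>}" using \<delta> by simp
  have s'0: "s' 0 = 0" by (simp add: s'_def y'_def zy j0 j1)
  note dc = dd[folded zy]
  note dd0 = comp[OF z\<delta> dc(1)] comp[OF z\<delta> dc(2)] comp[OF z\<delta> dc(3)] comp[OF z\<delta> dc(4)]
  \<comment> \<open>Only existence is shown; the value of \<open>s2\<close> then follows from
    \<open>second\<close>.\<close>
  have "\<exists>s2. (s' has_real_derivative s2) (at 0)"
  proof -
    have "Dy A0 (0, y 0) \<noteq> 0" unfolding zy by (simp add: j0)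
    from DERIV_divide[OF DERIV_minus[OF dd0(1)] dd0(2) this]
    obtain l where "(y' has_real_derivative l) (at 0)" unfolding y'_def[abs_def] by blast
    from DERIV_add[OF dd0(3) DERIV_mult[OF dd0(4) this]] show ?thesis
      unfolding s'_def[abs_def] by blast
  qed
  then obtain s2 where s2: "(s' has_real_derivative s2) (at 0)" by blast
  have wit: "A0 (x, y x) = 0 \<and> ((\<lambda>t. A1 (t, y t)) has_real_derivative s' x) (at x)"
    if "x \<in> {-\<delta><..<\<delta>}" for x
    using yV[OF that] comp[OF that d(2)] by (simp add: s'_def)
  have s2_eq: "s2 = e - b * a" by (rule second[OF \<delta> y0 yc wit s'0 s2])
  show ?thesis
  proof
    assume "quadratic_contact_at_0 A0 A1"
    then obtain y \<delta> s' s2 where *: "\<delta> > 0" "y 0 = 0" "continuous_on {-\<delta><..<\<delta>} y"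
      "\<forall>x\<in>{-\<delta><..<\<delta>}. A0 (x, y x) = 0 \<and> ((\<lambda>t. A1 (t, y t)) has_real_derivative s' x) (at x)"
      "s' 0 = 0" "(s' has_real_derivative s2) (at 0)" and "s2 \<noteq> 0"
      unfolding quadratic_contact_at_0_def by blast
    moreover have "s2 = e - b * a" by (rule second[OF *(1-3) bspec[OF *(4)] *(5,6)])
    ultimately show "e - b * a \<noteq> 0" by simp
  next
    assume "e - b * a \<noteq> 0"
    then show "quadratic_contact_at_0 A0 A1"
      unfolding quadratic_contact_at_0_def using rk \<delta> y0 yc wit s'0 s2 s2_eq by blast
  qed
qed

section \<open>The equation of axial lines in a Monge chart\<close>

lemma vector_4:
  "(vector [x, y, z, w] :: 'a::zero^4) $ 1 = x" "(vector [x, y, z, w] :: 'a::zero^4) $ 2 = y"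
  "(vector [x, y, z, w] :: 'a::zero^4) $ 3 = z" "(vector [x, y, z, w] :: 'a::zero^4) $ 4 = w"
  unfolding vector_def by simp_all

lemma inner_vector_4:
  "(vector [x, y, z, w] :: real^4) \<bullet> vector [x', y', z', w'] = x * x' + y * y' + z * z' + w * w'"
  by (simp add: inner_vec_def sum_4 vector_4)

lemma has_derivative_vector_4:
  fixes f1 f2 f3 f4 :: "'a::real_normed_vector \<Rightarrow> real"
  assumes "(f1 has_derivative f1') (at z)" "(f2 has_derivative f2') (at z)"
    "(f3 has_derivative f3') (at z)" "(f4 has_derivative f4') (at z)"
  shows "((\<lambda>z. vector [f1 z, f2 z, f3 z, f4 z] :: real^4) has_derivative
    (\<lambda>v. vector [f1' v, f2' v, f3' v, f4' v])) (at z)"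
proof -
  have "\<forall>k::4. ((\<lambda>z. (vector [f1 z, f2 z, f3 z, f4 z] :: real^4) $ k) has_derivative
    (\<lambda>v. (vector [f1' v, f2' v, f3' v, f4' v] :: real^4) $ k)) (at z)"
    using assms by (simp add: forall_4 vector_4)
  then show ?thesis
    by (subst has_derivative_componentwise_within) (auto simp: Basis_vec_def inner_axis)
qed

text \<open>The subtracted quotient is the inner product of the tangential parts, written with the
  inverse Gram matrix of \<open>X\<close> and \<open>Y\<close>. Consequently the left side depends
  on the tangent plane only and not on the frame.\<close>

lemma normal_projection:
  fixes X Y n1 n2 p q :: "real^4"
  assumes frame: "norm n1 = 1" "norm n2 = 1" "n1 \<bullet> n2 = 0" "X \<bullet> n1 = 0" "Y \<bullet> n1 = 0" "X \<bullet> n2 = 0" "Y \<bullet> n2 = 0"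
    and det: "det (vector [X, Y, n1, n2] :: real^4^4) \<noteq> 0"
    and gram: "(X \<bullet> X) * (Y \<bullet> Y) - (X \<bullet> Y)^2 \<noteq> 0"
  shows "(p \<bullet> n1) * (q \<bullet> n1) + (p \<bullet> n2) * (q \<bullet> n2) = p \<bullet> q -
    ((Y \<bullet> Y) * (p \<bullet> X) * (q \<bullet> X) - (X \<bullet> Y) * ((p \<bullet> X) * (q \<bullet> Y) + (p \<bullet> Y) * (q \<bullet> X))
      + (X \<bullet> X) * (p \<bullet> Y) * (q \<bullet> Y)) / ((X \<bullet> X) * (Y \<bullet> Y) - (X \<bullet> Y)^2)"
proof -
  let ?M = "vector [X, Y, n1, n2] :: real^4^4"
  have "invertible (transpose ?M)" using det by (simp add: invertible_det_nz det_transpose)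
  then obtain B where "transpose ?M ** B = mat 1" by (auto simp: invertible_def)
  then have B: "transpose ?M *v (B *v v) = v" for v
    by (metis matrix_vector_mul_assoc matrix_vector_mul_lid)
  have ex: "\<exists>s t u w. v = s *\<^sub>R X + t *\<^sub>R Y + u *\<^sub>R n1 + w *\<^sub>R n2" for v
  proof -
    define k where "k = B *v v"
    have "v = transpose ?M *v k" unfolding k_def by (rule B[symmetric])
    also have "\<dots> = k $ 1 *\<^sub>R X + k $ 2 *\<^sub>R Y + k $ 3 *\<^sub>R n1 + k $ 4 *\<^sub>R n2"
      by (simp add: vec_eq_iff matrix_vector_mult_def transpose_def sum_4 vector_4 mult.commute)
    finally show ?thesis by blast
  qed
  obtain s t u w where p: "p = s *\<^sub>R X + t *\<^sub>R Y + u *\<^sub>R n1 + w *\<^sub>R n2" using ex by blast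
  obtain s' t' u' w' where q: "q = s' *\<^sub>R X + t' *\<^sub>R Y + u' *\<^sub>R n1 + w' *\<^sub>R n2" using ex by blast
  define E F G where "E = X \<bullet> X" and "F = X \<bullet> Y" and "G = Y \<bullet> Y"
  have n: "n1 \<bullet> n1 = 1" "n2 \<bullet> n2 = 1" using frame(1,2) by (simp_all add: norm_eq_1)
  note sym = frame(3-7) frame(3-7)[unfolded inner_commute[of n1 n2] inner_commute[of X] inner_commute[of Y]]
  have F': "Y \<bullet> X = F" by (simp add: F_def inner_commute)
  have i: "p \<bullet> n1 = u" "p \<bullet> n2 = w" "q \<bullet> n1 = u'" "q \<bullet> n2 = w'"
    "p \<bullet> X = s * E + t * F" "p \<bullet> Y = s * F + t * G" "q \<bullet> X = s' * E + t' * F" "q \<bullet> Y = s' * F + t' * G"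
    "p \<bullet> q = s * s' * E + (s * t' + t * s') * F + t * t' * G + u * u' + w * w'"
    unfolding p q
    by (simp_all add: inner_add_left inner_add_right n sym F' E_def[symmetric] F_def[symmetric] G_def[symmetric]
        algebra_simps)
  have "E * G - F^2 \<noteq> 0" using gram by (simp add: E_def F_def G_def)
  moreover have "G * (s * E + t * F) * (s' * E + t' * F)
       - F * ((s * E + t * F) * (s' * F + t' * G) + (s * F + t * G) * (s' * E + t' * F))
       + E * (s * F + t * G) * (s' * F + t' * G)
     = (s * s' * E + (s * t' + t * s') * F + t * t' * G) * (E * G - F^2)"
    by algebra
  ultimately show ?thesis
    unfolding i E_def[symmetric] F_def[symmetric] G_def[symmetric] by simp
qed

text \<open>At the unit vector of angle \<open>\<theta> / 2\<close> the second form is the center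
  plus \<open>cos \<theta>\<close> times \<open>(d1, d2)\<close> plus \<open>sin \<theta>\<close>
  times \<open>(f1, f2)\<close>. The two equations say that these vectors are orthogonal and of
  equal length, so the image is a circle of radius \<open>sqrt m\<close>, a point if
  \<open>m = 0\<close>.\<close>

lemma axiumbilicI:
  assumes fr: "normal_frame \<alpha> z n1 n2"
    and I: "ff_E \<alpha> z = 1" "ff_F \<alpha> z = 0" "ff_G \<alpha> z = 1"
    and efg: "e1 = sf_e \<alpha> n1 z" "f1 = sf_f \<alpha> n1 z" "g1 = sf_g \<alpha> n1 z"
      "e2 = sf_e \<alpha> n2 z" "f2 = sf_f \<alpha> n2 z" "g2 = sf_g \<alpha> n2 z"
    and orth: "(e1 - g1) * f1 + (e2 - g2) * f2 = 0"
    and eq: "(e1 - g1)^2 + (e2 - g2)^2 = 4 * (f1^2 + f2^2)"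
  shows "axiumbilic \<alpha> z"
proof -
  have n: "n1 \<bullet> n1 = 1" "n2 \<bullet> n2 = 1" "n1 \<bullet> n2 = 0" "n2 \<bullet> n1 = 0"
    using fr by (simp_all add: normal_frame_def norm_eq_1 inner_commute)
  have nrm: "norm (s *\<^sub>R n1 + t *\<^sub>R n2) = sqrt (s^2 + t^2)" for s t
    by (simp add: norm_eq_sqrt_inner inner_add_left inner_add_right n power2_eq_square)
  have sp: "q \<in> span {n1, n2} \<longleftrightarrow> (\<exists>s t. q = s *\<^sub>R n1 + t *\<^sub>R n2)" for q
    by (auto simp: span_insert span_singleton algebra_simps)
  define d1 d2 h1 h2 where "d1 = (e1 - g1) / 2" and "d2 = (e2 - g2) / 2"
    and "h1 = (e1 + g1) / 2" and "h2 = (e2 + g2) / 2"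
  define m where "m = f1^2 + f2^2"
  have orth': "d1 * f1 + d2 * f2 = 0" using orth by (simp add: d1_def d2_def field_simps)
  have dd: "d1^2 + d2^2 = m" using eq by (simp add: d1_def d2_def m_def power_divide)
  define cen where "cen = h1 *\<^sub>R n1 + h2 *\<^sub>R n2"
  have II: "form_II \<alpha> n1 n2 z u v = cen + ((u^2 - v^2) * d1 + 2 * u * v * f1) *\<^sub>R n1
      + ((u^2 - v^2) * d2 + 2 * u * v * f2) *\<^sub>R n2" if "u^2 + v^2 = 1" for u v
  proof -
    have k: "e * u^2 + 2 * f * u * v + g * v^2 = (e + g) / 2 + ((u^2 - v^2) * ((e - g) / 2) + 2 * u * v * f)"
      for e f g
    proof -
      have "e * u^2 + 2 * f * u * v + g * v^2
          = (e + g) / 2 * (u^2 + v^2) + ((u^2 - v^2) * ((e - g) / 2) + 2 * u * v * f)"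
        by (simp add: field_simps)
      then show ?thesis by (simp only: that mult_1_right)
    qed
    show ?thesis
      unfolding form_II_def efg[symmetric] k cen_def h1_def h2_def d1_def d2_def
      by (simp add: scaleR_add_left add_ac)
  qed
  have I1: "form_I \<alpha> z u v = u^2 + v^2" for u v by (simp add: form_I_def I)
  have "curvature_ellipse \<alpha> n1 n2 z = {q \<in> span {n1, n2}. dist cen q = sqrt m}"
  proof (intro equalityI subsetI)
    fix q assume "q \<in> curvature_ellipse \<alpha> n1 n2 z"
    then obtain u v where uv: "u^2 + v^2 = 1" and q: "q = form_II \<alpha> n1 n2 z u v"
      by (auto simp: curvature_ellipse_def I1)
    define P Q where "P = u^2 - v^2" and "Q = 2 * u * v"
    have "P^2 + Q^2 = (u^2 + v^2)^2" by (simp add: P_def Q_def power2_eq_square algebra_simps)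
    then have PQ: "P^2 + Q^2 = 1" using uv by simp
    have q': "q = cen + ((P * d1 + Q * f1) *\<^sub>R n1 + (P * d2 + Q * f2) *\<^sub>R n2)"
      unfolding q II[OF uv] P_def Q_def by (simp add: add.assoc)
    have "(P * d1 + Q * f1)^2 + (P * d2 + Q * f2)^2
        = P^2 * (d1^2 + d2^2) + Q^2 * m + 2 * P * Q * (d1 * f1 + d2 * f2)"
      by (simp add: m_def power2_eq_square algebra_simps)
    also have "\<dots> = (P^2 + Q^2) * m" by (simp add: dd orth' algebra_simps)
    finally have "(P * d1 + Q * f1)^2 + (P * d2 + Q * f2)^2 = m" by (simp add: PQ)
    moreover have "dist cen q = norm ((P * d1 + Q * f1) *\<^sub>R n1 + (P * d2 + Q * f2) *\<^sub>R n2)"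
      unfolding q' by (metis dist_norm norm_minus_commute add_diff_cancel_left')
    ultimately have "dist cen q = sqrt m" by (simp only: nrm)
    moreover have "q = (h1 + (P * d1 + Q * f1)) *\<^sub>R n1 + (h2 + (P * d2 + Q * f2)) *\<^sub>R n2"
      unfolding q' cen_def by (simp add: algebra_simps)
    ultimately show "q \<in> {q \<in> span {n1, n2}. dist cen q = sqrt m}" using sp by blast
  next
    fix q assume "q \<in> {q \<in> span {n1, n2}. dist cen q = sqrt m}"
    then obtain s t where q: "q = s *\<^sub>R n1 + t *\<^sub>R n2" and dq: "dist cen q = sqrt m" using sp by blast
    define s' t' where "s' = s - h1" and "t' = t - h2"
    have q': "q = cen + s' *\<^sub>R n1 + t' *\<^sub>R n2" by (simp add: q cen_def s'_def t'_def algebra_simps)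
    have "cen - q = (- s') *\<^sub>R n1 + (- t') *\<^sub>R n2" by (simp add: q')
    then have "sqrt (s'^2 + t'^2) = sqrt m" using dq nrm[of "- s'" "- t'"] by (simp add: dist_norm)
    then have st: "s'^2 + t'^2 = m" by simp
    have "\<exists>P Q. P^2 + Q^2 = 1 \<and> s' = P * d1 + Q * f1 \<and> t' = P * d2 + Q * f2"
    proof (cases "m = 0")
      case True
      then have "f1 = 0" "f2 = 0" "d1 = 0" "d2 = 0" "s' = 0" "t' = 0"
        using dd st by (simp_all add: m_def sum_power2_eq_zero_iff)
      then show ?thesis by (intro exI[of _ 1] exI[of _ 0]) simp
    next
      case False
      have "(d1 * f2 - d2 * f1)^2 = (d1^2 + d2^2) * (f1^2 + f2^2) - (d1 * f1 + d2 * f2)^2"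
        by (simp add: power2_eq_square algebra_simps)
      then have W: "(d1 * f2 - d2 * f1)^2 = m^2" unfolding dd orth' m_def[symmetric] by (simp add: power2_eq_square)
      define P Q where "P = (s' * d1 + t' * d2) / m" and "Q = (s' * f1 + t' * f2) / m"
      have rel: "d1^2 + f1^2 = m" "d2^2 + f2^2 = m" "d1 * d2 + f1 * f2 = 0"
      proof -
        \<comment> \<open>In the plane, orthogonal vectors of equal length differ by a quarter turn;
          the sign of their determinant decides which one.\<close>
        have "(d1 = f2 \<and> d2 = - f1) \<or> (d1 = - f2 \<and> d2 = f1)"
        proof -
          have "d1 * f2 - d2 * f1 = m \<or> d1 * f2 - d2 * f1 = - m" using W by (simp add: power2_eq_iff)
          then show ?thesis
          proof
            assume "d1 * f2 - d2 * f1 = m"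
            then have "(d1 - f2)^2 + (d2 + f1)^2 = 0"
              using dd by (simp add: m_def power2_eq_square algebra_simps)
            then show ?thesis by (simp add: sum_power2_eq_zero_iff)
          next
            assume "d1 * f2 - d2 * f1 = - m"
            then have "(d1 + f2)^2 + (d2 - f1)^2 = 0"
              using dd by (simp add: m_def power2_eq_square algebra_simps)
            then show ?thesis by (simp add: sum_power2_eq_zero_iff)
          qed
        qed
        then show "d1^2 + f1^2 = m" "d2^2 + f2^2 = m" "d1 * d2 + f1 * f2 = 0"
          by (auto simp: m_def)
      qed
      have "P * d1 + Q * f1 = (s' * (d1^2 + f1^2) + t' * (d1 * d2 + f1 * f2)) / m"
        by (simp add: P_def Q_def add_divide_distrib[symmetric] power2_eq_square algebra_simps)
      then have 1: "P * d1 + Q * f1 = s'" using rel False by simp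
      have "P * d2 + Q * f2 = (s' * (d1 * d2 + f1 * f2) + t' * (d2^2 + f2^2)) / m"
        by (simp add: P_def Q_def add_divide_distrib[symmetric] power2_eq_square algebra_simps)
      then have 2: "P * d2 + Q * f2 = t'" using rel False by simp
      have "m = (P * d1 + Q * f1)^2 + (P * d2 + Q * f2)^2" by (simp add: 1 2 st)
      also have "\<dots> = P^2 * (d1^2 + d2^2) + Q^2 * m + 2 * P * Q * (d1 * f1 + d2 * f2)"
        by (simp add: m_def power2_eq_square algebra_simps)
      also have "\<dots> = (P^2 + Q^2) * m" by (simp add: dd orth' algebra_simps)
      finally have "P^2 + Q^2 = 1" using False by simp
      with 1 2 show ?thesis by metis
    qed
    then obtain P Q where PQ: "P^2 + Q^2 = 1" and s': "s' = P * d1 + Q * f1" and t': "t' = P * d2 + Q * f2" by blast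
    \<comment> \<open>The angle is halved below because \<open>P\<close> and \<open>Q\<close> are
      the double-angle functions of \<open>u\<close> and \<open>v\<close>.\<close>
    obtain \<theta> where \<theta>: "P = cos \<theta>" "Q = sin \<theta>" using sincos_total_2pi[OF PQ] by metis
    define u v where "u = cos (\<theta> / 2)" and "v = sin (\<theta> / 2)"
    have uv: "u^2 + v^2 = 1" by (simp add: u_def v_def)
    have "P = u^2 - v^2" "Q = 2 * u * v"
      using cos_double[of "\<theta> / 2"] sin_double[of "\<theta> / 2"] by (simp_all add: \<theta> u_def v_def)
    then have "q = form_II \<alpha> n1 n2 z u v" unfolding II[OF uv] q' s' t' by simp
    then show "q \<in> curvature_ellipse \<alpha> n1 n2 z"
      using uv by (force simp: curvature_ellipse_def I1)
  qed
  moreover have "cen \<in> span {n1, n2}" using sp cen_def by blast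
  moreover have "sqrt m \<ge> 0" by (simp add: m_def)
  ultimately show ?thesis unfolding axiumbilic_def using fr by blast
qed

text \<open>The index counts the power of dy. The value \<open>0\<close> beyond \<open>4\<close>
  lets the conditions of \<open>axial_jets\<close>, imposed on all indices, hold.\<close>

definition axial_coeff ::
    "(real \<times> real \<Rightarrow> real^4) \<Rightarrow> (real \<times> real \<Rightarrow> real^4) \<Rightarrow> (real \<times> real \<Rightarrow> real^4)
      \<Rightarrow> nat \<Rightarrow> real \<times> real \<Rightarrow> real" where
  "axial_coeff \<alpha> N1 N2 k z =
     (let E = ff_E \<alpha> z; F = ff_F \<alpha> z; G = ff_G \<alpha> z;
          A0 = axial_A0 \<alpha> N1 N2 z; A1 = axial_A1 \<alpha> N1 N2 z
      in if k = 0 then A0 * E^3 else if k = 1 then A1 * E^3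
         else if k = 2 then - 6 * A0 * G * E^2 + 3 * A1 * F * E^2
         else if k = 3 then - 8 * A0 * E * F * G + A1 * E * (4 * F^2 - E * G)
         else if k = 4 then A0 * G * (E * G - 4 * F^2) + A1 * F * (2 * F^2 - E * G) else 0)"

lemma axial_form_coeff:
  "axial_form \<alpha> N1 N2 z u v = axial_coeff \<alpha> N1 N2 0 z * u^4 + axial_coeff \<alpha> N1 N2 1 z * u^3 * v
     + axial_coeff \<alpha> N1 N2 2 z * u^2 * v^2 + axial_coeff \<alpha> N1 N2 3 z * u * v^3 + axial_coeff \<alpha> N1 N2 4 z * v^4"
  by (simp add: axial_form_def axial_coeff_def Let_def algebra_simps)

lemma lie_cartan_fun_Some: "lie_cartan_fun \<alpha> N1 N2 (Some l) = fib (axial_coeff \<alpha> N1 N2)"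
  by (auto simp: fun_eq_iff fib_expand axial_form_coeff)

text \<open>The chart \<open>q = dx/dy\<close> reverses the order of the coefficients. For
  \<open>k > 4\<close> the truncated difference repeats \<open>C 0\<close>, but \<open>fib\<close>
  stops at \<open>4\<close>.\<close>

lemma lie_cartan_fun_None: "lie_cartan_fun \<alpha> N1 N2 None = fib (\<lambda>k. axial_coeff \<alpha> N1 N2 (4 - k))"
  by (auto simp: fun_eq_iff fib_expand axial_form_coeff)

section \<open>Regularity of the coefficients in a Monge chart\<close>

locale monge_patch =
  fixes V :: "(real \<times> real) set" and R S :: "real \<times> real \<Rightarrow> real" and N1 N2 :: "real \<times> real \<Rightarrow> real^4"
  assumes V: "open V" and R5: "Ck_on 5 R V" and S5: "Ck_on 5 S V"
    and frame: "\<And>z. z \<in> V \<Longrightarrow> normal_frame (monge R S) z (N1 z) (N2 z)"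
begin

abbreviation \<beta> :: "real \<times> real \<Rightarrow> real^4" where "\<beta> \<equiv> monge R S"

lemma Ck_partials:
  assumes "Ck_on (Suc k) f V"
  shows "Ck_on k (Dx f) V" "Ck_on k (Dy f) V"
  using Ck_on_SucD(2)[OF assms] by auto

lemma R_Ck: "Ck_on 4 (Dx R) V" "Ck_on 4 (Dy R) V" "Ck_on 4 (Dx S) V" "Ck_on 4 (Dy S) V"
  using Ck_partials[of 4 R] Ck_partials[of 4 S] R5 S5 by (simp_all del: Ck_on.simps)

lemma RR_Ck: "Ck_on 3 (Dx (Dx R)) V" "Ck_on 3 (Dy (Dx R)) V" "Ck_on 3 (Dy (Dy R)) V"
    "Ck_on 3 (Dx (Dx S)) V" "Ck_on 3 (Dy (Dx S)) V" "Ck_on 3 (Dy (Dy S)) V"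
  using Ck_partials[of 3 "Dx R"] Ck_partials[of 3 "Dy R"] Ck_partials[of 3 "Dx S"] Ck_partials[of 3 "Dy S"] R_Ck
  by (simp_all del: Ck_on.simps)

lemma Ck_differentiable: "Ck_on (Suc k) f V \<Longrightarrow> z \<in> V \<Longrightarrow> f differentiable (at z)"
  by simp

lemma R_diff:
  assumes "z \<in> V"
  shows "R differentiable (at z)" "S differentiable (at z)" "Dx R differentiable (at z)" "Dy R differentiable (at z)"
    "Dx S differentiable (at z)" "Dy S differentiable (at z)"
  using Ck_differentiable[of 4 R z] Ck_differentiable[of 4 S z] Ck_differentiable[of 3 "Dx R" z]
    Ck_differentiable[of 3 "Dy R" z] Ck_differentiable[of 3 "Dx S" z] Ck_differentiable[of 3 "Dy S" z]
    R5 S5 R_Ck assms by (simp_all del: Ck_on.simps)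

lemma monge_partial:
  assumes z: "z \<in> V"
  shows "frechet_derivative \<beta> (at z) v =
    vector [fst v, snd v, frechet_derivative R (at z) v, frechet_derivative S (at z) v]"
proof -
  have "(\<beta> has_derivative (\<lambda>v. vector [fst v, snd v, frechet_derivative R (at z) v, frechet_derivative S (at z) v])) (at z)"
    unfolding monge_def[abs_def]
    by (intro has_derivative_vector_4 has_derivative_fst has_derivative_snd has_derivative_ident
        iffD1[OF frechet_derivative_works] R_diff z)
  from frechet_derivative_at[OF this, symmetric] show ?thesis by simp
qed

lemma monge_second_partial:
  assumes z: "z \<in> V"
    and d: "(\<lambda>w. frechet_derivative R (at w) u) differentiable (at z)"
      "(\<lambda>w. frechet_derivative S (at w) u) differentiable (at z)"
  shows "frechet_derivative (\<lambda>w. frechet_derivative \<beta> (at w) u) (at z) v =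
    vector [0, 0, frechet_derivative (\<lambda>w. frechet_derivative R (at w) u) (at z) v,
      frechet_derivative (\<lambda>w. frechet_derivative S (at w) u) (at z) v]"
proof -
  let ?D = "\<lambda>v. vector [0, 0, frechet_derivative (\<lambda>w. frechet_derivative R (at w) u) (at z) v,
      frechet_derivative (\<lambda>w. frechet_derivative S (at w) u) (at z) v] :: real^4"
  have "((\<lambda>w. vector [fst u, snd u, frechet_derivative R (at w) u, frechet_derivative S (at w) u] :: real^4) has_derivative
     ?D) (at z)"
    by (intro has_derivative_vector_4 has_derivative_const iffD1[OF frechet_derivative_works] d)
  then have "((\<lambda>w. frechet_derivative \<beta> (at w) u) has_derivative
     ?D) (at z)"
    by (rule has_derivative_transform_within_open[OF _ V z]) (simp add: monge_partial)
  from frechet_derivative_at[OF this, symmetric] show ?thesis by simp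
qed

definition E where "E z = 1 + (Dx R z)^2 + (Dx S z)^2"
definition F where "F z = Dx R z * Dy R z + Dx S z * Dy S z"
definition G where "G z = 1 + (Dy R z)^2 + (Dy S z)^2"

lemma first_form:
  assumes "z \<in> V"
  shows "ff_E \<beta> z = E z" "ff_F \<beta> z = F z" "ff_G \<beta> z = G z"
  by (simp_all add: ff_E_def ff_F_def ff_G_def E_def F_def G_def monge_partial[OF assms] inner_vector_4 power2_eq_square)

lemma gram_pos: "E z * G z - (F z)^2 > 0"
proof -
  have "E z * G z - (F z)^2 = 1 + (Dx R z)^2 + (Dx S z)^2 + (Dy R z)^2 + (Dy S z)^2
      + (Dx R z * Dy S z - Dx S z * Dy R z)^2"
    by (simp add: E_def F_def G_def power2_eq_square algebra_simps)
  then show ?thesis by (simp add: add_pos_nonneg)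
qed

lemma form_Ck: "Ck_on 3 E V" "Ck_on 3 F V" "Ck_on 3 G V"
  unfolding E_def[abs_def] F_def[abs_def] G_def[abs_def]
  using R_Ck[THEN Ck_on_mono, of 3] by (simp_all add: Ck_on_intros V del: Ck_on.simps)

text \<open>The frame is chosen point by point and may jump, so a single coefficient such as
  \<open>sf_e\<close> may be discontinuous. By \<open>normal_projection\<close> the frame-invariant
  products are rational in derivatives of \<open>R\<close> and \<open>S\<close>, with the positive
  Gram determinant as denominator.\<close>

lemma normal_product_Ck:
  assumes "Ck_on 3 p3 V" "Ck_on 3 p4 V" "Ck_on 3 q3 V" "Ck_on 3 q4 V"
    and p: "\<And>z. z \<in> V \<Longrightarrow> p z = vector [0, 0, p3 z, p4 z]" and q: "\<And>z. z \<in> V \<Longrightarrow> q z = vector [0, 0, q3 z, q4 z]"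
  shows "Ck_on 3 (\<lambda>z. (p z \<bullet> N1 z) * (q z \<bullet> N1 z) + (p z \<bullet> N2 z) * (q z \<bullet> N2 z)) V"
proof -
  let ?h = "\<lambda>z. p3 z * q3 z + p4 z * q4 z -
     (G z * (p3 z * Dx R z + p4 z * Dx S z) * (q3 z * Dx R z + q4 z * Dx S z)
      - F z * ((p3 z * Dx R z + p4 z * Dx S z) * (q3 z * Dy R z + q4 z * Dy S z)
               + (p3 z * Dy R z + p4 z * Dy S z) * (q3 z * Dx R z + q4 z * Dx S z))
      + E z * (p3 z * Dy R z + p4 z * Dy S z) * (q3 z * Dy R z + q4 z * Dy S z)) / (E z * G z - (F z)^2)"
  have 1: "Ck_on 3 ?h V"
    using R_Ck[THEN Ck_on_mono, of 3] gram_pos[THEN less_imp_neq] assms(1-4)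
    by (intro Ck_on_intros V form_Ck) (simp_all add: gram_pos[THEN less_imp_neq, symmetric] del: Ck_on.simps)
  have 2: "?h z = (p z \<bullet> N1 z) * (q z \<bullet> N1 z) + (p z \<bullet> N2 z) * (q z \<bullet> N2 z)" if z: "z \<in> V" for z
  proof -
    have fr: "normal_frame \<beta> z (N1 z) (N2 z)" using frame[OF z] .
    have g: "Dx \<beta> z \<bullet> Dx \<beta> z = E z" "Dx \<beta> z \<bullet> Dy \<beta> z = F z" "Dy \<beta> z \<bullet> Dy \<beta> z = G z"
      using first_form[OF z] by (simp_all add: ff_E_def ff_F_def ff_G_def)
    have i: "p z \<bullet> q z = p3 z * q3 z + p4 z * q4 z"
      "p z \<bullet> Dx \<beta> z = p3 z * Dx R z + p4 z * Dx S z" "p z \<bullet> Dy \<beta> z = p3 z * Dy R z + p4 z * Dy S z"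
      "q z \<bullet> Dx \<beta> z = q3 z * Dx R z + q4 z * Dx S z" "q z \<bullet> Dy \<beta> z = q3 z * Dy R z + q4 z * Dy S z"
      by (simp_all add: p[OF z] q[OF z] monge_partial[OF z] inner_vector_4)
    have "(Dx \<beta> z \<bullet> Dx \<beta> z) * (Dy \<beta> z \<bullet> Dy \<beta> z) - (Dx \<beta> z \<bullet> Dy \<beta> z)^2 \<noteq> 0"
      using gram_pos[of z] by (simp add: g)
    with fr normal_projection[of "N1 z" "N2 z" "Dx \<beta> z" "Dy \<beta> z" "p z" "q z"]
    show ?thesis by (simp add: normal_frame_def g i)
  qed
  show ?thesis by (rule iffD1[OF Ck_on_cong[OF V 2] 1])
qed

lemma second_derivatives:
  assumes "z \<in> V"
  shows "Dx (Dx \<beta>) z = vector [0, 0, Dx (Dx R) z, Dx (Dx S) z]"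
    "Dy (Dx \<beta>) z = vector [0, 0, Dy (Dx R) z, Dy (Dx S) z]"
    "Dy (Dy \<beta>) z = vector [0, 0, Dy (Dy R) z, Dy (Dy S) z]"
  using R_diff[OF assms] by (simp_all add: monge_second_partial[OF assms])

lemma second_form_Ck:
  "Ck_on 3 (\<lambda>z. sf_e \<beta> (N1 z) z * sf_e \<beta> (N1 z) z + sf_e \<beta> (N2 z) z * sf_e \<beta> (N2 z) z) V"
  "Ck_on 3 (\<lambda>z. sf_e \<beta> (N1 z) z * sf_f \<beta> (N1 z) z + sf_e \<beta> (N2 z) z * sf_f \<beta> (N2 z) z) V"
  "Ck_on 3 (\<lambda>z. sf_e \<beta> (N1 z) z * sf_g \<beta> (N1 z) z + sf_e \<beta> (N2 z) z * sf_g \<beta> (N2 z) z) V"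
  "Ck_on 3 (\<lambda>z. sf_f \<beta> (N1 z) z * sf_f \<beta> (N1 z) z + sf_f \<beta> (N2 z) z * sf_f \<beta> (N2 z) z) V"
  "Ck_on 3 (\<lambda>z. sf_f \<beta> (N1 z) z * sf_g \<beta> (N1 z) z + sf_f \<beta> (N2 z) z * sf_g \<beta> (N2 z) z) V"
  "Ck_on 3 (\<lambda>z. sf_g \<beta> (N1 z) z * sf_g \<beta> (N1 z) z + sf_g \<beta> (N2 z) z * sf_g \<beta> (N2 z) z) V"
  unfolding sf_e_def sf_f_def sf_g_def
  by (rule normal_product_Ck[OF RR_Ck(1) RR_Ck(4) RR_Ck(1) RR_Ck(4) second_derivatives(1) second_derivatives(1)]
      normal_product_Ck[OF RR_Ck(1) RR_Ck(4) RR_Ck(2) RR_Ck(5) second_derivatives(1) second_derivatives(2)]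
      normal_product_Ck[OF RR_Ck(1) RR_Ck(4) RR_Ck(3) RR_Ck(6) second_derivatives(1) second_derivatives(3)]
      normal_product_Ck[OF RR_Ck(2) RR_Ck(5) RR_Ck(2) RR_Ck(5) second_derivatives(2) second_derivatives(2)]
      normal_product_Ck[OF RR_Ck(2) RR_Ck(5) RR_Ck(3) RR_Ck(6) second_derivatives(2) second_derivatives(3)]
      normal_product_Ck[OF RR_Ck(3) RR_Ck(6) RR_Ck(3) RR_Ck(6) second_derivatives(3) second_derivatives(3)]; assumption)+

lemma axial_coeff_Ck: "Ck_on 3 (axial_coeff \<beta> N1 N2 k) V"
proof -
  define ee ef eg ff' fg gg where
    "ee = (\<lambda>z. sf_e \<beta> (N1 z) z * sf_e \<beta> (N1 z) z + sf_e \<beta> (N2 z) z * sf_e \<beta> (N2 z) z)" and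
    "ef = (\<lambda>z. sf_e \<beta> (N1 z) z * sf_f \<beta> (N1 z) z + sf_e \<beta> (N2 z) z * sf_f \<beta> (N2 z) z)" and
    "eg = (\<lambda>z. sf_e \<beta> (N1 z) z * sf_g \<beta> (N1 z) z + sf_e \<beta> (N2 z) z * sf_g \<beta> (N2 z) z)" and
    "ff' = (\<lambda>z. sf_f \<beta> (N1 z) z * sf_f \<beta> (N1 z) z + sf_f \<beta> (N2 z) z * sf_f \<beta> (N2 z) z)" and
    "fg = (\<lambda>z. sf_f \<beta> (N1 z) z * sf_g \<beta> (N1 z) z + sf_f \<beta> (N2 z) z * sf_g \<beta> (N2 z) z)" and
    "gg = (\<lambda>z. sf_g \<beta> (N1 z) z * sf_g \<beta> (N1 z) z + sf_g \<beta> (N2 z) z * sf_g \<beta> (N2 z) z)"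
  note S = second_form_Ck[folded ee_def ef_def eg_def ff'_def fg_def gg_def]
  define A1 where "A1 z = 4 * G z * (E z * G z - 4 * (F z)^2) * ee z + 32 * E z * F z * G z * ef z
         + 4 * (E z)^3 * gg z - 8 * (E z)^2 * G z * eg z - 16 * (E z)^2 * G z * ff' z" for z
  define A0 where "A0 z = 4 * F z * (E z * G z - 2 * (F z)^2) * ee z - 4 * E z * (E z * G z - 4 * (F z)^2) * ef z
         + 4 * (E z)^3 * fg z - 4 * (E z)^2 * F z * eg z - 8 * (E z)^2 * F z * ff' z" for z
  have A1: "axial_A1 \<beta> N1 N2 z = A1 z" and A0: "axial_A0 \<beta> N1 N2 z = A0 z" if "z \<in> V" for z
    by (simp_all add: axial_A1_def axial_A0_def Let_def first_form[OF that] A1_def A0_def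
        ee_def ef_def eg_def ff'_def fg_def gg_def power2_eq_square)
  have A: "Ck_on 3 A1 V" "Ck_on 3 A0 V"
    unfolding A1_def[abs_def] A0_def[abs_def] by (intro Ck_on_intros V form_Ck S)+
  let ?c = "\<lambda>z. if k = 0 then A0 z * (E z)^3 else if k = 1 then A1 z * (E z)^3
         else if k = 2 then - 6 * A0 z * G z * (E z)^2 + 3 * A1 z * F z * (E z)^2
         else if k = 3 then - 8 * A0 z * E z * F z * G z + A1 z * E z * (4 * (F z)^2 - E z * G z)
         else if k = 4 then A0 z * G z * (E z * G z - 4 * (F z)^2) + A1 z * F z * (2 * (F z)^2 - E z * G z) else 0"
  have if_Ck: "Ck_on 3 (\<lambda>z. if b then f z else h z) V" if "Ck_on 3 f V" "Ck_on 3 h V"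
    for b and f h :: "real \<times> real \<Rightarrow> real"
    using that by (cases b) simp_all
  have 1: "Ck_on 3 ?c V"
    by (intro if_Ck Ck_on_intros V form_Ck A)
  have 2: "?c z = axial_coeff \<beta> N1 N2 k z" if "z \<in> V" for z
    using that by (simp add: axial_coeff_def Let_def A1 A0 first_form)
  show ?thesis by (rule iffD1[OF Ck_on_cong[OF V 2] 1])
qed

text \<open>With \<open>E = G = 1\<close> and \<open>F = 0\<close> the two coefficients reduce to
  \<open>-4\<close> times the inner product of \<open>e - g\<close> and \<open>f\<close>, and to
  \<open>4\<close> times the difference of the squared lengths of \<open>e - g\<close> and
  \<open>2 f\<close>, where \<open>e\<close>, \<open>f\<close>, \<open>g\<close> are vectors in the
  normal plane.\<close>

lemma axiumbilic_origin:
  assumes 0: "0 \<in> V" and d: "Dx R 0 = 0" "Dy R 0 = 0" "Dx S 0 = 0" "Dy S 0 = 0"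
    and c: "axial_coeff \<beta> N1 N2 0 0 = 0" "axial_coeff \<beta> N1 N2 1 0 = 0"
  shows "axiumbilic \<beta> 0"
proof -
  have I: "ff_E \<beta> 0 = 1" "ff_F \<beta> 0 = 0" "ff_G \<beta> 0 = 1"
    by (simp_all add: first_form[OF 0] E_def F_def G_def d)
  show ?thesis
  proof (rule axiumbilicI[OF frame[OF 0] I refl refl refl refl refl refl])
    let ?e1 = "sf_e \<beta> (N1 0) 0" and ?f1 = "sf_f \<beta> (N1 0) 0" and ?g1 = "sf_g \<beta> (N1 0) 0"
    let ?e2 = "sf_e \<beta> (N2 0) 0" and ?f2 = "sf_f \<beta> (N2 0) 0" and ?g2 = "sf_g \<beta> (N2 0) 0"
    have "axial_A0 \<beta> N1 N2 0 = 0" "axial_A1 \<beta> N1 N2 0 = 0"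
      using c by (simp_all add: axial_coeff_def Let_def I)
    then have "- 4 * (?e1 * ?f1 + ?e2 * ?f2) + 4 * (?f1 * ?g1 + ?f2 * ?g2) = 0"
      "4 * (?e1^2 + ?e2^2) + 4 * (?g1^2 + ?g2^2) - 8 * (?e1 * ?g1 + ?e2 * ?g2) - 16 * (?f1^2 + ?f2^2) = 0"
      by (simp_all add: axial_A0_def axial_A1_def Let_def I)
    then show "(?e1 - ?g1) * ?f1 + (?e2 - ?g2) * ?f2 = 0"
      "(?e1 - ?g1)^2 + (?e2 - ?g2)^2 = 4 * (?f1^2 + ?f2^2)"
      by (simp_all add: power2_eq_square algebra_simps)
  qed
qed

end

section \<open>Equivalence of the three conditions\<close>

lemma bigo_lincomb:
  fixes f g :: "'a \<Rightarrow> real"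
  assumes "f \<in> O[\<F>](h)" "g \<in> O[\<F>](h)" "\<And>z. k z = s * f z + t * g z"
  shows "k \<in> O[\<F>](h)"
proof -
  have "(\<lambda>z. s * f z + t * g z) \<in> O[\<F>](h)"
    using assms(1,2) by (intro sum_in_bigo) simp_all
  then show ?thesis using assms(3) by presburger
qed

text \<open>The five coefficients of the quartic are recovered from its values at the slopes
  \<open>0, 1, -1, 2, -2, \<infinity>\<close>.\<close>

lemma quartic_coeff_jets:
  fixes C :: "nat \<Rightarrow> real \<times> real \<Rightarrow> real" and a0 a1 q0 q1 :: "real \<times> real \<Rightarrow> real"
  assumes O: "\<And>u v. (\<lambda>z. c * (C 0 z * u^4 + C 1 z * u^3 * v + C 2 z * u^2 * v^2 + C 3 z * u * v^3 + C 4 z * v^4)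
        - (a0 z * (u^4 - 6 * u^2 * v^2 + v^4) + a1 z * u * v * (u^2 - v^2))) \<in> O[\<F>](h)"
    and a0: "(\<lambda>z. a0 z - q0 z) \<in> O[\<F>](h)" and a1: "(\<lambda>z. a1 z - q1 z) \<in> O[\<F>](h)"
    and c: "c \<noteq> 0"
  shows "(\<lambda>z. C 0 z - q0 z / c) \<in> O[\<F>](h)" "(\<lambda>z. C 1 z - q1 z / c) \<in> O[\<F>](h)"
    "(\<lambda>z. C 2 z - - 6 * q0 z / c) \<in> O[\<F>](h)" "(\<lambda>z. C 3 z - - q1 z / c) \<in> O[\<F>](h)"
    "(\<lambda>z. C 4 z - q0 z / c) \<in> O[\<F>](h)"
proof -
  note L = bigo_lincomb
  have e0: "(\<lambda>z. c * C 0 z - a0 z) \<in> O[\<F>](h)" using O[of 1 0] by simp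
  have e4: "(\<lambda>z. c * C 4 z - a0 z) \<in> O[\<F>](h)" using O[of 0 1] by simp
  have d1: "(\<lambda>z. c * (C 1 z + C 3 z)) \<in> O[\<F>](h)"
    by (rule L[OF O[of 1 1] O[of 1 "-1"], of _ "1/2" "-1/2"]) (simp add: algebra_simps)
  have s1: "(\<lambda>z. c * (C 0 z + C 2 z + C 4 z) + 4 * a0 z) \<in> O[\<F>](h)"
    by (rule L[OF O[of 1 1] O[of 1 "-1"], of _ "1/2" "1/2"]) (simp add: algebra_simps)
  \<comment> \<open>At the slopes \<open>1\<close> and \<open>-1\<close> the term with
    \<open>a1\<close> vanishes since \<open>u^2 = v^2\<close>; the slopes \<open>2\<close> and
    \<open>-2\<close> are the ones that reveal it.\<close>
  have d2: "(\<lambda>z. c * (2 * C 1 z + 8 * C 3 z) + 6 * a1 z) \<in> O[\<F>](h)"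
    by (rule L[OF O[of 1 2] O[of 1 "-2"], of _ "1/2" "-1/2"]) (simp add: algebra_simps)
  have e3: "(\<lambda>z. c * C 3 z + a1 z) \<in> O[\<F>](h)"
    by (rule L[OF d2 d1, of _ "1/6" "-1/3"]) (simp add: field_simps)
  have e1: "(\<lambda>z. c * C 1 z - a1 z) \<in> O[\<F>](h)"
    by (rule L[OF d1 e3, of _ 1 "-1"]) (simp add: field_simps)
  have e04: "(\<lambda>z. c * C 0 z + c * C 4 z - 2 * a0 z) \<in> O[\<F>](h)"
    by (rule L[OF e0 e4, of _ 1 1]) simp
  have e2: "(\<lambda>z. c * C 2 z + 6 * a0 z) \<in> O[\<F>](h)"
    by (rule L[OF s1 e04, of _ 1 "-1"]) (simp add: algebra_simps)
  show "(\<lambda>z. C 0 z - q0 z / c) \<in> O[\<F>](h)"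
    by (rule L[OF e0 a0, of _ "1/c" "1/c"]) (use c in \<open>simp add: field_simps\<close>)
  show "(\<lambda>z. C 1 z - q1 z / c) \<in> O[\<F>](h)"
    by (rule L[OF e1 a1, of _ "1/c" "1/c"]) (use c in \<open>simp add: field_simps\<close>)
  show "(\<lambda>z. C 2 z - - 6 * q0 z / c) \<in> O[\<F>](h)"
    by (rule L[OF e2 a0, of _ "1/c" "-6/c"]) (use c in \<open>simp add: field_simps\<close>)
  show "(\<lambda>z. C 3 z - - q1 z / c) \<in> O[\<F>](h)"
    by (rule L[OF e3 a1, of _ "1/c" "-1/c"]) (use c in \<open>simp add: field_simps\<close>)
  show "(\<lambda>z. C 4 z - q0 z / c) \<in> O[\<F>](h)"
    by (rule L[OF e4 a0, of _ "1/c" "1/c"]) (use c in \<open>simp add: field_simps\<close>)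
qed

text \<open>At \<open>q = 0\<close> only \<open>D 0\<close>, the former coefficient of dy^4,
  contributes to the \<open>y\<close>-derivative, and the last component of the field is minus this
  derivative. So the direction dx = 0 yields neither a singular point nor a zero of the
  field.\<close>

lemma not_critical_zero_vertical:
  assumes "\<And>k. D k differentiable (at (0, 0))" "Dy (D 0) (0, 0) \<noteq> 0"
  shows "\<not> critical_zero (fib D) (0, 0, 0)"
    "lie_cartan_field None (fib D) (0, 0, 0) \<noteq> 0"
proof -
  have f: "frechet_derivative (fib D) (at (0, 0, 0)) (h, k, l) =
     fib (fam_x D) (0, 0, 0) * h + fib (fam_y D) (0, 0, 0) * k + fib (fam_p D) (0, 0, 0) * l" for h k l
    by (rule fib_frechet[OF assms(1)])
  have "frechet_derivative (fib D) (at (0, 0, 0)) (0, 1, 0) \<noteq> 0"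
    using assms(2) by (simp add: f fib_expand)
  then show "\<not> critical_zero (fib D) (0, 0, 0)"
    unfolding critical_zero_def using frechet_derivative_at[of "fib D"] by metis
  show "lie_cartan_field None (fib D) (0, 0, 0) \<noteq> 0"
    using assms(2) by (simp add: f fib_expand Let_def zero_prod_def)
qed

text \<open>For \<open>b01 = 0\<close> the derivative of \<open>a1\<close> at \<open>0\<close>
  vanishes, so \<open>a1\<close> is not regular there, while conditions (ii) and (iii) then amount
  to \<open>b20 \<noteq> 0\<close>. Hence the version of (i) that includes regularity is compared
  with (ii) under \<open>b01 \<noteq> 0\<close>; quadratic contact, as defined by the Jacobian and
  the second derivative, is compared for every \<open>b01\<close>.\<close>

theorem proposition13:
  fixes r :: nat
    and \<alpha> :: "real \<times> real \<Rightarrow> real^4"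
    and U V :: "(real \<times> real) set"
    and m :: "real \<times> real"
    and R S a0 a1 :: "real \<times> real \<Rightarrow> real"
    and N1 N2 :: "real \<times> real \<Rightarrow> real^4"
    and c a20 a11 a02 b01 b20 b11 b02 :: real
  assumes "r \<ge> 5"
    and "open U" and "m \<in> U"
    and "Ck_on r \<alpha> U" and "immersion_on \<alpha> U"
    and "axiumbilic \<alpha> m"
    and "monge_chart_at r \<alpha> U m V R S"
    and "\<And>z. z \<in> V \<Longrightarrow> normal_frame (monge R S) z (N1 z) (N2 z)"
    and "Ck_on (r - 2) a0 V" and "Ck_on (r - 2) a1 V"
    and "(\<lambda>(x, y). a0 (x, y) - (y + a20 * x^2 / 2 + a11 * x * y + a02 * y^2 / 2))
           \<in> O[nhds 0](\<lambda>z. norm z ^ 3)"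
    and "(\<lambda>(x, y). a1 (x, y) - (b01 * y + b20 * x^2 / 2 + b11 * x * y + b02 * y^2 / 2))
           \<in> O[nhds 0](\<lambda>z. norm z ^ 3)"
    and "c \<noteq> 0"
    and "\<And>u v. (\<lambda>z. c * axial_form (monge R S) N1 N2 z u v
                 - (a0 z * (u^4 - 6 * u^2 * v^2 + v^4) + a1 z * u * v * (u^2 - v^2)))
           \<in> O[nhds 0](\<lambda>z. norm z ^ 3)"
  shows "(b01 \<noteq> 0 \<longrightarrow>
           (regular_curve_at_0 a0 \<and> regular_curve_at_0 a1 \<and> quadratic_contact_at_0 a0 a1
              \<longleftrightarrow> type_E145 (monge R S) N1 N2)) \<and>
         (quadratic_contact_at_0 a0 a1 \<longleftrightarrow> type_E145 (monge R S) N1 N2) \<and>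
         (type_E145 (monge R S) N1 N2 \<longleftrightarrow> lie_cartan_saddle_node (monge R S) N1 N2)"
proof -
  let ?\<beta> = "monge R S"
  define C where "C = axial_coeff ?\<beta> N1 N2"
  have mc: "open V" "0 \<in> V" "Ck_on r R V" "Ck_on r S V"
      "(R has_derivative (\<lambda>_. 0)) (at 0)" "(S has_derivative (\<lambda>_. 0)) (at 0)"
    using assms(7) by (simp_all add: monge_chart_at_def)
  interpret monge_patch V R S N1 N2
    using mc Ck_on_mono[OF mc(3), of 5] Ck_on_mono[OF mc(4), of 5] assms(1,8) by unfold_locales auto
  have a3: "Ck_on 2 a0 V" "Ck_on 2 a1 V"
    using Ck_on_mono[OF assms(9), of 2] Ck_on_mono[OF assms(10), of 2] assms(1) by auto
  define q where "q b p m n = (\<lambda>(x, y). b * y + p * x^2 / 2 + m * x * y + n * y^2 / 2)"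
    for b p m n :: real
  have h0: "(\<lambda>z. a0 z - q 1 a20 a11 a02 z) \<in> O[nhds 0](\<lambda>z. norm z ^ 3)"
    using assms(11) by (simp add: q_def case_prod_unfold)
  have h1: "(\<lambda>z. a1 z - q b01 b20 b11 b02 z) \<in> O[nhds 0](\<lambda>z. norm z ^ 3)"
    using assms(12) by (simp add: q_def case_prod_unfold)
  have jets: "D 0 = 0" "Dx D 0 = 0" "Dy D 0 = b" "Dx (Dx D) 0 = p"
    if "Ck_on 2 D V" "(\<lambda>z. D z - q b p m n z) \<in> O[nhds 0](\<lambda>z. norm z ^ 3)" for D b p m n
    using jets_of_bigo[OF mc(1,2) that(1), of b p m n] that(2) by (simp_all add: q_def case_prod_unfold)
  note j0 = jets[OF a3(1) h0] and j1 = jets[OF a3(2) h1]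
  have C3: "Ck_on 3 (C k) V" for k unfolding C_def by (rule axial_coeff_Ck)
  have C2: "Ck_on 2 (C k) V" for k by (rule Ck_on_mono[OF C3]) simp
  note O = assms(14)[unfolded axial_form_coeff, folded C_def]
  note QJ = quartic_coeff_jets[OF O h0 h1 assms(13)]
  have qs: "q b p m n z / c = q (b / c) (p / c) (m / c) (n / c) z"
    "- 6 * q b p m n z / c = q (-6 * b / c) (-6 * p / c) (-6 * m / c) (-6 * n / c) z"
    "- q b p m n z / c = q (- b / c) (- p / c) (- m / c) (- n / c) z" for b p m n z
    using assms(13) by (simp_all add: q_def case_prod_unfold field_simps)
  note J = jets[OF C2 QJ(1)[unfolded qs]] jets[OF C2 QJ(2)[unfolded qs]] jets[OF C2 QJ(3)[unfolded qs]]
    jets[OF C2 QJ(4)[unfolded qs]] jets[OF C2 QJ(5)[unfolded qs]]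
  have Cbig: "C k = (\<lambda>_. 0)" if "k > 4" for k
    using that by (auto simp: C_def axial_coeff_def Let_def fun_eq_iff)
  have k5: "k = 0 \<or> k = 1 \<or> k = 2 \<or> k = 3 \<or> k = 4 \<or> k > 4" for k :: nat by linarith
  have z: "(0::real, 0::real) = 0" by (simp add: zero_prod_def)
  interpret axial_jets V C c a20 b01 b20
  proof unfold_locales
    show "C k (0, 0) = 0" for k unfolding z using k5[of k] J Cbig[of k] by auto
    show "Dx (C k) (0, 0) = 0" for k unfolding z using k5[of k] J Cbig[of k] by auto
  qed (use mc C3 J assms(13) in \<open>simp_all add: z\<close>)
  let ?\<chi> = "b20 - b01 * a20"
  have contact: "quadratic_contact_at_0 a0 a1 \<longleftrightarrow> ?\<chi> \<noteq> 0"
    by (rule quadratic_contact_iff[OF mc(1,2) a3 j0 j1])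
  have reg: "regular_curve_at_0 a0" "b01 \<noteq> 0 \<Longrightarrow> regular_curve_at_0 a1"
  proof -
    have "a0 differentiable (at 0)" "a1 differentiable (at 0)"
      using a3 mc(2) by (simp_all add: numeral_2_eq_2)
    moreover have "frechet_derivative a0 (at 0) \<noteq> (\<lambda>_. 0)" using j0(3) by auto
    moreover have "frechet_derivative a1 (at 0) \<noteq> (\<lambda>_. 0)" if "b01 \<noteq> 0" using j1(3) that by auto
    ultimately show "regular_curve_at_0 a0" "b01 \<noteq> 0 \<Longrightarrow> regular_curve_at_0 a1"
      using j0 j1 by (simp_all add: regular_curve_at_0_def)
  qed
  have fS: "lie_cartan_fun ?\<beta> N1 N2 (Some l) = fib C" for l
    by (simp add: lie_cartan_fun_Some C_def)
  have fN: "lie_cartan_fun ?\<beta> N1 N2 None = fib (\<lambda>k. C (4 - k))"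
    by (simp add: lie_cartan_fun_None C_def)
  have oo: "over_origin (Some l) = (0, 0, l)" "over_origin None = (0, 0, 0)" for l
    by (simp_all add: over_origin_def)
  have vert: "\<not> critical_zero (lie_cartan_fun ?\<beta> N1 N2 None) (over_origin None)"
    "lie_cartan_field None (lie_cartan_fun ?\<beta> N1 N2 None) (over_origin None) \<noteq> 0"
    unfolding fN oo using not_critical_zero_vertical[of "\<lambda>k. C (4 - k)"] C_diff[OF V(2)] jety(5) c0 by auto
  have sing: "lie_cartan_singular ?\<beta> N1 N2 = Some ` {p. \<phi> p = 0}"
  proof -
    have "l \<in> lie_cartan_singular ?\<beta> N1 N2 \<longleftrightarrow> l \<in> Some ` {p. \<phi> p = 0}" for l
      using vert(1) by (cases l) (auto simp: lie_cartan_singular_def fS oo critical_zero_iff)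
    then show ?thesis by blast
  qed
  have ax: "axiumbilic ?\<beta> 0"
  proof (rule axiumbilic_origin[OF mc(2)])
    show "Dx R 0 = 0" "Dy R 0 = 0" "Dx S 0 = 0" "Dy S 0 = 0"
      using frechet_derivative_at[OF mc(5), symmetric] frechet_derivative_at[OF mc(6), symmetric] by simp_all
    show "axial_coeff ?\<beta> N1 N2 0 0 = 0" "axial_coeff ?\<beta> N1 N2 1 0 = 0"
      using jet0[of 0] jet0[of 1] by (simp_all add: C_def z)
  qed
  have type: "type_E145 ?\<beta> N1 N2 \<longleftrightarrow> ?\<chi> \<noteq> 0"
  proof -
    have "card (lie_cartan_singular ?\<beta> N1 N2) = 4"
      unfolding sing by (simp add: card_image card_roots_\<phi>(2))
    moreover have "finite (lie_cartan_singular ?\<beta> N1 N2)"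
      unfolding sing using card_roots_\<phi>(1) by simp
    \<comment> \<open>Without a root the condition on all singular points would hold vacuously and
      say nothing about \<open>b20 - b01 * a20\<close>.\<close>
    moreover have "{p. \<phi> p = 0} \<noteq> {}" using card_roots_\<phi>(2) by (metis card.empty zero_neq_numeral)
    then have "(\<forall>l\<in>lie_cartan_singular ?\<beta> N1 N2.
        nondegenerate_hessian (lie_cartan_fun ?\<beta> N1 N2 l) (over_origin l)) \<longleftrightarrow> ?\<chi> \<noteq> 0"
      unfolding sing by (auto simp: fS oo nondegenerate_iff)
    ultimately show ?thesis unfolding type_E145_def using ax by simp
  qed
  have saddle: "lie_cartan_saddle_node ?\<beta> N1 N2 \<longleftrightarrow> ?\<chi> \<noteq> 0"
  proof
    assume "lie_cartan_saddle_node ?\<beta> N1 N2"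
    then obtain l \<gamma> where l: "quadratic_saddle_node_along (lie_cartan_fun ?\<beta> N1 N2 l)
              (lie_cartan_field l (lie_cartan_fun ?\<beta> N1 N2 l)) (over_origin l) \<gamma>"
      unfolding lie_cartan_saddle_node_def by blast
    show "?\<chi> \<noteq> 0"
    proof (cases l)
      case None
      then show ?thesis using l vert(2)
        by (simp add: quadratic_saddle_node_along_def has_saddle_node_eigenvalues_def)
    next
      case (Some p)
      then show ?thesis using l saddle_node_imp by (simp add: fS oo)
    qed
  next
    assume "?\<chi> \<noteq> 0"
    then show "lie_cartan_saddle_node ?\<beta> N1 N2"
      unfolding lie_cartan_saddle_node_def using saddle_node_exists
      by (intro exI[of _ "Some 0"]) (simp add: fS oo)
  qed
  show ?thesis using contact reg type saddle by blast
qed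

end
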